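(* Let $(\mathcal C,\iota)$ be a good Q-structure, let $f:X\to Y$ be a map in $\mathcal C$, and suppose that $X$ admits points (i.e. there is a map $*\to X$). Then for every nonnegative integer $n$, $f$ is $n$-connected if and only if for all points $x$ in $X$, the map $\pi_k f:\pi_k(X,x)\to\pi_k(Y,f(x))$ is an isomorphism for $k<n$ and a surjection for $k=n$. In particular, $f$ is a weak equivalence if and only if $\pi_n f:\pi_n(X,x)\to\pi_n(Y,f(x))$ is an isomorphism for every nonnegative integer $n$ and every point $x$ in $X$.
   Context: Write $I=[0,1]$. Let $\Box$ be the full subcategory of the category $\mathsf{Top}$ of topological spaces on all cubes $I^n$ and their boundaries $\partial I^n$, $n\ge 0$ ($I^0=*$ is a point, $\partial I^0=\emptyset$), and let $\Box_{\le 2}$ be the full subcategory on $*,I,I^2,\emptyset,\partial I,\partial I^2$. For $k\in\{0,1\}$ let $e_k:*\to I$ be the inclusion of the endpoint $k$; the same symbol denotes the inclusion $*\to\partial I$. An embedding means a faithful functor. A category with intervals is a bicomplete category $\mathcal C$ with an embedding $\iota:\Box_{\le 2}\to\mathcal C$ such that: (S1) $\iota\emptyset$ is initial and $\iota *$ is terminal; (S2) $\iota I^2\cong\iota I\times\iota I$ (product in $\mathcal C$); (S3) $\iota$ preserves a pushout square in $\Box_{\le 2}$ expressing $I$ as the pushout of $I\xleftarrow{e_1}*\xrightarrow{e_0}I$ with legs $a:I\to I$ (from the $e_1$ copy) and $b:I\to I$ (from the $e_0$ copy), so $ae_1=be_0$, such that $a(0)=0$ and $b(1)=1$, and $X\times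 -$ preserves this pushout for all $X\in\mathcal C$; (S4) $\emptyset\times X\cong\emptyset$ for all $X\in\mathcal C$. Objects and maps of $\Box$ are identified with their images under $\iota$. For $X\in\mathcal C$, $e_k$ also denotes $\mathrm{id}_X\times e_k: X\to X\times I$. Let $\mathcal I=\{i_n:\partial I^n\hookrightarrow I^n\}_{n\ge 0}$ and $\mathcal J=\{j_n:I^n\times\{0\}\hookrightarrow I^n\times I\}_{n\ge 0}$ be the (images under $\iota$ of the) subspace inclusions. For a class $\mathcal K$ of maps, $cell(\mathcal K)$ is the class of transfinite compositions of pushouts of coproducts of maps in $\mathcal K$, and $cof(\mathcal K)$ is the closure of $cell(\mathcal K)$ under retracts. The pushout product of $f:X\to Y$ and $g:A\to B$ is the induced map $f\hat\times g:(Y\times A)\coprod_{X\times A}(X\times B)\to Y\times B$; for classes, $\mathcal K\hat\times\mathcal L=\{k\hat\times l: k\in\mathcal K,\ l\in\mathcal L\}$. An object $A$ is exponentiable if $-\times A$ has a right adjoint. A Q-structure is a pair $(\mathcal C,\iota)$ with $\mathcal C$ bicomplete and $\iota:\Box\to\mathcal C$ an embedding such that: (Q1) the restriction of $\iota$ to $\Box_{\le 2}$ makes $\mathcal C$ a category with intervals; (Q2) for all $X\in\mathcal C$, $X\times\partial I$ is a coproduct $X\coprod X$ with inclusions $\mathrm{id}_X\times e_k$, $k=0,1$; (Q3) $\mathcal I\hat\times\mathcal I\subseteq cof(\mathcal I)$ and $\mathcal I\hat\times\mathcal J\subseteq cof(\mathcal J)$; (Q4) $\mathcal J\subseteq cof(\mathcal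 I)$ and $\{\emptyset\to\partial I^n\}\subseteq cof(\mathcal I)$; (Q5) $\partial I^n$ and $I^n$ are exponentiable in $\mathcal C$ for all $n\ge 0$; (Q6) $\partial I^n$ and $I^n$ are small relative to maps in $cell(\mathcal I)$ and $cell(\mathcal J)$ respectively, for all $n\ge 0$. A Q-structure is good if in addition: (Q7) $I^n$ is a product $\prod_{1\le k\le n}I$ in $\mathcal C$ for all $n\ge 1$; (Q8) for all $n\ge 1$ there are pushout squares in $\mathcal C$: one exhibiting $I^n$ as the pushout of $*\leftarrow\partial I^n\xrightarrow{e_1}\partial I^n\times I$ with legs $c:*\to I^n$ and $\rho:\partial I^n\times I\to I^n$ such that $\rho e_0=i_n$; and one exhibiting $\partial I^n$ as the pushout of $*\leftarrow\partial I^{n-1}\xrightarrow{i_{n-1}}I^{n-1}$ with legs $( * ):*\to\partial I^n$ and $\sigma:I^{n-1}\to\partial I^n$. A homotopy from $f:X\to Y$ to $g:X\to Y$ is a map $H:X\times I\to Y$ with $He_0=f$, $He_1=g$. If $i:A\to X$ satisfies $fi=gi$, the homotopy is relative to $A$ if $H(i\times\mathrm{id}_I)=fi\pi_A$, where $\pi_A:A\times I\to A$ is the projection; one writes $f\sim g$ rel $A$. A map $f:X\to Y$ is $n$-compressible if for every $u:\partial I^n\to X$ and $v:I^n\to Y$ with $fu=vi_n$ there is $h:I^n\to X$ with $hi_n=u$ and $fh\sim v$ rel $\partial I^n$. It is $n$-connected if it is $k$-compressible for all $0\le k\le n$, and a weak equivalence if it is $n$-connected for all $n\ge 0$. A point of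 $X$ is a map $x:*\to X$; $f(x)$ means $f\circ x$. For $n\ge 0$, $\pi_n(X,x_0)$ is the set of based maps $(\partial I^{n+1},( * ))\to(X,x_0)$ modulo homotopy relative to $( * )$; equivalently, via the second pushout of (Q8), the set of maps $\alpha:I^n\to X$ with $\alpha i_n$ equal to the constant map at $x_0$, modulo homotopy relative to $\partial I^n$. For $n\ge 1$ it is a group under $[\alpha]\cdot[\beta]=[\alpha\bullet\beta]$, where, identifying $I^n\cong I^{n-1}\times I$, $\alpha\bullet\beta:I^n\to X$ is the unique map with $(\alpha\bullet\beta)(\mathrm{id}_{I^{n-1}}\times a)=\alpha$ and $(\alpha\bullet\beta)(\mathrm{id}_{I^{n-1}}\times b)=\beta$. "Isomorphism" means bijection for index $0$ and group isomorphism for indices $\ge 1$. $\pi_nf$ is induced by composition with $f$. *)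

theory Defs
  imports "HOL-Analysis.Analysis" "HOL-Algebra.Group"
begin

unbundle cardinal_syntax

section \<open>Categories and functors\<close>

record ('o, 'm) cat =
  Obj :: "'o set"
  Arr :: "'m set"
  Dom :: "'m \<Rightarrow> 'o"
  Cod :: "'m \<Rightarrow> 'o"
  Ide :: "'o \<Rightarrow> 'm"
  Comp :: "'m \<Rightarrow> 'm \<Rightarrow> 'm"  (infixl "\<cdot>\<index>" 70)

definition Hom :: "('o, 'm) cat \<Rightarrow> 'o \<Rightarrow> 'o \<Rightarrow> 'm set" where
  "Hom C X Y = {f \<in> Arr C. Dom C f = X \<and> Cod C f = Y}"

locale category =
  fixes C :: "('o, 'm) cat" (structure)
  assumes Dom_Obj: "f \<in> Arr C \<Longrightarrow> Dom C f \<in> Obj C"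
    and Cod_Obj: "f \<in> Arr C \<Longrightarrow> Cod C f \<in> Obj C"
    and Ide_Hom: "X \<in> Obj C \<Longrightarrow> Ide C X \<in> Hom C X X"
    and Comp_Hom: "\<lbrakk>f \<in> Hom C X Y; g \<in> Hom C Y Z\<rbrakk> \<Longrightarrow> g \<cdot> f \<in> Hom C X Z"
    and Comp_Ide: "f \<in> Hom C X Y \<Longrightarrow> f \<cdot> Ide C X = f"
    and Ide_Comp: "f \<in> Hom C X Y \<Longrightarrow> Ide C Y \<cdot> f = f"
    and Comp_assoc: "\<lbrakk>f \<in> Hom C W X; g \<in> Hom C X Y; h \<in> Hom C Y Z\<rbrakk>
                      \<Longrightarrow> (h \<cdot> g) \<cdot> f = h \<cdot> (g \<cdot> f)"

record ('o, 'm, 'p, 'n) fctr =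
  OMap :: "'o \<Rightarrow> 'p"
  AMap :: "'m \<Rightarrow> 'n"

definition is_functor ::
  "('o, 'm) cat \<Rightarrow> ('p, 'n) cat \<Rightarrow> ('o, 'm, 'p, 'n) fctr \<Rightarrow> bool" where
  "is_functor C D F \<longleftrightarrow>
     category C \<and> category D \<and>
     (\<forall>X\<in>Obj C. OMap F X \<in> Obj D \<and> AMap F (Ide C X) = Ide D (OMap F X)) \<and>
     (\<forall>X Y. \<forall>f\<in>Hom C X Y. AMap F f \<in> Hom D (OMap F X) (OMap F Y)) \<and>
     (\<forall>X Y Z. \<forall>f\<in>Hom C X Y. \<forall>g\<in>Hom C Y Z.
        AMap F (g \<cdot>\<^bsub>C\<^esub> f) = AMap F g \<cdot>\<^bsub>D\<^esub> AMap F f)"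

definition faithful_functor ::
  "('o, 'm) cat \<Rightarrow> ('p, 'n) cat \<Rightarrow> ('o, 'm, 'p, 'n) fctr \<Rightarrow> bool" where
  "faithful_functor C D F \<longleftrightarrow>
     is_functor C D F \<and> (\<forall>X\<in>Obj C. \<forall>Y\<in>Obj C. inj_on (AMap F) (Hom C X Y))"

definition adjoint_functors ::
  "('o, 'm) cat \<Rightarrow> ('p, 'n) cat \<Rightarrow> ('o, 'm, 'p, 'n) fctr \<Rightarrow> ('p, 'n, 'o, 'm) fctr \<Rightarrow> bool" where
  "adjoint_functors C D F G \<longleftrightarrow>
     is_functor C D F \<and> is_functor D C G \<and>
     (\<exists>\<phi>. (\<forall>X\<in>Obj C. \<forall>Y\<in>Obj D.
             bij_betw (\<phi> X Y) (Hom D (OMap F X) Y) (Hom C X (OMap G Y))) \<and>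
          (\<forall>X\<in>Obj C. \<forall>X'\<in>Obj C. \<forall>Y\<in>Obj D. \<forall>Y'\<in>Obj D.
             \<forall>u\<in>Hom C X' X. \<forall>v\<in>Hom D Y Y'. \<forall>g\<in>Hom D (OMap F X) Y.
               \<phi> X' Y' (v \<cdot>\<^bsub>D\<^esub> g \<cdot>\<^bsub>D\<^esub> AMap F u) = AMap G v \<cdot>\<^bsub>C\<^esub> \<phi> X Y g \<cdot>\<^bsub>C\<^esub> u))"

definition isomorphic :: "('o, 'm) cat \<Rightarrow> 'o \<Rightarrow> 'o \<Rightarrow> bool" where
  "isomorphic C X Y \<longleftrightarrow>
     (\<exists>f\<in>Hom C X Y. \<exists>g\<in>Hom C Y X. g \<cdot>\<^bsub>C\<^esub> f = Ide C X \<and> f \<cdot>\<^bsub>C\<^esub> g = Ide C Y)"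


section \<open>Limits and colimits\<close>

definition is_cone ::
  "('j, 'k) cat \<Rightarrow> ('o, 'm) cat \<Rightarrow> ('j, 'k, 'o, 'm) fctr \<Rightarrow> 'o \<Rightarrow> ('j \<Rightarrow> 'm) \<Rightarrow> bool" where
  "is_cone J C D X p \<longleftrightarrow>
     X \<in> Obj C \<and> (\<forall>j\<in>Obj J. p j \<in> Hom C X (OMap D j)) \<and>
     (\<forall>u\<in>Arr J. AMap D u \<cdot>\<^bsub>C\<^esub> p (Dom J u) = p (Cod J u))"

definition is_limit ::
  "('j, 'k) cat \<Rightarrow> ('o, 'm) cat \<Rightarrow> ('j, 'k, 'o, 'm) fctr \<Rightarrow> 'o \<Rightarrow> ('j \<Rightarrow> 'm) \<Rightarrow> bool" where
  "is_limit J C D X p \<longleftrightarrow>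
     is_cone J C D X p \<and>
     (\<forall>Y q. is_cone J C D Y q \<longrightarrow> (\<exists>!h. h \<in> Hom C Y X \<and> (\<forall>j\<in>Obj J. p j \<cdot>\<^bsub>C\<^esub> h = q j)))"

definition is_cocone ::
  "('j, 'k) cat \<Rightarrow> ('o, 'm) cat \<Rightarrow> ('j, 'k, 'o, 'm) fctr \<Rightarrow> 'o \<Rightarrow> ('j \<Rightarrow> 'm) \<Rightarrow> bool" where
  "is_cocone J C D X p \<longleftrightarrow>
     X \<in> Obj C \<and> (\<forall>j\<in>Obj J. p j \<in> Hom C (OMap D j) X) \<and>
     (\<forall>u\<in>Arr J. p (Cod J u) \<cdot>\<^bsub>C\<^esub> AMap D u = p (Dom J u))"

definition is_colimit ::
  "('j, 'k) cat \<Rightarrow> ('o, 'm) cat \<Rightarrow> ('j, 'k, 'o, 'm) fctr \<Rightarrow> 'o \<Rightarrow> ('j \<Rightarrow> 'm) \<Rightarrow> bool" where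
  "is_colimit J C D X p \<longleftrightarrow>
     is_cocone J C D X p \<and>
     (\<forall>Y q. is_cocone J C D Y q \<longrightarrow> (\<exists>!h. h \<in> Hom C X Y \<and> (\<forall>j\<in>Obj J. h \<cdot>\<^bsub>C\<^esub> p j = q j)))"

text \<open>The type \<open>'u\<close> plays the role of the universe: a set is small when its cardinality is
  strictly below that of \<open>'u\<close>. When \<open>'u\<close> has strongly inaccessible cardinality this is smallness
  relative to a Grothendieck universe. Every small category is isomorphic to one whose objects and
  arrows have type \<open>'u\<close>.\<close>

definition small_set :: "'u itself \<Rightarrow> 'a set \<Rightarrow> bool" where
  "small_set U A \<longleftrightarrow> |A| <o |UNIV :: 'u set|"

definition bicomplete :: "'u itself \<Rightarrow> ('o, 'm) cat \<Rightarrow> bool" where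
  "bicomplete U C \<longleftrightarrow>
     category C \<and>
     (\<forall>(J :: ('u, 'u) cat) D. small_set U (Arr J) \<and> is_functor J C D \<longrightarrow>
        (\<exists>X p. is_limit J C D X p) \<and> (\<exists>X p. is_colimit J C D X p))"

definition is_initial :: "('o, 'm) cat \<Rightarrow> 'o \<Rightarrow> bool" where
  "is_initial C X \<longleftrightarrow> X \<in> Obj C \<and> (\<forall>Y\<in>Obj C. \<exists>!h. h \<in> Hom C X Y)"

definition is_terminal :: "('o, 'm) cat \<Rightarrow> 'o \<Rightarrow> bool" where
  "is_terminal C X \<longleftrightarrow> X \<in> Obj C \<and> (\<forall>Y\<in>Obj C. \<exists>!h. h \<in> Hom C Y X)"

definition is_product :: "('o, 'm) cat \<Rightarrow> 'i set \<Rightarrow> ('i \<Rightarrow> 'o) \<Rightarrow> 'o \<Rightarrow> ('i \<Rightarrow> 'm) \<Rightarrow> bool" where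
  "is_product C I A P p \<longleftrightarrow>
     P \<in> Obj C \<and> (\<forall>i\<in>I. p i \<in> Hom C P (A i)) \<and>
     (\<forall>Z\<in>Obj C. \<forall>q. (\<forall>i\<in>I. q i \<in> Hom C Z (A i)) \<longrightarrow>
        (\<exists>!h. h \<in> Hom C Z P \<and> (\<forall>i\<in>I. p i \<cdot>\<^bsub>C\<^esub> h = q i)))"

definition is_coproduct :: "('o, 'm) cat \<Rightarrow> 'i set \<Rightarrow> ('i \<Rightarrow> 'o) \<Rightarrow> 'o \<Rightarrow> ('i \<Rightarrow> 'm) \<Rightarrow> bool" where
  "is_coproduct C I A S s \<longleftrightarrow>
     S \<in> Obj C \<and> (\<forall>i\<in>I. s i \<in> Hom C (A i) S) \<and>
     (\<forall>Z\<in>Obj C. \<forall>q. (\<forall>i\<in>I. q i \<in> Hom C (A i) Z) \<longrightarrow>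
        (\<exists>!h. h \<in> Hom C S Z \<and> (\<forall>i\<in>I. h \<cdot>\<^bsub>C\<^esub> s i = q i)))"

text \<open>\<open>is_pushout C f g a b\<close>: the cospan with legs \<open>a : B \<rightarrow> P\<close> and \<open>b : D \<rightarrow> P\<close> is a pushout
  of the span \<open>f : A \<rightarrow> B\<close>, \<open>g : A \<rightarrow> D\<close>.\<close>

definition is_pushout :: "('o, 'm) cat \<Rightarrow> 'm \<Rightarrow> 'm \<Rightarrow> 'm \<Rightarrow> 'm \<Rightarrow> bool" where
  "is_pushout C f g a b \<longleftrightarrow>
     f \<in> Arr C \<and> g \<in> Arr C \<and> a \<in> Arr C \<and> b \<in> Arr C \<and>
     Dom C f = Dom C g \<and> Dom C a = Cod C f \<and> Dom C b = Cod C g \<and> Cod C a = Cod C b \<and>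
     a \<cdot>\<^bsub>C\<^esub> f = b \<cdot>\<^bsub>C\<^esub> g \<and>
     (\<forall>Z\<in>Obj C. \<forall>u\<in>Hom C (Cod C f) Z. \<forall>v\<in>Hom C (Cod C g) Z. u \<cdot>\<^bsub>C\<^esub> f = v \<cdot>\<^bsub>C\<^esub> g \<longrightarrow>
        (\<exists>!h. h \<in> Hom C (Cod C a) Z \<and> h \<cdot>\<^bsub>C\<^esub> a = u \<and> h \<cdot>\<^bsub>C\<^esub> b = v))"


section \<open>Chosen binary products\<close>

definition is_product2 :: "('o, 'm) cat \<Rightarrow> 'o \<Rightarrow> 'o \<Rightarrow> 'o \<times> 'm \<times> 'm \<Rightarrow> bool" where
  "is_product2 C X Y = (\<lambda>(P, p, q).
     P \<in> Obj C \<and> p \<in> Hom C P X \<and> q \<in> Hom C P Y \<and>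
     (\<forall>Z\<in>Obj C. \<forall>f\<in>Hom C Z X. \<forall>g\<in>Hom C Z Y.
        \<exists>!h. h \<in> Hom C Z P \<and> p \<cdot>\<^bsub>C\<^esub> h = f \<and> q \<cdot>\<^bsub>C\<^esub> h = g))"

definition chosen_product :: "('o, 'm) cat \<Rightarrow> 'o \<Rightarrow> 'o \<Rightarrow> 'o \<times> 'm \<times> 'm" where
  "chosen_product C X Y = (SOME t. is_product2 C X Y t)"

definition prod_obj :: "('o, 'm) cat \<Rightarrow> 'o \<Rightarrow> 'o \<Rightarrow> 'o" where
  "prod_obj C X Y = fst (chosen_product C X Y)"

definition pr1 :: "('o, 'm) cat \<Rightarrow> 'o \<Rightarrow> 'o \<Rightarrow> 'm" where
  "pr1 C X Y = fst (snd (chosen_product C X Y))"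

definition pr2 :: "('o, 'm) cat \<Rightarrow> 'o \<Rightarrow> 'o \<Rightarrow> 'm" where
  "pr2 C X Y = snd (snd (chosen_product C X Y))"

definition pairing :: "('o, 'm) cat \<Rightarrow> 'm \<Rightarrow> 'm \<Rightarrow> 'm" where
  "pairing C f g = (THE h. h \<in> Hom C (Dom C f) (prod_obj C (Cod C f) (Cod C g)) \<and>
     pr1 C (Cod C f) (Cod C g) \<cdot>\<^bsub>C\<^esub> h = f \<and> pr2 C (Cod C f) (Cod C g) \<cdot>\<^bsub>C\<^esub> h = g)"

definition prod_map :: "('o, 'm) cat \<Rightarrow> 'm \<Rightarrow> 'm \<Rightarrow> 'm" where
  "prod_map C f g =
     pairing C (f \<cdot>\<^bsub>C\<^esub> pr1 C (Dom C f) (Dom C g)) (g \<cdot>\<^bsub>C\<^esub> pr2 C (Dom C f) (Dom C g))"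

definition exponentiable :: "('o, 'm) cat \<Rightarrow> 'o \<Rightarrow> bool" where
  "exponentiable C A \<longleftrightarrow> A \<in> Obj C \<and>
     (\<exists>G. adjoint_functors C C
            \<lparr>OMap = \<lambda>X. prod_obj C X A, AMap = \<lambda>h. prod_map C h (Ide C A)\<rparr> G)"

text \<open>All pushouts of the span are admitted, so the pushout product of two maps is a class of
  maps that are isomorphic under the target.\<close>

definition is_pushout_product :: "('o, 'm) cat \<Rightarrow> 'm \<Rightarrow> 'm \<Rightarrow> 'm \<Rightarrow> bool" where
  "is_pushout_product C f g h \<longleftrightarrow>
     f \<in> Arr C \<and> g \<in> Arr C \<and>
     (\<exists>a b. is_pushout C (prod_map C f (Ide C (Dom C g))) (prod_map C (Ide C (Dom C f)) g) a b \<and>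
        h \<in> Hom C (Cod C a) (prod_obj C (Cod C f) (Cod C g)) \<and>
        h \<cdot>\<^bsub>C\<^esub> a = prod_map C (Ide C (Cod C f)) g \<and>
        h \<cdot>\<^bsub>C\<^esub> b = prod_map C f (Ide C (Cod C g)))"

definition pushout_products :: "('o, 'm) cat \<Rightarrow> 'm set \<Rightarrow> 'm set \<Rightarrow> 'm set" where
  "pushout_products C K L = {h. \<exists>k\<in>K. \<exists>l\<in>L. is_pushout_product C k l h}"


section \<open>Cell complexes and smallness of objects\<close>

definition poset_cat :: "'a rel \<Rightarrow> ('a, 'a \<times> 'a) cat" where
  "poset_cat r = \<lparr>Obj = Field r, Arr = r, Dom = fst, Cod = snd,
                  Ide = (\<lambda>x. (x, x)), Comp = (\<lambda>g f. (fst f, snd g))\<rparr>"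

definition is_min :: "'a rel \<Rightarrow> 'a \<Rightarrow> bool" where
  "is_min r m \<longleftrightarrow> m \<in> Field r \<and> (\<forall>x\<in>Field r. (m, x) \<in> r)"

definition is_next :: "'a rel \<Rightarrow> 'a \<Rightarrow> 'a \<Rightarrow> bool" where
  "is_next r x y \<longleftrightarrow> x \<in> underS r y \<and> (\<forall>z\<in>underS r y. (z, x) \<in> r)"

definition is_limit_stage :: "'a rel \<Rightarrow> 'a \<Rightarrow> bool" where
  "is_limit_stage r y \<longleftrightarrow> y \<in> Field r \<and> \<not> is_min r y \<and> (\<nexists>x. is_next r x y)"

text \<open>A nonzero small ordinal \<open>\<lambda>\<close> is encoded as a well-order \<open>r\<close>, and a \<open>\<lambda>\<close>-sequence is a
  functor on it that preserves colimits at limit stages.\<close>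

definition is_sequence ::
  "'u itself \<Rightarrow> ('o, 'm) cat \<Rightarrow> 'u rel \<Rightarrow> ('u, 'u \<times> 'u, 'o, 'm) fctr \<Rightarrow> bool" where
  "is_sequence U C r F \<longleftrightarrow>
     Well_order r \<and> Field r \<noteq> {} \<and> small_set U (Field r) \<and> is_functor (poset_cat r) C F \<and>
     (\<forall>y. is_limit_stage r y \<longrightarrow>
        is_colimit (poset_cat (Restr r (underS r y))) C F (OMap F y) (\<lambda>x. AMap F (x, y)))"

definition transfinite_compositions :: "'u itself \<Rightarrow> ('o, 'm) cat \<Rightarrow> 'm set \<Rightarrow> 'm set" where
  "transfinite_compositions U C K = {p m | (r :: 'u rel) F X p m.
     is_sequence U C r F \<and> (\<forall>x y. is_next r x y \<longrightarrow> AMap F (x, y) \<in> K) \<and>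
     is_colimit (poset_cat r) C F X p \<and> is_min r m}"

definition coproducts_of_maps :: "'u itself \<Rightarrow> ('o, 'm) cat \<Rightarrow> 'm set \<Rightarrow> 'm set" where
  "coproducts_of_maps U C K = {h | h (I :: 'u set) k A a B b.
     small_set U I \<and> k ` I \<subseteq> K \<and>
     is_coproduct C I (\<lambda>i. Dom C (k i)) A a \<and> is_coproduct C I (\<lambda>i. Cod C (k i)) B b \<and>
     h \<in> Hom C A B \<and> (\<forall>i\<in>I. h \<cdot>\<^bsub>C\<^esub> a i = b i \<cdot>\<^bsub>C\<^esub> k i)}"

definition pushouts_of_maps :: "('o, 'm) cat \<Rightarrow> 'm set \<Rightarrow> 'm set" where
  "pushouts_of_maps C K = {g. \<exists>k\<in>K. \<exists>u b. is_pushout C k u b g}"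

definition cell :: "'u itself \<Rightarrow> ('o, 'm) cat \<Rightarrow> 'm set \<Rightarrow> 'm set" where
  "cell U C K = transfinite_compositions U C (pushouts_of_maps C (coproducts_of_maps U C K))"

definition is_retract :: "('o, 'm) cat \<Rightarrow> 'm \<Rightarrow> 'm \<Rightarrow> bool" where
  "is_retract C f g \<longleftrightarrow> f \<in> Arr C \<and> g \<in> Arr C \<and>
     (\<exists>i\<in>Hom C (Dom C f) (Dom C g). \<exists>r\<in>Hom C (Dom C g) (Dom C f).
      \<exists>j\<in>Hom C (Cod C f) (Cod C g). \<exists>s\<in>Hom C (Cod C g) (Cod C f).
        r \<cdot>\<^bsub>C\<^esub> i = Ide C (Dom C f) \<and> s \<cdot>\<^bsub>C\<^esub> j = Ide C (Cod C f) \<and>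
        g \<cdot>\<^bsub>C\<^esub> i = j \<cdot>\<^bsub>C\<^esub> f \<and> f \<cdot>\<^bsub>C\<^esub> r = s \<cdot>\<^bsub>C\<^esub> g)"

definition cof :: "'u itself \<Rightarrow> ('o, 'm) cat \<Rightarrow> 'm set \<Rightarrow> 'm set" where
  "cof U C K = {f. \<exists>g\<in>cell U C K. is_retract C f g}"

definition cardinal_filtered :: "'k rel \<Rightarrow> 'a rel \<Rightarrow> bool" where
  "cardinal_filtered \<kappa> r \<longleftrightarrow>
     Field r \<noteq> {} \<and> (\<forall>x\<in>Field r. \<exists>y. is_next r x y) \<and>
     (\<forall>S\<subseteq>Field r. |S| \<le>o \<kappa> \<longrightarrow> (\<exists>y\<in>Field r. \<forall>x\<in>S. (x, y) \<in> r))"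

text \<open>The last two conjuncts spell out surjectivity and injectivity of the comparison map from
  the directed colimit of the sets \<open>Hom A (F x)\<close> to \<open>Hom A (colim F)\<close>.\<close>

definition small_relative :: "'u itself \<Rightarrow> ('o, 'm) cat \<Rightarrow> 'm set \<Rightarrow> 'o \<Rightarrow> bool" where
  "small_relative U C K A \<longleftrightarrow> A \<in> Obj C \<and>
     (\<exists>\<kappa> :: 'u rel. Card_order \<kappa> \<and> small_set U (Field \<kappa>) \<and>
       (\<forall>(r :: 'u rel) F X p.
          is_sequence U C r F \<and> cardinal_filtered \<kappa> r \<and>
          (\<forall>x y. is_next r x y \<longrightarrow> AMap F (x, y) \<in> K) \<and> is_colimit (poset_cat r) C F X p \<longrightarrow>
          (\<forall>g\<in>Hom C A X. \<exists>x\<in>Field r. \<exists>h\<in>Hom C A (OMap F x). p x \<cdot>\<^bsub>C\<^esub> h = g) \<and>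
          (\<forall>x\<in>Field r. \<forall>x'\<in>Field r. \<forall>h\<in>Hom C A (OMap F x). \<forall>h'\<in>Hom C A (OMap F x').
             p x \<cdot>\<^bsub>C\<^esub> h = p x' \<cdot>\<^bsub>C\<^esub> h' \<longrightarrow>
             (\<exists>y. (x, y) \<in> r \<and> (x', y) \<in> r \<and> AMap F (x, y) \<cdot>\<^bsub>C\<^esub> h = AMap F (x', y) \<cdot>\<^bsub>C\<^esub> h'))))"


section \<open>Cubes and their boundaries\<close>

text \<open>A map of spaces is a triple (source, extensional function, target).\<close>

type_synonym 'a top_map = "'a topology \<times> ('a \<Rightarrow> 'a) \<times> 'a topology"

definition tmap :: "'a topology \<Rightarrow> 'a topology \<Rightarrow> ('a \<Rightarrow> 'a) \<Rightarrow> 'a top_map" where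
  "tmap X Y g = (X, restrict g (topspace X), Y)"

definition full_Top :: "'a topology set \<Rightarrow> ('a topology, 'a top_map) cat" where
  "full_Top \<S> =
     \<lparr>Obj = \<S>,
      Arr = {(X, g, Y) | X g Y.
               X \<in> \<S> \<and> Y \<in> \<S> \<and> continuous_map X Y g \<and> g \<in> extensional (topspace X)},
      Dom = fst,
      Cod = (\<lambda>f. snd (snd f)),
      Ide = (\<lambda>X. tmap X X (\<lambda>x. x)),
      Comp = (\<lambda>g f. tmap (fst f) (snd (snd g)) (fst (snd g) \<circ> fst (snd f)))\<rparr>"

definition cube :: "nat \<Rightarrow> (nat \<Rightarrow> real) topology" where
  "cube n = product_topology (\<lambda>_. top_of_set {0..1}) {..<n}"

definition bdry :: "nat \<Rightarrow> (nat \<Rightarrow> real) topology" where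
  "bdry n = subtopology (cube n) {x. \<exists>k<n. x k = 0 \<or> x k = 1}"

type_synonym space = "(nat \<Rightarrow> real) topology"
type_synonym space_map = "(nat \<Rightarrow> real) top_map"

definition Box :: "(space, space_map) cat" where
  "Box = full_Top (range cube \<union> range bdry)"

definition Box2 :: "(space, space_map) cat" where
  "Box2 = full_Top (cube ` {..2} \<union> bdry ` {..2})"

definition endpoint :: "real \<Rightarrow> space_map" where
  "endpoint k = tmap (cube 0) (cube 1) (\<lambda>_. \<lambda>i\<in>{..<1}. k)"

definition bdry_endpoint :: "real \<Rightarrow> space_map" where
  "bdry_endpoint k = tmap (cube 0) (bdry 1) (\<lambda>_. \<lambda>i\<in>{..<1}. k)"

definition bdry_incl :: "nat \<Rightarrow> space_map" where
  "bdry_incl n = tmap (bdry n) (cube n) (\<lambda>x. x)"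

text \<open>\<open>I\<^sup>n \<times> {0} \<hookrightarrow> I\<^sup>n \<times> I\<close>, with the source identified with \<open>I\<^sup>n\<close> and the target with
  \<open>I\<^sup>n\<^sup>+\<^sup>1\<close>.\<close>

definition base_incl :: "nat \<Rightarrow> space_map" where
  "base_incl n = tmap (cube n) (cube (Suc n)) (\<lambda>x. x(n := 0))"

definition empty_to_bdry :: "nat \<Rightarrow> space_map" where
  "empty_to_bdry n = tmap (bdry 0) (bdry n) (\<lambda>x. x)"

definition coord :: "nat \<Rightarrow> nat \<Rightarrow> space_map" where
  "coord n k = tmap (cube n) (cube 1) (\<lambda>x. \<lambda>i\<in>{..<1}. x k)"

text \<open>\<open>id \<times> a\<close> on \<open>I\<^sup>n = I\<^sup>n\<^sup>-\<^sup>1 \<times> I\<close>, for \<open>n \<ge> 1\<close> and \<open>a : I \<rightarrow> I\<close>.\<close>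

definition on_last :: "nat \<Rightarrow> space_map \<Rightarrow> space_map" where
  "on_last n a =
     tmap (cube n) (cube n) (\<lambda>x. x(n - 1 := fst (snd a) (\<lambda>i\<in>{..<1}. x (n - 1)) 0))"


section \<open>Categories with intervals\<close>

type_synonym ('o, 'm) box_functor = "(space, space_map, 'o, 'm) fctr"

definition bang :: "('o, 'm) cat \<Rightarrow> ('o, 'm) box_functor \<Rightarrow> 'o \<Rightarrow> 'm" where
  "bang C \<iota> X = (THE h. h \<in> Hom C X (OMap \<iota> (cube 0)))"

text \<open>\<open>id\<^sub>X \<times> e : X \<rightarrow> X \<times> B\<close> for a point \<open>e\<close> of \<open>B\<close>, with \<open>X\<close> identified with \<open>X \<times> *\<close>.\<close>

definition slice :: "('o, 'm) cat \<Rightarrow> ('o, 'm) box_functor \<Rightarrow> 'o \<Rightarrow> 'm \<Rightarrow> 'm" where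
  "slice C \<iota> X e = pairing C (Ide C X) (e \<cdot>\<^bsub>C\<^esub> bang C \<iota> X)"

abbreviation cyl :: "('o, 'm) cat \<Rightarrow> ('o, 'm) box_functor \<Rightarrow> 'o \<Rightarrow> 'o" where
  "cyl C \<iota> X \<equiv> prod_obj C X (OMap \<iota> (cube 1))"

abbreviation cyl_end :: "('o, 'm) cat \<Rightarrow> ('o, 'm) box_functor \<Rightarrow> real \<Rightarrow> 'o \<Rightarrow> 'm" where
  "cyl_end C \<iota> k X \<equiv> slice C \<iota> X (AMap \<iota> (endpoint k))"

text \<open>\<open>a\<close> and \<open>b\<close> exhibit \<open>I\<close> as two copies of \<open>I\<close> glued end to start; they are used again to
  define the multiplication of homotopy groups.\<close>

definition interval_square ::
  "('o, 'm) cat \<Rightarrow> ('o, 'm) box_functor \<Rightarrow> space_map \<Rightarrow> space_map \<Rightarrow> bool" where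
  "interval_square C \<iota> a b \<longleftrightarrow>
     a \<in> Hom Box2 (cube 1) (cube 1) \<and> b \<in> Hom Box2 (cube 1) (cube 1) \<and>
     is_pushout Box2 (endpoint 1) (endpoint 0) a b \<and>
     a \<cdot>\<^bsub>Box2\<^esub> endpoint 0 = endpoint 0 \<and> b \<cdot>\<^bsub>Box2\<^esub> endpoint 1 = endpoint 1 \<and>
     is_pushout C (AMap \<iota> (endpoint 1)) (AMap \<iota> (endpoint 0)) (AMap \<iota> a) (AMap \<iota> b) \<and>
     (\<forall>X\<in>Obj C.
        is_pushout C
          (prod_map C (Ide C X) (AMap \<iota> (endpoint 1)))
          (prod_map C (Ide C X) (AMap \<iota> (endpoint 0)))
          (prod_map C (Ide C X) (AMap \<iota> a))
          (prod_map C (Ide C X) (AMap \<iota> b)))"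

definition category_with_intervals ::
  "'u itself \<Rightarrow> ('o, 'm) cat \<Rightarrow> ('o, 'm) box_functor \<Rightarrow> bool" where
  "category_with_intervals U C \<iota> \<longleftrightarrow>
     bicomplete U C \<and> faithful_functor Box2 C \<iota> \<and>
     is_initial C (OMap \<iota> (bdry 0)) \<and> is_terminal C (OMap \<iota> (cube 0)) \<and>
     isomorphic C (OMap \<iota> (cube 2)) (prod_obj C (OMap \<iota> (cube 1)) (OMap \<iota> (cube 1))) \<and>
     (\<exists>a b. interval_square C \<iota> a b) \<and>
     (\<forall>X\<in>Obj C. isomorphic C (prod_obj C (OMap \<iota> (bdry 0)) X) (OMap \<iota> (bdry 0)))"


section \<open>Q-structures\<close>

definition gen_I :: "('o, 'm) box_functor \<Rightarrow> 'm set" where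
  "gen_I \<iota> = range (\<lambda>n. AMap \<iota> (bdry_incl n))"

definition gen_J :: "('o, 'm) box_functor \<Rightarrow> 'm set" where
  "gen_J \<iota> = range (\<lambda>n. AMap \<iota> (base_incl n))"

definition Q_structure ::
  "'u itself \<Rightarrow> ('o, 'm) cat \<Rightarrow> ('o, 'm) box_functor \<Rightarrow> bool" where
  "Q_structure U C \<iota> \<longleftrightarrow>
     bicomplete U C \<and> faithful_functor Box C \<iota> \<and>
     category_with_intervals U C \<iota> \<and>
     (\<forall>X\<in>Obj C. is_coproduct C {0, 1} (\<lambda>_. X) (prod_obj C X (OMap \<iota> (bdry 1)))
        (\<lambda>k. slice C \<iota> X (AMap \<iota> (bdry_endpoint k)))) \<and>
     pushout_products C (gen_I \<iota>) (gen_I \<iota>) \<subseteq> cof U C (gen_I \<iota>) \<and>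
     pushout_products C (gen_I \<iota>) (gen_J \<iota>) \<subseteq> cof U C (gen_J \<iota>) \<and>
     gen_J \<iota> \<subseteq> cof U C (gen_I \<iota>) \<and>
     range (\<lambda>n. AMap \<iota> (empty_to_bdry n)) \<subseteq> cof U C (gen_I \<iota>) \<and>
     (\<forall>n. exponentiable C (OMap \<iota> (bdry n)) \<and> exponentiable C (OMap \<iota> (cube n))) \<and>
     (\<forall>n. small_relative U C (cell U C (gen_I \<iota>)) (OMap \<iota> (bdry n)) \<and>
          small_relative U C (cell U C (gen_J \<iota>)) (OMap \<iota> (cube n)))"

definition good_Q_structure ::
  "'u itself \<Rightarrow> ('o, 'm) cat \<Rightarrow> ('o, 'm) box_functor \<Rightarrow> bool" where
  "good_Q_structure U C \<iota> \<longleftrightarrow>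
     Q_structure U C \<iota> \<and>
     (\<forall>n\<ge>1. is_product C {..<n} (\<lambda>_. OMap \<iota> (cube 1)) (OMap \<iota> (cube n))
              (\<lambda>k. AMap \<iota> (coord n k))) \<and>
     (\<forall>n\<ge>1. \<exists>c \<rho>. c \<in> Hom C (OMap \<iota> (cube 0)) (OMap \<iota> (cube n)) \<and>
        \<rho> \<in> Hom C (cyl C \<iota> (OMap \<iota> (bdry n))) (OMap \<iota> (cube n)) \<and>
        is_pushout C (bang C \<iota> (OMap \<iota> (bdry n))) (cyl_end C \<iota> 1 (OMap \<iota> (bdry n))) c \<rho> \<and>
        \<rho> \<cdot>\<^bsub>C\<^esub> cyl_end C \<iota> 0 (OMap \<iota> (bdry n)) = AMap \<iota> (bdry_incl n)) \<and>
     (\<forall>n\<ge>1. \<exists>pt \<sigma>. pt \<in> Hom C (OMap \<iota> (cube 0)) (OMap \<iota> (bdry n)) \<and>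
        \<sigma> \<in> Hom C (OMap \<iota> (cube (n - 1))) (OMap \<iota> (bdry n)) \<and>
        is_pushout C (bang C \<iota> (OMap \<iota> (bdry (n - 1)))) (AMap \<iota> (bdry_incl (n - 1))) pt \<sigma>)"


section \<open>Homotopies and weak equivalences\<close>

definition is_homotopy ::
  "('o, 'm) cat \<Rightarrow> ('o, 'm) box_functor \<Rightarrow> 'm \<Rightarrow> 'm \<Rightarrow> 'm \<Rightarrow> bool" where
  "is_homotopy C \<iota> H f g \<longleftrightarrow>
     f \<in> Arr C \<and> g \<in> Hom C (Dom C f) (Cod C f) \<and>
     H \<in> Hom C (cyl C \<iota> (Dom C f)) (Cod C f) \<and>
     H \<cdot>\<^bsub>C\<^esub> cyl_end C \<iota> 0 (Dom C f) = f \<and> H \<cdot>\<^bsub>C\<^esub> cyl_end C \<iota> 1 (Dom C f) = g"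

definition homotopic_rel ::
  "('o, 'm) cat \<Rightarrow> ('o, 'm) box_functor \<Rightarrow> 'm \<Rightarrow> 'm \<Rightarrow> 'm \<Rightarrow> bool" where
  "homotopic_rel C \<iota> i f g \<longleftrightarrow>
     f \<cdot>\<^bsub>C\<^esub> i = g \<cdot>\<^bsub>C\<^esub> i \<and>
     (\<exists>H. is_homotopy C \<iota> H f g \<and>
        H \<cdot>\<^bsub>C\<^esub> prod_map C i (Ide C (OMap \<iota> (cube 1))) =
          f \<cdot>\<^bsub>C\<^esub> i \<cdot>\<^bsub>C\<^esub> pr1 C (Dom C i) (OMap \<iota> (cube 1)))"

definition compressible ::
  "('o, 'm) cat \<Rightarrow> ('o, 'm) box_functor \<Rightarrow> nat \<Rightarrow> 'm \<Rightarrow> bool" where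
  "compressible C \<iota> n f \<longleftrightarrow>
     (\<forall>u\<in>Hom C (OMap \<iota> (bdry n)) (Dom C f). \<forall>v\<in>Hom C (OMap \<iota> (cube n)) (Cod C f).
        f \<cdot>\<^bsub>C\<^esub> u = v \<cdot>\<^bsub>C\<^esub> AMap \<iota> (bdry_incl n) \<longrightarrow>
        (\<exists>h\<in>Hom C (OMap \<iota> (cube n)) (Dom C f).
           h \<cdot>\<^bsub>C\<^esub> AMap \<iota> (bdry_incl n) = u \<and>
           homotopic_rel C \<iota> (AMap \<iota> (bdry_incl n)) (f \<cdot>\<^bsub>C\<^esub> h) v))"

definition n_connected ::
  "('o, 'm) cat \<Rightarrow> ('o, 'm) box_functor \<Rightarrow> nat \<Rightarrow> 'm \<Rightarrow> bool" where
  "n_connected C \<iota> n f \<longleftrightarrow> (\<forall>k\<le>n. compressible C \<iota> k f)"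

definition weak_equivalence :: "('o, 'm) cat \<Rightarrow> ('o, 'm) box_functor \<Rightarrow> 'm \<Rightarrow> bool" where
  "weak_equivalence C \<iota> f \<longleftrightarrow> (\<forall>n. n_connected C \<iota> n f)"


section \<open>Homotopy groups\<close>

definition points :: "('o, 'm) cat \<Rightarrow> ('o, 'm) box_functor \<Rightarrow> 'o \<Rightarrow> 'm set" where
  "points C \<iota> X = Hom C (OMap \<iota> (cube 0)) X"

definition const_map :: "('o, 'm) cat \<Rightarrow> ('o, 'm) box_functor \<Rightarrow> 'o \<Rightarrow> 'm \<Rightarrow> 'm" where
  "const_map C \<iota> A x = x \<cdot>\<^bsub>C\<^esub> bang C \<iota> A"

text \<open>\<open>\<pi>\<^sub>n(X, x)\<close> is formed from maps \<open>I\<^sup>n \<rightarrow> X\<close> that are constant at \<open>x\<close> on \<open>\<partial>I\<^sup>n\<close>, rather than from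
  based maps out of \<open>\<partial>I\<^sup>n\<^sup>+\<^sup>1\<close>.\<close>

definition loops ::
  "('o, 'm) cat \<Rightarrow> ('o, 'm) box_functor \<Rightarrow> nat \<Rightarrow> 'o \<Rightarrow> 'm \<Rightarrow> 'm set" where
  "loops C \<iota> n X x = {\<alpha> \<in> Hom C (OMap \<iota> (cube n)) X.
     \<alpha> \<cdot>\<^bsub>C\<^esub> AMap \<iota> (bdry_incl n) = const_map C \<iota> (OMap \<iota> (bdry n)) x}"

definition loop_rel ::
  "('o, 'm) cat \<Rightarrow> ('o, 'm) box_functor \<Rightarrow> nat \<Rightarrow> 'o \<Rightarrow> 'm \<Rightarrow> 'm rel" where
  "loop_rel C \<iota> n X x = {(\<alpha>, \<beta>). \<alpha> \<in> loops C \<iota> n X x \<and> \<beta> \<in> loops C \<iota> n X x \<and>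
     homotopic_rel C \<iota> (AMap \<iota> (bdry_incl n)) \<alpha> \<beta>}"

text \<open>The product \<open>\<alpha> \<bullet> \<beta>\<close>, for \<open>n \<ge> 1\<close>.\<close>

definition concat_loops ::
  "('o, 'm) cat \<Rightarrow> ('o, 'm) box_functor \<Rightarrow> space_map \<Rightarrow> space_map \<Rightarrow> nat \<Rightarrow> 'm \<Rightarrow> 'm \<Rightarrow> 'm" where
  "concat_loops C \<iota> a b n \<alpha> \<beta> = (THE \<gamma>. \<gamma> \<in> Hom C (OMap \<iota> (cube n)) (Cod C \<alpha>) \<and>
     \<gamma> \<cdot>\<^bsub>C\<^esub> AMap \<iota> (on_last n a) = \<alpha> \<and> \<gamma> \<cdot>\<^bsub>C\<^esub> AMap \<iota> (on_last n b) = \<beta>)"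

text \<open>The multiplication and unit are meaningful only for \<open>n \<ge> 1\<close>; for \<open>n = 0\<close> only the carrier
  is used.\<close>

definition homotopy_group ::
  "('o, 'm) cat \<Rightarrow> ('o, 'm) box_functor \<Rightarrow> space_map \<Rightarrow> space_map \<Rightarrow> nat \<Rightarrow> 'o \<Rightarrow> 'm \<Rightarrow> 'm set monoid"
  where
  "homotopy_group C \<iota> a b n X x =
     \<lparr>carrier = loops C \<iota> n X x // loop_rel C \<iota> n X x,
      mult = (\<lambda>A B. \<Union>\<alpha>\<in>A. \<Union>\<beta>\<in>B. loop_rel C \<iota> n X x `` {concat_loops C \<iota> a b n \<alpha> \<beta>}),
      one = loop_rel C \<iota> n X x `` {const_map C \<iota> (OMap \<iota> (cube n)) x}\<rparr>"

definition homotopy_map ::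
  "('o, 'm) cat \<Rightarrow> ('o, 'm) box_functor \<Rightarrow> nat \<Rightarrow> 'm \<Rightarrow> 'm \<Rightarrow> 'm set \<Rightarrow> 'm set" where
  "homotopy_map C \<iota> n f x =
     (\<lambda>A. \<Union>\<alpha>\<in>A. loop_rel C \<iota> n (Cod C f) (f \<cdot>\<^bsub>C\<^esub> x) `` {f \<cdot>\<^bsub>C\<^esub> \<alpha>})"

definition homotopy_map_iso ::
  "('o, 'm) cat \<Rightarrow> ('o, 'm) box_functor \<Rightarrow> space_map \<Rightarrow> space_map \<Rightarrow> nat \<Rightarrow> 'm \<Rightarrow> 'm \<Rightarrow> bool" where
  "homotopy_map_iso C \<iota> a b n f x \<longleftrightarrow>
     (let G = homotopy_group C \<iota> a b n (Dom C f) x;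
          H = homotopy_group C \<iota> a b n (Cod C f) (f \<cdot>\<^bsub>C\<^esub> x)
      in if n = 0 then bij_betw (homotopy_map C \<iota> n f x) (carrier G) (carrier H)
         else homotopy_map C \<iota> n f x \<in> iso G H)"

definition homotopy_map_surj ::
  "('o, 'm) cat \<Rightarrow> ('o, 'm) box_functor \<Rightarrow> space_map \<Rightarrow> space_map \<Rightarrow> nat \<Rightarrow> 'm \<Rightarrow> 'm \<Rightarrow> bool" where
  "homotopy_map_surj C \<iota> a b n f x \<longleftrightarrow>
     homotopy_map C \<iota> n f x ` carrier (homotopy_group C \<iota> a b n (Dom C f) x) =
       carrier (homotopy_group C \<iota> a b n (Cod C f) (f \<cdot>\<^bsub>C\<^esub> x))"

end

theory Submission
  imports Defs
begin

text \<open>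
  By the first pushout of (Q8), \<open>I\<^sup>k\<close> is a cone on \<open>S = \<partial>I\<^sup>k\<close>. Hence a map \<open>h : I\<^sup>k \<rightarrow> W\<close> is a path of
  maps \<open>S \<rightarrow> W\<close> that ends at a constant map, and a homotopy relative to the boundary is a deformation
  of such paths that fixes the start and moves the end through constant maps. Gluing paths along
  \<open>I = I \<union> I\<close> gives, for maps \<open>h\<close> and \<open>v\<close> that agree on the boundary, a difference loop \<open>d(h, v)\<close> at the
  center of \<open>h\<close>, and an action \<open>h # w\<close> of such loops with \<open>h # d(h, v) \<sim> v\<close>. Nothing but the interval
  coordinates is ever deformed, so no structure of \<open>S\<close> is needed.

  By the second pushout of (Q8), a map \<open>u : \<partial>I\<^sup>k\<^sup>+\<^sup>1 \<rightarrow> W\<close> amounts to a loop \<open>I\<^sup>k \<rightarrow> W\<close>, and \<open>u\<close> extends over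
  \<open>I\<^sup>k\<^sup>+\<^sup>1\<close> iff this loop is null-homotopic. So if \<open>f\<close> is \<open>(k+1)\<close>-compressible, a loop is null as soon as
  its image under \<open>f\<close> is, at every base point, and difference loops turn this into injectivity of
  \<open>\<pi>\<^sub>k f\<close>. Conversely, if \<open>f u = v i\<close>, injectivity of \<open>\<pi>\<^sub>k f\<close> yields some extension \<open>h\<close> of \<open>u\<close>, and
  surjectivity of \<open>\<pi>\<^sub>k\<^sub>+\<^sub>1 f\<close> a loop \<open>w\<close> with \<open>f w \<sim> d(f h, v)\<close>, whence \<open>f (h # w) \<sim> v\<close>.

  That the product of two loops is again constant on the whole boundary comes from the homotopy
  extension property of \<open>\<partial>I\<^sup>k \<rightarrow> I\<^sup>k\<close>, which follows from (Q3) because every object has the extension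
  property for \<open>\<J>\<close>. The same fact in the path object makes the product of classes well defined.
\<close>

section \<open>Bicomplete categories\<close>

text \<open>The halves \<open>a\<close> and \<open>b\<close> of the interval are known only through
  their pushout square, so concatenation has no formula. A function with prescribed values on both
  halves comes from the square in \<open>Box2\<close>, and functions with the same ends are joined
  by a straight line in \<open>[0, 1]\<close>. Together with pulling a path back along a map
  \<open>I\<^sup>2 \<rightarrow> I\<close> this supplies the deformations of paths. Associativity of
  concatenation is avoided: a path and its reverse are cancelled by shrinking neighbouring factors
  at the same time.

  Extending a map over a cube only sees a contraction of a loop whose base point may travel, whereas
  \<open>\<pi>\<^sub>k\<close> asks for a fixed base point. The two notions agree because the end of
  a path of maps may itself travel through constant maps, so the track of the base point can be
  drawn back in.

  Degree 0 stands apart since its sphere is empty: there is no cone description, and no point of the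
  sphere at which constant maps could be compared.\<close>

context category
begin

lemma HomD: "f \<in> Hom C X Y \<Longrightarrow> f \<in> Arr C" "f \<in> Hom C X Y \<Longrightarrow> Dom C f = X"
  "f \<in> Hom C X Y \<Longrightarrow> Cod C f = Y"
  by (auto simp: Hom_def)

lemma HomI: "f \<in> Arr C \<Longrightarrow> Dom C f = X \<Longrightarrow> Cod C f = Y \<Longrightarrow> f \<in> Hom C X Y"
  by (auto simp: Hom_def)

lemma Hom_Obj: "f \<in> Hom C X Y \<Longrightarrow> X \<in> Obj C" "f \<in> Hom C X Y \<Longrightarrow> Y \<in> Obj C"
  using Dom_Obj Cod_Obj by (auto simp: Hom_def)

lemma ide_simps [simp]:
  "X \<in> Obj C \<Longrightarrow> Ide C X \<in> Arr C" "X \<in> Obj C \<Longrightarrow> Dom C (Ide C X) = X"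
  "X \<in> Obj C \<Longrightarrow> Cod C (Ide C X) = X"
  using Ide_Hom[of X] by (auto simp: Hom_def)

lemma comp_simps [simp]:
  "\<lbrakk>f \<in> Arr C; g \<in> Arr C; Cod C f = Dom C g\<rbrakk> \<Longrightarrow> g \<cdot> f \<in> Arr C"
  "\<lbrakk>f \<in> Arr C; g \<in> Arr C; Cod C f = Dom C g\<rbrakk> \<Longrightarrow> Dom C (g \<cdot> f) = Dom C f"
  "\<lbrakk>f \<in> Arr C; g \<in> Arr C; Cod C f = Dom C g\<rbrakk> \<Longrightarrow> Cod C (g \<cdot> f) = Cod C g"
  using Comp_Hom[of f "Dom C f" "Cod C f" g "Cod C g"] by (auto simp: Hom_def)

lemma comp_assoc [simp]:
  "\<lbrakk>f \<in> Arr C; g \<in> Arr C; h \<in> Arr C; Cod C f = Dom C g; Cod C g = Dom C h\<rbrakk>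
   \<Longrightarrow> (h \<cdot> g) \<cdot> f = h \<cdot> (g \<cdot> f)"
  using Comp_assoc[of f "Dom C f" "Cod C f" g "Cod C g" h "Cod C h"] by (auto simp: Hom_def)

lemma comp_ide [simp]:
  "\<lbrakk>f \<in> Arr C; Dom C f = X\<rbrakk> \<Longrightarrow> f \<cdot> Ide C X = f"
  "\<lbrakk>f \<in> Arr C; Cod C f = X\<rbrakk> \<Longrightarrow> Ide C X \<cdot> f = f"
  using Comp_Ide[of f "Dom C f" "Cod C f"] Ide_Comp[of f "Dom C f" "Cod C f"] by (auto simp: Hom_def)

lemma arr_obj [simp]: "f \<in> Arr C \<Longrightarrow> Dom C f \<in> Obj C" "f \<in> Arr C \<Longrightarrow> Cod C f \<in> Obj C"
  using Dom_Obj Cod_Obj by auto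

end

text \<open>The diagram categories for binary products and for pushouts, with objects and arrows
  coded by distinct elements of the universe.\<close>

definition discrete_cat :: "'u set \<Rightarrow> ('u, 'u) cat" where
  "discrete_cat S = \<lparr>Obj = S, Arr = S, Dom = id, Cod = id, Ide = id, Comp = (\<lambda>g f. f)\<rparr>"

definition span_cat :: "'u \<Rightarrow> 'u \<Rightarrow> 'u \<Rightarrow> 'u \<Rightarrow> 'u \<Rightarrow> ('u, 'u) cat" where
  "span_cat x y z s t = \<lparr>Obj = {x, y, z}, Arr = {x, y, z, s, t},
     Dom = (\<lambda>w. if w = s \<or> w = t then x else w),
     Cod = (\<lambda>w. if w = s then y else if w = t then z else w),
     Ide = id, Comp = (\<lambda>g f. if g = s \<or> g = t then g else f)\<rparr>"

lemma small_finite: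
  assumes "infinite (UNIV :: 'u set)" "finite A"
  shows "small_set TYPE('u) A"
  using assms unfolding small_set_def by (meson finite_iff_ordLess_natLeq infinite_iff_natLeq_ordLeq ordLess_ordLeq_trans card_of_Well_order)

locale bicomplete_category = category C for C :: "('o, 'm) cat" (structure) +
  fixes U :: "'u itself"
  assumes bicomplete: "bicomplete U C" and uncountable: "uncountable (UNIV :: 'u set)"
begin

lemma infinite_universe: "infinite (UNIV :: 'u set)"
  using uncountable countable_finite by auto

lemma limit_exists:
  fixes J :: "('u, 'u) cat"
  assumes "finite (Arr J)" "is_functor J C D"
  shows "\<exists>X p. is_limit J C D X p" "\<exists>X p. is_colimit J C D X p"
proof -
  have "small_set TYPE('u) (Arr J)"
    by (rule small_finite[OF infinite_universe assms(1)])
  then have "small_set U (Arr J)" by (simp add: small_set_def)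
  with bicomplete assms(2) show "\<exists>X p. is_limit J C D X p" "\<exists>X p. is_colimit J C D X p"
    unfolding bicomplete_def by blast+
qed

lemma discrete_functor:
  fixes S :: "'u set"
  assumes "\<And>i. i \<in> S \<Longrightarrow> A i \<in> Obj C"
  shows "is_functor (discrete_cat S) C \<lparr>OMap = A, AMap = \<lambda>i. Ide C (A i)\<rparr>"
proof -
  have "category (discrete_cat S)"
    by unfold_locales (auto simp: discrete_cat_def Hom_def)
  then show ?thesis
    unfolding is_functor_def
    using assms category_axioms by (auto simp: discrete_cat_def Hom_def)
qed

lemma product2_exists:
  assumes "X \<in> Obj C" "Y \<in> Obj C"
  shows "\<exists>t. is_product2 C X Y t"
proof -
  obtain e :: "nat \<Rightarrow> 'u" where e: "inj e"
    using infinite_universe by (meson infinite_countable_subset)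
  obtain x y :: 'u where ne: "x \<noteq> y"
  proof
    show "e 0 \<noteq> e 1" using e by (simp add: inj_eq)
  qed
  let ?S = "{x, y}"
  let ?A = "\<lambda>i. if i = x then X else Y"
  let ?D = "\<lparr>OMap = ?A, AMap = \<lambda>i. Ide C (?A i)\<rparr>"
  have "is_functor (discrete_cat ?S) C ?D"
    by (rule discrete_functor) (use assms in auto)
  then obtain P p where P: "is_limit (discrete_cat ?S) C ?D P p"
    using limit_exists(1)[of "discrete_cat ?S" ?D] by (auto simp: discrete_cat_def)
  have cone: "is_cone (discrete_cat ?S) C ?D Z q \<longleftrightarrow>
      Z \<in> Obj C \<and> q x \<in> Hom C Z X \<and> q y \<in> Hom C Z Y" for Z q
    using ne unfolding is_cone_def
    by (auto simp: discrete_cat_def Hom_def)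
  have "is_product2 C X Y (P, p x, p y)"
    unfolding is_product2_def
  proof (clarsimp, intro conjI ballI)
    show "P \<in> Obj C" "p x \<in> Hom C P X" "p y \<in> Hom C P Y"
      using P cone unfolding is_limit_def by auto
  next
    fix Z f g assume z: "Z \<in> Obj C" "f \<in> Hom C Z X" "g \<in> Hom C Z Y"
    let ?q = "\<lambda>i. if i = x then f else g"
    have "is_cone (discrete_cat ?S) C ?D Z ?q" unfolding cone using z ne by auto
    then have "\<exists>!h. h \<in> Hom C Z P \<and> (\<forall>j\<in>Obj (discrete_cat ?S). p j \<cdot> h = ?q j)"
      using P unfolding is_limit_def by blast
    then show "\<exists>!h. h \<in> Hom C Z P \<and> p x \<cdot> h = f \<and> p y \<cdot> h = g"
      using ne by (simp add: discrete_cat_def)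
  qed
  then show ?thesis by blast
qed

lemma pushout_exists:
  assumes f: "f \<in> Hom C A B" and g: "g \<in> Hom C A D"
  shows "\<exists>a b. is_pushout C f g a b"
proof -
  obtain e :: "nat \<Rightarrow> 'u" where e: "inj e"
    using infinite_universe by (meson infinite_countable_subset)
  obtain x y z s t :: 'u where dist: "distinct [x, y, z, s, t]"
  proof
    show "distinct [e 0, e 1, e 2, e 3, e 4]" using e by (simp add: inj_eq)
  qed
  let ?J = "span_cat x y z s t"
  let ?O = "\<lambda>w. if w = x then A else if w = y then B else D"
  let ?D = "\<lparr>OMap = ?O, AMap = \<lambda>w. if w = s then f else if w = t then g else Ide C (?O w)\<rparr>"
  have J: "category ?J"
    by unfold_locales (use dist in \<open>auto simp: span_cat_def Hom_def\<close>)
  have obs: "A \<in> Obj C" "B \<in> Obj C" "D \<in> Obj C" using f g Hom_Obj by auto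
  have "is_functor ?J C ?D"
    unfolding is_functor_def
    using J category_axioms obs f g dist by (auto simp: span_cat_def Hom_def)
  then obtain P p where P: "is_colimit ?J C ?D P p"
    using limit_exists(2)[of ?J ?D] by (auto simp: span_cat_def)
  have cocone: "is_cocone ?J C ?D Z q \<longleftrightarrow>
      Z \<in> Obj C \<and> q x \<in> Hom C A Z \<and> q y \<in> Hom C B Z \<and> q z \<in> Hom C D Z \<and>
      q y \<cdot> f = q x \<and> q z \<cdot> g = q x" for Z q
    unfolding is_cocone_def using dist by (auto simp: span_cat_def Hom_def obs)
  have c: "is_cocone ?J C ?D P p" using P unfolding is_colimit_def by auto
  note c' = c[unfolded cocone]
  have "is_pushout C f g (p y) (p z)"
    unfolding is_pushout_def
  proof (intro conjI ballI impI)
    fix Z u v assume z: "Z \<in> Obj C" "u \<in> Hom C (Cod C f) Z" "v \<in> Hom C (Cod C g) Z" "u \<cdot> f = v \<cdot> g"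
    let ?q = "\<lambda>w. if w = x then u \<cdot> f else if w = y then u else v"
    have "is_cocone ?J C ?D Z ?q" unfolding cocone using z f g dist by (auto simp: Hom_def)
    then have ex: "\<exists>!h. h \<in> Hom C P Z \<and> (\<forall>j\<in>Obj ?J. h \<cdot> p j = ?q j)"
      using P unfolding is_colimit_def by blast
    have "(h \<in> Hom C P Z \<and> (\<forall>j\<in>Obj ?J. h \<cdot> p j = ?q j)) \<longleftrightarrow>
       (h \<in> Hom C P Z \<and> h \<cdot> p y = u \<and> h \<cdot> p z = v)" for h
    proof -
      have "h \<cdot> p x = u \<cdot> f" if "h \<in> Hom C P Z" "h \<cdot> p y = u"
      proof -
        have "h \<cdot> p x = h \<cdot> (p y \<cdot> f)" using c' by simp
        also have "\<dots> = (h \<cdot> p y) \<cdot> f" using that c' f by (auto simp: Hom_def)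
        finally show ?thesis using that by simp
      qed
      then show ?thesis using dist by (auto simp: span_cat_def)
    qed
    then have "\<exists>!h. h \<in> Hom C P Z \<and> h \<cdot> p y = u \<and> h \<cdot> p z = v" using ex by simp
    moreover have "Cod C (p y) = P" using c' by (simp add: Hom_def)
    ultimately show "\<exists>!h. h \<in> Hom C (Cod C (p y)) Z \<and> h \<cdot> p y = u \<and> h \<cdot> p z = v"
      by simp
  qed (use c' f g in \<open>auto simp: Hom_def\<close>)
  then show ?thesis by blast
qed

end

lemma is_pushoutD:
  assumes "is_pushout C f g a b"
  shows "f \<in> Arr C" "g \<in> Arr C" "a \<in> Arr C" "b \<in> Arr C" "Dom C f = Dom C g"
    "Dom C a = Cod C f" "Dom C b = Cod C g" "Cod C a = Cod C b"
    "Comp C a f = Comp C b g"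
  using assms by (auto simp: is_pushout_def)

lemma is_pushoutE:
  assumes "is_pushout C f g a b" "Z \<in> Obj C" "u \<in> Hom C (Cod C f) Z" "v \<in> Hom C (Cod C g) Z"
    "Comp C u f = Comp C v g"
  shows "\<exists>!h. h \<in> Hom C (Cod C a) Z \<and> Comp C h a = u \<and> Comp C h b = v"
  using assms(1) unfolding is_pushout_def using assms(2-5) by blast

section \<open>Extension properties of relative cell complexes\<close>

context category
begin

text \<open>This is lifting against the map from \<open>Z\<close> to the terminal object, phrased
  without that object. The property survives every construction that leads from \<open>K\<close> to
  \<open>cof U C K\<close>.\<close>

definition extendable where
  "extendable Z f \<longleftrightarrow> f \<in> Arr C \<and>
     (\<forall>g\<in>Hom C (Dom C f) Z. \<exists>h\<in>Hom C (Cod C f) Z. h \<cdot> f = g)"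

lemma extendable_coproducts:
  assumes K: "\<And>k. k \<in> K \<Longrightarrow> extendable Z k" and h: "h \<in> coproducts_of_maps (U :: 'u itself) C K"
  shows "extendable Z h"
proof -
  obtain I :: "'u set" and k A a B b where I: "k ` I \<subseteq> K"
     "is_coproduct C I (\<lambda>i. Dom C (k i)) A a" "is_coproduct C I (\<lambda>i. Cod C (k i)) B b"
     "h \<in> Hom C A B" "\<forall>i\<in>I. h \<cdot> a i = b i \<cdot> k i"
    using h unfolding coproducts_of_maps_def mem_Collect_eq
    by (elim exE conjE, hypsubst) (rule that, assumption+)
  show ?thesis unfolding extendable_def
  proof (intro conjI ballI)
    show "h \<in> Arr C" using I(4) HomD by auto
    fix g assume g: "g \<in> Hom C (Dom C h) Z"
    have Z: "Z \<in> Obj C" using g Hom_Obj by auto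
    have a: "a i \<in> Hom C (Dom C (k i)) A" and b: "b i \<in> Hom C (Cod C (k i)) B"
      and k: "extendable Z (k i)" if "i \<in> I" for i
      using I(1-3) K that unfolding is_coproduct_def by auto
    have gA: "g \<in> Hom C A Z" using g I(4) by (simp add: Hom_def)
    have "\<exists>q\<in>Hom C (Cod C (k i)) Z. q \<cdot> k i = g \<cdot> a i" if "i \<in> I" for i
      using k[OF that] Comp_Hom[OF a[OF that] gA] unfolding extendable_def by blast
    then obtain q where q: "\<And>i. i \<in> I \<Longrightarrow> q i \<in> Hom C (Cod C (k i)) Z"
       "\<And>i. i \<in> I \<Longrightarrow> q i \<cdot> k i = g \<cdot> a i"
      by metis
    obtain m where m: "m \<in> Hom C B Z" "\<And>i. i \<in> I \<Longrightarrow> m \<cdot> b i = q i"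
    proof -
      have "\<exists>!m. m \<in> Hom C B Z \<and> (\<forall>i\<in>I. m \<cdot> b i = q i)"
        using I(3)[unfolded is_coproduct_def, THEN conjunct2, THEN conjunct2, THEN bspec, OF Z] q(1)
        by simp
      then show ?thesis using that by blast
    qed
    have "m \<cdot> h \<in> Hom C A Z" using m(1) I(4) Comp_Hom by blast
    moreover have "(m \<cdot> h) \<cdot> a i = g \<cdot> a i" if "i \<in> I" for i
    proof -
      have "(m \<cdot> h) \<cdot> a i = m \<cdot> (h \<cdot> a i)"
        using m(1) I(4) a[OF that] by (simp add: Hom_def)
      also have "\<dots> = m \<cdot> (b i \<cdot> k i)" using I(5) that by simp
      also have "\<dots> = (m \<cdot> b i) \<cdot> k i"
        using m(1) b[OF that] k[OF that] by (simp add: Hom_def extendable_def)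
      finally show ?thesis using m(2) q(2) that by simp
    qed
    moreover have "\<exists>!h. h \<in> Hom C A Z \<and> (\<forall>i\<in>I. h \<cdot> a i = g \<cdot> a i)"
    proof -
      have "\<forall>i\<in>I. g \<cdot> a i \<in> Hom C (Dom C (k i)) Z" using a gA Comp_Hom by blast
      with I(2)[unfolded is_coproduct_def, THEN conjunct2, THEN conjunct2, THEN bspec, OF Z]
      show ?thesis by simp
    qed
    ultimately have "m \<cdot> h = g" using gA by blast
    moreover have "Cod C h = B" using I(4) HomD by auto
    ultimately show "\<exists>u\<in>Hom C (Cod C h) Z. u \<cdot> h = g" using m(1) by blast
  qed
qed

lemma extendable_pushouts:
  assumes K: "\<And>k. k \<in> K \<Longrightarrow> extendable Z k" and g: "g \<in> pushouts_of_maps C K"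
  shows "extendable Z g"
proof -
  obtain k u b where k: "k \<in> K" and P: "is_pushout C k u b g"
    using g unfolding pushouts_of_maps_def by blast
  note P' = is_pushoutD[OF P]
  show ?thesis unfolding extendable_def
  proof (intro conjI ballI)
    show "g \<in> Arr C" by (rule P')
    fix x assume x: "x \<in> Hom C (Dom C g) Z"
    then have Z: "Z \<in> Obj C" using Hom_Obj by auto
    have "x \<cdot> u \<in> Hom C (Dom C k) Z" using x P' by (simp add: Hom_def)
    then obtain y where y: "y \<in> Hom C (Cod C k) Z" "y \<cdot> k = x \<cdot> u"
      using K[OF k] unfolding extendable_def by blast
    obtain h where "h \<in> Hom C (Cod C b) Z" "h \<cdot> g = x"
      using is_pushoutE[OF P Z y(1), of x] y(2) x P' by auto
    then show "\<exists>h\<in>Hom C (Cod C g) Z. h \<cdot> g = x" using P' by auto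
  qed
qed

text \<open>Extensions are chosen by well-founded recursion over the stages. There is a choice at
  successor stages only; at a limit stage the colimit property forces the value.\<close>

lemma extendable_transfinite:
  assumes K: "\<And>k. k \<in> K \<Longrightarrow> extendable Z k" and t: "t \<in> transfinite_compositions U C K"
  shows "extendable Z t"
proof -
  obtain r F X p m where t: "t = p m" and S: "is_sequence U C r F"
    and N: "\<And>x y. is_next r x y \<Longrightarrow> AMap F (x, y) \<in> K"
    and cl: "is_colimit (poset_cat r) C F X p" and m: "is_min r m"
    using t unfolding transfinite_compositions_def by blast
  have wo: "Well_order r" and fn: "is_functor (poset_cat r) C F"
    and lim: "\<And>y. is_limit_stage r y \<Longrightarrow>
        is_colimit (poset_cat (Restr r (underS r y))) C F (OMap F y) (\<lambda>x. AMap F (x, y))"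
    using S unfolding is_sequence_def by auto
  have refl: "(x, x) \<in> r" if "x \<in> Field r" for x
    using wo that by (auto simp: well_order_on_def linear_order_on_def partial_order_on_def
        preorder_on_def refl_on_def)
  have trans: "trans r" and antisym: "antisym r"
    using wo by (auto simp: well_order_on_def linear_order_on_def partial_order_on_def preorder_on_def)
  have wf: "wf (r - Id)" using wo by (simp add: well_order_on_def)
  have fld: "x \<in> Field r" "y \<in> Field r" if "(x, y) \<in> r" for x y
    using that by (auto simp: Field_def)
  have obj: "OMap F x \<in> Obj C" and idm: "AMap F (x, x) = Ide C (OMap F x)" if "x \<in> Field r" for x
    using fn that unfolding is_functor_def by (auto simp: poset_cat_def)
  have mor: "AMap F (x, y) \<in> Hom C (OMap F x) (OMap F y)" if "(x, y) \<in> r" for x y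
    using fn that unfolding is_functor_def by (auto simp: poset_cat_def Hom_def)
  have cmp: "AMap F (x, z) = AMap F (y, z) \<cdot> AMap F (x, y)" if "(x, y) \<in> r" "(y, z) \<in> r" for x y z
  proof -
    have "(x, y) \<in> Hom (poset_cat r) x y" "(y, z) \<in> Hom (poset_cat r) y z"
      using that by (auto simp: poset_cat_def Hom_def)
    with fn have "AMap F (Comp (poset_cat r) (y, z) (x, y)) = AMap F (y, z) \<cdot> AMap F (x, y)"
      unfolding is_functor_def by blast
    then show ?thesis by (simp add: poset_cat_def)
  qed
  have mF: "m \<in> Field r" using m by (simp add: is_min_def)
  have pm: "p x \<in> Hom C (OMap F x) X" if "x \<in> Field r" for x
    using cl that unfolding is_colimit_def is_cocone_def by (auto simp: poset_cat_def)
  show ?thesis unfolding extendable_def t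
  proof (intro conjI ballI)
    show "p m \<in> Arr C" using pm[OF mF] HomD by auto
    fix g assume "g \<in> Hom C (Dom C (p m)) Z"
    then have g: "g \<in> Hom C (OMap F m) Z" using pm[OF mF] by (simp add: Hom_def)
    then have Z: "Z \<in> Obj C" using Hom_Obj by auto
    \<comment> \<open>Compatibility is recorded with all earlier stages and not just with the
      predecessor, because at a limit stage the earlier choices must form a cocone.\<close>
    let ?P = "\<lambda>q y h. y \<in> Field r \<longrightarrow> h \<in> Hom C (OMap F y) Z \<and> (y = m \<longrightarrow> h = g) \<and>
       (\<forall>x\<in>underS r y. h \<cdot> AMap F (x, y) = q x)"
    have "\<exists>q. \<forall>y. ?P q y (q y)"
    proof (rule dependent_wf_choice[OF wf])
      fix f f' :: "_ \<Rightarrow> 'm" and x h assume "\<And>z. (z, x) \<in> r - Id \<Longrightarrow> f z = f' z"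
      then have "f z = f' z" if "z \<in> underS r x" for z using that by (auto simp: underS_def)
      then show "?P f x h = ?P f' x h" by simp
    next
      fix y f assume IH: "\<And>x. (x, y) \<in> r - Id \<Longrightarrow> ?P f x (f x)"
      have f: "f x \<in> Hom C (OMap F x) Z" "\<And>w. w \<in> underS r x \<Longrightarrow> f x \<cdot> AMap F (w, x) = f w"
        if "x \<in> underS r y" for x
        using IH[of x] that fld[of x y] by (auto simp: underS_def)
      have f': "f x \<cdot> AMap F (w, x) = f w" if "x \<in> underS r y" "(w, x) \<in> r" for w x
      proof (cases "w = x")
        case True
        then show ?thesis using f(1)[OF that(1)] idm[OF fld(1)] that(2) by (auto simp: Hom_def)
      next
        case False then show ?thesis using f(2)[OF that(1)] that(2) by (auto simp: underS_def)
      qed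
      consider "y \<notin> Field r" | "y = m" | x where "y \<in> Field r" "y \<noteq> m" "is_next r x y"
        | "is_limit_stage r y" "y \<noteq> m"
      proof (cases "y \<in> Field r \<and> y \<noteq> m \<and> (\<nexists>x. is_next r x y)")
        case True
        moreover have "\<not> is_min r y"
          using True m antisym unfolding is_min_def antisym_def by blast
        ultimately show ?thesis using that(4) by (auto simp: is_limit_stage_def)
      qed (use that in blast)
      then show "\<exists>h. ?P f y h"
      proof cases
        case 1 then show ?thesis by blast
      next
        case 2
        have "underS r y = {}" using m antisym 2 unfolding underS_def is_min_def antisym_def
          by (auto simp: Field_def)
        with 2 g show ?thesis by auto
      next
        case (3 x)
        then have x: "x \<in> underS r y" "(x, y) \<in> r" by (auto simp: is_next_def underS_def)
        have "extendable Z (AMap F (x, y))" using K N 3 by blast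
        then obtain h where h: "h \<in> Hom C (OMap F y) Z" "h \<cdot> AMap F (x, y) = f x"
          using f(1)[OF x(1)] mor[OF x(2)] unfolding extendable_def by (auto simp: HomD)
        have "h \<cdot> AMap F (w, y) = f w" if "w \<in> underS r y" for w
        proof -
          have wx: "(w, x) \<in> r" using 3 that by (auto simp: is_next_def)
          have "h \<cdot> AMap F (w, y) = (h \<cdot> AMap F (x, y)) \<cdot> AMap F (w, x)"
            using cmp[OF wx x(2)] h(1) mor[OF wx] mor[OF x(2)] by (simp add: Hom_def)
          then show ?thesis using h(2) f'[OF x(1) wx] by simp
        qed
        with h 3(2) show ?thesis by (intro exI[of _ h]) simp
      next
        case 4
        let ?r = "Restr r (underS r y)"
        have fl: "Field ?r = underS r y"
          using refl by (auto simp: Field_def underS_def)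
        have "is_cocone (poset_cat ?r) C F Z f"
          unfolding is_cocone_def
          using Z f(1) f' fl by (auto simp: poset_cat_def)
        with lim[OF 4(1)] have "\<exists>!h. h \<in> Hom C (OMap F y) Z \<and>
            (\<forall>j\<in>Obj (poset_cat ?r). h \<cdot> AMap F (j, y) = f j)"
          unfolding is_colimit_def by blast
        then obtain h where "h \<in> Hom C (OMap F y) Z \<and>
            (\<forall>j\<in>Obj (poset_cat ?r). h \<cdot> AMap F (j, y) = f j)"
          by (elim ex1E) auto
        moreover have "Obj (poset_cat ?r) = underS r y" using fl by (simp add: poset_cat_def)
        ultimately have "h \<in> Hom C (OMap F y) Z" "\<forall>x\<in>underS r y. h \<cdot> AMap F (x, y) = f x"
          by auto
        with 4(2) show ?thesis by (intro exI[of _ h]) simp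
      qed
    qed
    then obtain q where q: "\<And>y. ?P q y (q y)" by blast
    have "is_cocone (poset_cat r) C F Z q"
      unfolding is_cocone_def
    proof (intro conjI ballI)
      fix u assume "u \<in> Arr (poset_cat r)"
      then obtain x y where u: "u = (x, y)" "(x, y) \<in> r" by (cases u) (auto simp: poset_cat_def)
      have "q y \<cdot> AMap F (x, y) = q x"
      proof (cases "x = y")
        case True
        then show ?thesis using q[of y] idm[of y] fld[OF u(2)] by (auto simp: Hom_def)
      next
        case False
        then have "x \<in> underS r y" using u by (auto simp: underS_def)
        then show ?thesis using q[of y] fld[OF u(2)] by blast
      qed
      then show "q (Cod (poset_cat r) u) \<cdot> AMap F u = q (Dom (poset_cat r) u)"
        by (simp add: u poset_cat_def)
    qed (use q Z in \<open>auto simp: poset_cat_def\<close>)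
    with cl have "\<exists>!h. h \<in> Hom C X Z \<and> (\<forall>j\<in>Obj (poset_cat r). h \<cdot> p j = q j)"
      unfolding is_colimit_def by blast
    then obtain h where "h \<in> Hom C X Z" "\<forall>j\<in>Field r. h \<cdot> p j = q j"
      by (elim ex1E) (auto simp: poset_cat_def)
    moreover have "q m = g" using q mF by blast
    moreover have "Cod C (p m) = X" using pm[OF mF] HomD by auto
    ultimately show "\<exists>h\<in>Hom C (Cod C (p m)) Z. h \<cdot> p m = g" using mF by blast
  qed
qed

lemma extendable_retract:
  assumes "is_retract C f g" "extendable Z g"
  shows "extendable Z f"
proof -
  obtain i r j s where fg: "f \<in> Arr C" "g \<in> Arr C" and
    i: "i \<in> Hom C (Dom C f) (Dom C g)" and r: "r \<in> Hom C (Dom C g) (Dom C f)" and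
    j: "j \<in> Hom C (Cod C f) (Cod C g)" and ri: "r \<cdot> i = Ide C (Dom C f)" and
    gi: "g \<cdot> i = j \<cdot> f"
    using assms(1) unfolding is_retract_def by blast
  show ?thesis unfolding extendable_def
  proof (intro conjI ballI)
    fix x assume x: "x \<in> Hom C (Dom C f) Z"
    obtain h where h: "h \<in> Hom C (Cod C g) Z" "h \<cdot> g = x \<cdot> r"
      using assms(2) Comp_Hom[OF r x] unfolding extendable_def by blast
    have "(h \<cdot> j) \<cdot> f = (h \<cdot> g) \<cdot> i"
      using h(1) j fg i gi by (simp add: Hom_def)
    also have "\<dots> = x \<cdot> (r \<cdot> i)" unfolding h(2) using x r i by (simp add: Hom_def)
    also have "\<dots> = x" using ri x by (simp add: Hom_def)
    finally show "\<exists>h\<in>Hom C (Cod C f) Z. h \<cdot> f = x"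
      using Comp_Hom[OF j h(1)] by blast
  qed fact
qed

lemma extendable_cof:
  assumes "\<And>k. k \<in> K \<Longrightarrow> extendable Z k" "f \<in> cof U C K"
  shows "extendable Z f"
proof -
  obtain g where g: "g \<in> cell U C K" "is_retract C f g" using assms(2) by (auto simp: cof_def)
  have "extendable Z k" if "k \<in> pushouts_of_maps C (coproducts_of_maps U C K)" for k
    by (rule extendable_pushouts[OF _ that]) (rule extendable_coproducts[OF assms(1)])
  then have "extendable Z g"
    by (rule extendable_transfinite[OF _ g(1)[unfolded cell_def]])
  then show ?thesis using g(2) extendable_retract by blast
qed

end

section \<open>Binary products\<close>

context bicomplete_category
begin

lemma chosen_product:
  assumes "X \<in> Obj C" "Y \<in> Obj C"
  shows "is_product2 C X Y (prod_obj C X Y, pr1 C X Y, pr2 C X Y)"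
  using someI_ex[OF product2_exists[OF assms]]
  by (simp add: prod_obj_def pr1_def pr2_def chosen_product_def)

lemma pr_simps [simp]:
  assumes "X \<in> Obj C" "Y \<in> Obj C"
  shows "prod_obj C X Y \<in> Obj C"
    "pr1 C X Y \<in> Arr C" "Dom C (pr1 C X Y) = prod_obj C X Y" "Cod C (pr1 C X Y) = X"
    "pr2 C X Y \<in> Arr C" "Dom C (pr2 C X Y) = prod_obj C X Y" "Cod C (pr2 C X Y) = Y"
  using chosen_product[OF assms] by (auto simp: is_product2_def Hom_def)

lemma pairing_unique:
  assumes "f \<in> Arr C" "g \<in> Arr C" "Dom C f = Dom C g"
  shows "\<exists>!h. h \<in> Hom C (Dom C f) (prod_obj C (Cod C f) (Cod C g)) \<and>
     pr1 C (Cod C f) (Cod C g) \<cdot> h = f \<and> pr2 C (Cod C f) (Cod C g) \<cdot> h = g"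
proof -
  have "Dom C f \<in> Obj C" "f \<in> Hom C (Dom C f) (Cod C f)" "g \<in> Hom C (Dom C f) (Cod C g)"
    using assms by (auto simp: Hom_def)
  then show ?thesis
    using chosen_product[of "Cod C f" "Cod C g"] assms unfolding is_product2_def by auto
qed

lemma pairing_props:
  assumes "f \<in> Arr C" "g \<in> Arr C" "Dom C f = Dom C g"
  shows "pairing C f g \<in> Hom C (Dom C f) (prod_obj C (Cod C f) (Cod C g))"
    "pr1 C (Cod C f) (Cod C g) \<cdot> pairing C f g = f"
    "pr2 C (Cod C f) (Cod C g) \<cdot> pairing C f g = g"
  using theI'[OF pairing_unique[OF assms]] unfolding pairing_def by auto

lemma pairing_simps [simp]:
  assumes "f \<in> Arr C" "g \<in> Arr C" "Dom C f = Dom C g"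
  shows "pairing C f g \<in> Arr C" "Dom C (pairing C f g) = Dom C f"
    "Cod C (pairing C f g) = prod_obj C (Cod C f) (Cod C g)"
    "Cod C f = X \<Longrightarrow> Cod C g = Y \<Longrightarrow> pr1 C X Y \<cdot> pairing C f g = f"
    "Cod C f = X \<Longrightarrow> Cod C g = Y \<Longrightarrow> pr2 C X Y \<cdot> pairing C f g = g"
  using pairing_props[OF assms] by (auto simp: Hom_def)

lemma pairing_eqI:
  assumes "u \<in> Arr C" "v \<in> Arr C" "Dom C u = Dom C v"
    "Cod C u = prod_obj C X Y" "Cod C v = prod_obj C X Y" "X \<in> Obj C" "Y \<in> Obj C"
    "pr1 C X Y \<cdot> u = pr1 C X Y \<cdot> v" "pr2 C X Y \<cdot> u = pr2 C X Y \<cdot> v"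
  shows "u = v"
proof -
  let ?f = "pr1 C X Y \<cdot> v" and ?g = "pr2 C X Y \<cdot> v"
  have "?f \<in> Arr C" "?g \<in> Arr C" "Dom C ?f = Dom C ?g" "Cod C ?f = X" "Cod C ?g = Y"
     "Dom C ?f = Dom C v" using assms by auto
  then show ?thesis
    using pairing_unique[of ?f ?g] assms by (auto simp: Hom_def)
qed

lemma pairing_comp [simp]:
  assumes "f \<in> Arr C" "g \<in> Arr C" "Dom C f = Dom C g" "h \<in> Arr C" "Cod C h = Dom C f"
  shows "pairing C f g \<cdot> h = pairing C (f \<cdot> h) (g \<cdot> h)"
  by (rule pairing_eqI[where X = "Cod C f" and Y = "Cod C g"])
     (use assms in \<open>simp_all flip: comp_assoc\<close>)

lemma pairing_pr [simp]:
  assumes "X \<in> Obj C" "Y \<in> Obj C"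
  shows "pairing C (pr1 C X Y) (pr2 C X Y) = Ide C (prod_obj C X Y)"
  by (rule pairing_eqI[where X = X and Y = Y]) (use assms in simp_all)

lemma pairing_eta [simp]:
  assumes "f \<in> Arr C" "Cod C f = prod_obj C X Y" "X \<in> Obj C" "Y \<in> Obj C"
  shows "pairing C (pr1 C X Y \<cdot> f) (pr2 C X Y \<cdot> f) = f"
  by (rule pairing_eqI[where X = X and Y = Y]) (use assms in simp_all)

lemma prod_map_simps [simp]:
  assumes "f \<in> Arr C" "g \<in> Arr C"
  shows "prod_map C f g \<in> Arr C" "Dom C (prod_map C f g) = prod_obj C (Dom C f) (Dom C g)"
    "Cod C (prod_map C f g) = prod_obj C (Cod C f) (Cod C g)"
  using assms by (auto simp: prod_map_def)

lemma pushout_exists_arr: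
  assumes "f \<in> Arr C" "g \<in> Arr C" "Dom C f = Dom C g"
  shows "\<exists>a b. is_pushout C f g a b"
  by (rule pushout_exists[of f "Dom C f" "Cod C f" g "Cod C g"]) (use assms in \<open>auto simp: Hom_def\<close>)

end

section \<open>Maps of cubes\<close>

lemma topspace_cube [simp]: "topspace (cube n) = ({..<n} \<rightarrow>\<^sub>E {0..1})"
  by (simp add: cube_def)

lemma topspace_bdry [simp]:
  "topspace (bdry n) = {x \<in> {..<n} \<rightarrow>\<^sub>E {0..1}. \<exists>k<n. x k = 0 \<or> x k = 1}"
  by (auto simp: bdry_def)

lemma continuous_map_cube:
  "continuous_map X (cube n) f \<longleftrightarrow> f \<in> topspace X \<rightarrow> extensional {..<n} \<and>
     (\<forall>k<n. continuous_map X (top_of_set {0..1}) (\<lambda>x. f x k))"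
  unfolding cube_def continuous_map_componentwise by auto

lemma continuous_map_bdry:
  "continuous_map X (bdry n) f \<longleftrightarrow> continuous_map X (cube n) f \<and>
     (\<forall>x\<in>topspace X. \<exists>k<n. f x k = 0 \<or> f x k = 1)"
  unfolding bdry_def continuous_map_in_subtopology by (auto simp: continuous_map_def)

lemma continuous_map_coord:
  "k < n \<Longrightarrow> continuous_map (cube n) (top_of_set {0..1}) (\<lambda>x. x k)"
  unfolding cube_def by (rule continuous_map_product_projection) simp

lemma continuous_map_bdry_incl: "continuous_map (bdry n) (cube n) (\<lambda>x. x)"
  unfolding bdry_def by (simp add: continuous_map_from_subtopology)

lemma tmap_eqI: "(\<And>x. x \<in> topspace X \<Longrightarrow> f x = g x) \<Longrightarrow> tmap X Y f = tmap X Y g"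
  by (auto simp: tmap_def restrict_def)

lemma tmap_arr:
  assumes "X \<in> \<S>" "Y \<in> \<S>" "continuous_map X Y f"
  shows "tmap X Y f \<in> Hom (full_Top \<S>) X Y"
  using assms continuous_map_eq[of X Y f "restrict f (topspace X)"]
  by (auto simp: tmap_def full_Top_def Hom_def)

lemma tmap_comp:
  assumes "f \<in> topspace X \<rightarrow> topspace Y"
  shows "tmap Y Z g \<cdot>\<^bsub>full_Top \<S>\<^esub> tmap X Y f = tmap X Z (\<lambda>x. g (f x))"
  using assms by (auto simp: tmap_def full_Top_def restrict_def fun_eq_iff)

lemma full_Top_arrE:
  assumes "\<phi> \<in> Hom (full_Top \<S>) X Y"
  obtains f where "\<phi> = tmap X Y f" "continuous_map X Y f"
proof -
  obtain g where "\<phi> = (X, g, Y)" "continuous_map X Y g" "g \<in> extensional (topspace X)"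
    using assms by (auto simp: Hom_def full_Top_def)
  then have "\<phi> = tmap X Y g" by (simp add: tmap_def extensional_restrict)
  with \<open>continuous_map X Y g\<close> show ?thesis using that[of g] by simp
qed

lemma tmap_simps: "fst (tmap X Y f) = X" "snd (snd (tmap X Y f)) = Y"
  by (auto simp: tmap_def)

lemma Box_Obj [simp]: "cube n \<in> Obj Box" "bdry n \<in> Obj Box"
  by (auto simp: Box_def full_Top_def)

lemma Box2_Obj [simp]: "n \<le> 2 \<Longrightarrow> cube n \<in> Obj Box2" "n \<le> 2 \<Longrightarrow> bdry n \<in> Obj Box2"
  by (auto simp: Box2_def full_Top_def)

lemma tmap_Box: "X \<in> Obj Box \<Longrightarrow> Y \<in> Obj Box \<Longrightarrow> continuous_map X Y f \<Longrightarrow> tmap X Y f \<in> Hom Box X Y"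
  unfolding Box_def by (rule tmap_arr) (auto simp: full_Top_def)

text \<open>The points of \<open>cube 1\<close> are functions on \<open>{..<1}\<close>, so a
  real-valued function must be wrapped before it is a map of spaces.\<close>

definition ifun :: "space \<Rightarrow> ((nat \<Rightarrow> real) \<Rightarrow> real) \<Rightarrow> space_map" where
  "ifun X r = tmap X (cube 1) (\<lambda>x. \<lambda>i\<in>{..<1}. r x)"

abbreviation icont :: "space \<Rightarrow> ((nat \<Rightarrow> real) \<Rightarrow> real) \<Rightarrow> bool" where
  "icont X r \<equiv> continuous_map X (top_of_set {0..1}) r"

lemma coord_ifun: "coord n k = ifun (cube n) (\<lambda>x. x k)"
  by (simp add: coord_def ifun_def)

lemma endpoint_ifun: "endpoint k = ifun (cube 0) (\<lambda>_. k)"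
  by (simp add: endpoint_def ifun_def)

lemma continuous_ifun: "icont X r \<Longrightarrow> continuous_map X (cube 1) (\<lambda>x. \<lambda>i\<in>{..<1}. r x)"
  unfolding continuous_map_cube by auto

lemma ifun_Box [simp]: "X \<in> Obj Box \<Longrightarrow> icont X r \<Longrightarrow> ifun X r \<in> Hom Box X (cube 1)"
  unfolding ifun_def by (rule tmap_Box[OF _ _ continuous_ifun]) simp_all

lemma ifun_cong: "(\<And>x. x \<in> topspace X \<Longrightarrow> r x = s x) \<Longrightarrow> ifun X r = ifun X s"
  unfolding ifun_def by (rule tmap_eqI) auto

lemma Box_cube1E:
  assumes "\<phi> \<in> Hom Box X (cube 1)"
  obtains r where "\<phi> = ifun X r" "icont X r"
proof -
  obtain f where f: "\<phi> = tmap X (cube 1) f" "continuous_map X (cube 1) f"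
    using assms unfolding Box_def by (rule full_Top_arrE)
  have "f x = (\<lambda>i\<in>{..<1}. f x 0)" if "x \<in> topspace X" for x
    using continuous_map_funspace[OF f(2)] that by (auto simp: PiE_def extensional_def restrict_def fun_eq_iff)
  then have "\<phi> = ifun X (\<lambda>x. f x 0)" unfolding f(1) ifun_def by (rule tmap_eqI)
  moreover have "icont X (\<lambda>x. f x 0)" using f(2) by (auto simp: continuous_map_cube)
  ultimately show ?thesis by (rule that)
qed

lemma Box2_Box: "X \<in> Obj Box2 \<Longrightarrow> Y \<in> Obj Box2 \<Longrightarrow> Hom Box2 X Y = Hom Box X Y"
proof -
  assume "X \<in> Obj Box2" "Y \<in> Obj Box2"
  then have XY: "X \<in> cube ` {..2} \<union> bdry ` {..2}" "Y \<in> cube ` {..2} \<union> bdry ` {..2}"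
    by (auto simp: Box2_def full_Top_def)
  have "Hom (full_Top S) X Y = {(X, g, Y) | g. continuous_map X Y g \<and> g \<in> extensional (topspace X)}"
    if "X \<in> S" "Y \<in> S" for S
    using that by (auto simp: full_Top_def Hom_def)
  from this[OF XY] this[of "range cube \<union> range bdry"] XY show ?thesis
    unfolding Box_def Box2_def by blast
qed

lemma Box2_comp: "f \<cdot>\<^bsub>Box2\<^esub> g = f \<cdot>\<^bsub>Box\<^esub> g"
  by (simp add: Box_def Box2_def full_Top_def)

lemma tmap_comp_Box:
  assumes "f \<in> topspace X \<rightarrow> topspace Y"
  shows "tmap Y Z g \<cdot>\<^bsub>Box\<^esub> tmap X Y f = tmap X Z (\<lambda>x. g (f x))"
  unfolding Box_def by (rule tmap_comp[OF assms])

lemma ifun_comp: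
  assumes "f \<in> topspace X \<rightarrow> topspace Y"
  shows "ifun Y r \<cdot>\<^bsub>Box\<^esub> tmap X Y f = ifun X (\<lambda>x. r (f x))"
  unfolding ifun_def by (rule tmap_comp_Box[OF assms])

declare One_nat_def [simp del]

lemma icont_iff:
  "icont X r \<longleftrightarrow> continuous_map X euclideanreal r \<and> (\<forall>x\<in>topspace X. 0 \<le> r x \<and> r x \<le> 1)"
  by (auto simp: continuous_map_in_subtopology Pi_iff)

lemma icont_mult [simp]: "icont X r \<Longrightarrow> icont X s \<Longrightarrow> icont X (\<lambda>x. r x * s x)"
  unfolding icont_iff by (auto intro!: continuous_map_real_mult mult_le_one)

lemma icont_diff [simp]: "icont X r \<Longrightarrow> icont X (\<lambda>x. 1 - r x)"
  unfolding icont_iff by (auto intro!: continuous_map_diff)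

lemma icont_max [simp]: "icont X r \<Longrightarrow> icont X s \<Longrightarrow> icont X (\<lambda>x. max (r x) (s x))"
  unfolding icont_iff by (auto simp: le_max_iff_disj intro!: continuous_map_real_max)

lemma icont_convex [simp]:
  assumes "icont X r" "icont X s" "icont X t"
  shows "icont X (\<lambda>x. (1 - r x) * s x + r x * t x)"
  using assms unfolding icont_iff
  by (auto intro!: continuous_map_real_mult continuous_map_diff continuous_map_add convex_bound_le)

lemma icont_const [simp]: "0 \<le> k \<Longrightarrow> k \<le> 1 \<Longrightarrow> icont X (\<lambda>_. k)"
  by (auto simp: icont_iff)

lemma icont_coord [simp]: "k < n \<Longrightarrow> icont (cube n) (\<lambda>x. x k)"
  by (rule continuous_map_coord)

lemma icont_comp:
  "icont (cube 1) (\<lambda>x. f (x 0)) \<Longrightarrow> icont X r \<Longrightarrow> icont X (\<lambda>x. f (r x))"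
  using continuous_map_compose[OF continuous_ifun, of X r "top_of_set {0..1}" "\<lambda>x. f (x 0)"]
  by (simp add: comp_def)

lemma icont_comp2:
  assumes "icont (cube 2) (\<lambda>x. f (x 0) (x 1))" "icont X r" "icont X s"
  shows "icont X (\<lambda>x. f (r x) (s x))"
proof -
  have "continuous_map X (cube 2) (\<lambda>x. \<lambda>i\<in>{..<2}. if i = 0 then r x else s x)"
    unfolding continuous_map_cube using assms(2,3) by auto
  from continuous_map_compose[OF this assms(1)] show ?thesis by (simp add: comp_def)
qed

section \<open>Good Q-structures\<close>

locale good_Q =
  fixes C :: "('o, 'm) cat" (structure) and \<iota> :: "('o, 'm) box_functor"
    and U :: "'u itself" and a b :: space_map
  assumes uncountable_universe: "uncountable (UNIV :: 'u set)"
    and good: "good_Q_structure U C \<iota>"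
    and interval: "interval_square C \<iota> a b"
begin

lemma Q: "Q_structure U C \<iota>"
  using good by (simp add: good_Q_structure_def)

sublocale bicomplete_category C U
proof -
  have "bicomplete U C" using Q by (simp add: Q_structure_def)
  then interpret category C by (simp add: bicomplete_def)
  show "bicomplete_category C U"
    by unfold_locales (fact \<open>bicomplete U C\<close> uncountable_universe)+
qed

lemma box_functor: "is_functor Box C \<iota>"
  using Q by (simp add: Q_structure_def faithful_functor_def)

abbreviation "point \<equiv> OMap \<iota> (cube 0)"
abbreviation "I \<equiv> OMap \<iota> (cube 1)"

lemma terminal: "is_terminal C point"
  using Q by (simp add: Q_structure_def category_with_intervals_def)

lemma OMap_Obj [simp]: "X \<in> Obj Box \<Longrightarrow> OMap \<iota> X \<in> Obj C"
  using box_functor by (simp add: is_functor_def)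

lemma AMap_Hom: "\<phi> \<in> Hom Box X Y \<Longrightarrow> AMap \<iota> \<phi> \<in> Hom C (OMap \<iota> X) (OMap \<iota> Y)"
  using box_functor by (simp add: is_functor_def)

lemma AMap_simps:
  assumes "\<phi> \<in> Hom Box X Y"
  shows "AMap \<iota> \<phi> \<in> Arr C" "Dom C (AMap \<iota> \<phi>) = OMap \<iota> X" "Cod C (AMap \<iota> \<phi>) = OMap \<iota> Y"
  using AMap_Hom[OF assms] by (auto simp: Hom_def)

lemma AMap_comp:
  "\<phi> \<in> Hom Box X Y \<Longrightarrow> \<psi> \<in> Hom Box Y Z \<Longrightarrow> AMap \<iota> \<psi> \<cdot> AMap \<iota> \<phi> = AMap \<iota> (\<psi> \<cdot>\<^bsub>Box\<^esub> \<phi>)"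
  using box_functor unfolding is_functor_def by metis

lemma AMap_Ide: "X \<in> Obj Box \<Longrightarrow> AMap \<iota> (tmap X X (\<lambda>x. x)) = Ide C (OMap \<iota> X)"
  using box_functor by (simp add: is_functor_def Box_def full_Top_def)

lemma bang_ex1: "X \<in> Obj C \<Longrightarrow> \<exists>!h. h \<in> Hom C X point"
  using terminal by (simp add: is_terminal_def)

lemma bang_Hom: "X \<in> Obj C \<Longrightarrow> bang C \<iota> X \<in> Hom C X point"
  unfolding bang_def by (rule theI'[OF bang_ex1])

lemma bang_simps [simp]:
  assumes "X \<in> Obj C"
  shows "bang C \<iota> X \<in> Arr C" "Dom C (bang C \<iota> X) = X" "Cod C (bang C \<iota> X) = point"
  using bang_Hom[OF assms] by (auto simp: Hom_def)

abbreviation "to_pt \<equiv> bang C \<iota>"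

lemma to_point_eq:
  assumes "f \<in> Arr C" "Cod C f = point"
  shows "f = to_pt (Dom C f)"
proof -
  have "f \<in> Hom C (Dom C f) point" "to_pt (Dom C f) \<in> Hom C (Dom C f) point"
    using assms bang_Hom by (auto simp: Hom_def)
  then show ?thesis using bang_ex1[of "Dom C f"] assms by auto
qed

lemma bang_comp [simp]: "f \<in> Arr C \<Longrightarrow> Cod C f = Y \<Longrightarrow> to_pt Y \<cdot> f = to_pt (Dom C f)"
  using to_point_eq[of "to_pt Y \<cdot> f"] by auto

lemma bang_point [simp]: "to_pt point = Ide C point"
  using to_point_eq[of "Ide C point"] by simp

lemma pr2_point [simp]: "X \<in> Obj C \<Longrightarrow> pr2 C X point = to_pt (prod_obj C X point)"
  using to_point_eq[of "pr2 C X point"] by simp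

lemma pr1_point [simp]: "X \<in> Obj C \<Longrightarrow> pr1 C point X = to_pt (prod_obj C point X)"
  using to_point_eq[of "pr1 C point X"] by simp

definition cst :: "real \<Rightarrow> 'o \<Rightarrow> 'm" where
  "cst k X = AMap \<iota> (endpoint k) \<cdot> to_pt X"

lemma endpoint_simps [simp]:
  assumes "0 \<le> k" "k \<le> 1"
  shows "AMap \<iota> (endpoint k) \<in> Arr C" "Dom C (AMap \<iota> (endpoint k)) = point"
    "Cod C (AMap \<iota> (endpoint k)) = I"
  using AMap_simps[OF ifun_Box[of "cube 0" "\<lambda>_. k"]] assms by (simp_all add: endpoint_ifun)

lemma endpoint_cst: "0 \<le> k \<Longrightarrow> k \<le> 1 \<Longrightarrow> AMap \<iota> (endpoint k) = cst k point"
  by (simp add: cst_def)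

lemma cst_simps [simp]:
  assumes "0 \<le> k" "k \<le> 1" "X \<in> Obj C"
  shows "cst k X \<in> Arr C" "Dom C (cst k X) = X" "Cod C (cst k X) = I"
  using assms by (auto simp: cst_def)

lemma cst_comp [simp]:
  "0 \<le> k \<Longrightarrow> k \<le> 1 \<Longrightarrow> f \<in> Arr C \<Longrightarrow> Cod C f = Y \<Longrightarrow> cst k Y \<cdot> f = cst k (Dom C f)"
  by (auto simp: cst_def)

lemma cyl_end_eq:
  "0 \<le> k \<Longrightarrow> k \<le> 1 \<Longrightarrow> X \<in> Obj C \<Longrightarrow> cyl_end C \<iota> k X = pairing C (Ide C X) (cst k X)"
  by (simp add: slice_def cst_def)

lemma cube_product:
  assumes "n \<ge> 1"
  shows "is_product C {..<n} (\<lambda>_. I) (OMap \<iota> (cube n)) (\<lambda>k. AMap \<iota> (coord n k))"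
  using good assms by (simp add: good_Q_structure_def)

lemma coord_simps [simp]:
  assumes "k < n"
  shows "AMap \<iota> (coord n k) \<in> Arr C" "Dom C (AMap \<iota> (coord n k)) = OMap \<iota> (cube n)"
    "Cod C (AMap \<iota> (coord n k)) = I"
  using AMap_simps[OF ifun_Box[of "cube n" "\<lambda>x. x k"]] assms by (simp_all add: coord_ifun)

definition tuple :: "nat \<Rightarrow> 'o \<Rightarrow> (nat \<Rightarrow> 'm) \<Rightarrow> 'm" where
  "tuple n W t = (THE h. h \<in> Hom C W (OMap \<iota> (cube n)) \<and> (\<forall>k<n. AMap \<iota> (coord n k) \<cdot> h = t k))"

lemma tuple_ex1:
  assumes "n \<ge> 1" "W \<in> Obj C" "\<And>k. k < n \<Longrightarrow> t k \<in> Hom C W I"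
  shows "\<exists>!h. h \<in> Hom C W (OMap \<iota> (cube n)) \<and> (\<forall>k<n. AMap \<iota> (coord n k) \<cdot> h = t k)"
  using cube_product[OF assms(1), unfolded is_product_def, THEN conjunct2, THEN conjunct2,
      THEN bspec, OF assms(2), THEN spec, of t] assms(3)
  by (simp add: Ball_def)

lemma tuple_props:
  assumes "n \<ge> 1" "W \<in> Obj C" "\<And>k. k < n \<Longrightarrow> t k \<in> Hom C W I"
  shows "tuple n W t \<in> Arr C" "Dom C (tuple n W t) = W" "Cod C (tuple n W t) = OMap \<iota> (cube n)"
    "k < n \<Longrightarrow> AMap \<iota> (coord n k) \<cdot> tuple n W t = t k"
  using theI'[OF tuple_ex1[of n W t, OF assms]] unfolding tuple_def[symmetric] by (auto simp: Hom_def)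

lemma cube_eqI:
  assumes "n \<ge> 1" "u \<in> Arr C" "v \<in> Arr C" "Dom C u = Dom C v"
    "Cod C u = OMap \<iota> (cube n)" "Cod C v = OMap \<iota> (cube n)"
    "\<And>k. k < n \<Longrightarrow> AMap \<iota> (coord n k) \<cdot> u = AMap \<iota> (coord n k) \<cdot> v"
  shows "u = v"
proof -
  have "AMap \<iota> (coord n k) \<cdot> v \<in> Hom C (Dom C v) I" if "k < n" for k
    using assms(3,6) that by (auto simp: Hom_def)
  from tuple_ex1[OF assms(1), of "Dom C v" "\<lambda>k. AMap \<iota> (coord n k) \<cdot> v", OF _ this]
  have "\<exists>!h. h \<in> Hom C (Dom C v) (OMap \<iota> (cube n)) \<and>
      (\<forall>k<n. AMap \<iota> (coord n k) \<cdot> h = AMap \<iota> (coord n k) \<cdot> v)"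
    using assms(3) by simp
  moreover have "u \<in> Hom C (Dom C v) (OMap \<iota> (cube n))" "v \<in> Hom C (Dom C v) (OMap \<iota> (cube n))"
    using assms(2-6) by (auto simp: Hom_def)
  ultimately show ?thesis using assms(7) by blast
qed

text \<open>Maps to \<open>I\<close> are treated as elements of \<open>[0, 1]\<close>, to which continuous operations can be applied.
  The binary ones use that \<open>I\<^sup>2\<close> is a product (Q7).\<close>

definition app1 :: "(real \<Rightarrow> real) \<Rightarrow> 'm \<Rightarrow> 'm" where
  "app1 f t = AMap \<iota> (ifun (cube 1) (\<lambda>x. f (x 0))) \<cdot> t"

definition app2 :: "(real \<Rightarrow> real \<Rightarrow> real) \<Rightarrow> 'm \<Rightarrow> 'm \<Rightarrow> 'm" where
  "app2 f t s = AMap \<iota> (ifun (cube 2) (\<lambda>x. f (x 0) (x 1))) \<cdot>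
     tuple 2 (Dom C t) (\<lambda>k. if k = 0 then t else s)"

abbreviation "c1 f \<equiv> icont (cube 1) (\<lambda>x. f (x 0))"
abbreviation "c2 f \<equiv> icont (cube 2) (\<lambda>x. f (x 0) (x 1))"

lemma ifun_arr [simp]:
  assumes "icont X r" "X \<in> Obj Box"
  shows "AMap \<iota> (ifun X r) \<in> Arr C" "Dom C (AMap \<iota> (ifun X r)) = OMap \<iota> X"
    "Cod C (AMap \<iota> (ifun X r)) = I"
  using AMap_simps[OF ifun_Box[OF assms(2,1)]] by simp_all

lemma ifun_arr_comp:
  assumes "icont Y r" "Y \<in> Obj Box" "X \<in> Obj Box" "continuous_map X Y f"
  shows "AMap \<iota> (ifun Y r) \<cdot> AMap \<iota> (tmap X Y f) = AMap \<iota> (ifun X (\<lambda>x. r (f x)))"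
  using AMap_comp[OF tmap_Box[OF assms(3,2,4)] ifun_Box[OF assms(2,1)]] ifun_comp[of f X Y r]
    continuous_map_funspace[OF assms(4)] by simp

lemma tmap_arr_simps:
  assumes "X \<in> Obj Box" "Y \<in> Obj Box" "continuous_map X Y f"
  shows "AMap \<iota> (tmap X Y f) \<in> Arr C" "Dom C (AMap \<iota> (tmap X Y f)) = OMap \<iota> X"
    "Cod C (AMap \<iota> (tmap X Y f)) = OMap \<iota> Y"
  using AMap_simps[OF tmap_Box[OF assms]] by simp_all

lemma app1_ifun:
  assumes "c1 f" "icont X r" "X \<in> Obj Box"
  shows "app1 f (AMap \<iota> (ifun X r)) = AMap \<iota> (ifun X (\<lambda>x. f (r x)))"
  unfolding app1_def ifun_def[of X r]
  using ifun_arr_comp[OF assms(1) _ assms(3) continuous_ifun[OF assms(2)]] by simp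

lemma app1_simps [simp]:
  assumes "c1 f" "t \<in> Arr C" "Cod C t = I"
  shows "app1 f t \<in> Arr C" "Dom C (app1 f t) = Dom C t" "Cod C (app1 f t) = I"
    "h \<in> Arr C \<Longrightarrow> Cod C h = Dom C t \<Longrightarrow> app1 f t \<cdot> h = app1 f (t \<cdot> h)"
  using assms by (auto simp: app1_def)

lemma app1_app1 [simp]:
  assumes "c1 f" "c1 g" "t \<in> Arr C" "Cod C t = I"
  shows "app1 f (app1 g t) = app1 (\<lambda>x. f (g x)) t"
proof -
  have "app1 f (app1 g t) = app1 f (AMap \<iota> (ifun (cube 1) (\<lambda>x. g (x 0)))) \<cdot> t"
    using assms by (simp add: app1_def)
  also have "\<dots> = AMap \<iota> (ifun (cube 1) (\<lambda>x. f (g (x 0)))) \<cdot> t"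
    by (subst app1_ifun) (use assms in auto)
  finally show ?thesis by (simp add: app1_def)
qed

lemma app1_cong:
  assumes "\<And>x. 0 \<le> x \<Longrightarrow> x \<le> 1 \<Longrightarrow> f x = g x"
  shows "app1 f t = app1 g t"
proof -
  have "ifun (cube 1) (\<lambda>x. f (x 0)) = ifun (cube 1) (\<lambda>x. g (x 0))"
    by (rule ifun_cong) (use assms in \<open>auto simp: PiE_iff\<close>)
  then show ?thesis by (simp add: app1_def)
qed

lemma app1_id [simp]:
  assumes "t \<in> Arr C" "Cod C t = I"
  shows "app1 (\<lambda>x. x) t = t"
proof -
  have "ifun (cube 1) (\<lambda>x. x 0) = tmap (cube 1) (cube 1) (\<lambda>x. x)"
    unfolding ifun_def by (rule tmap_eqI) (auto simp: PiE_def extensional_def restrict_def fun_eq_iff)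
  then show ?thesis using assms by (simp add: app1_def AMap_Ide)
qed

lemma app1_cst [simp]:
  assumes "c1 f" "0 \<le> k" "k \<le> 1" "X \<in> Obj C"
  shows "app1 f (cst k X) = cst (f k) X"
proof -
  have "app1 f (AMap \<iota> (endpoint k)) = AMap \<iota> (endpoint (f k))"
    unfolding endpoint_ifun by (rule app1_ifun) (use assms in auto)
  then show ?thesis using assms by (simp add: cst_def app1_def flip: comp_assoc)
qed

lemma app1_const [simp]:
  assumes "0 \<le> k" "k \<le> 1" "t \<in> Arr C" "Cod C t = I"
  shows "app1 (\<lambda>_. k) t = cst k (Dom C t)"
proof -
  \<comment> \<open>\<open>cst\<close> is built from the terminal object of the category. Since its
    map \<open>I \<rightarrow> *\<close> is unique, it is the image of the map of cubes, and the
    claim becomes one about functions.\<close>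
  have "to_pt I = AMap \<iota> (tmap (cube 1) (cube 0) (\<lambda>_ _. undefined))"
    using to_point_eq[of "AMap \<iota> (tmap (cube 1) (cube 0) (\<lambda>_ _. undefined))"]
      tmap_arr_simps[of "cube 1" "cube 0" "\<lambda>_ _. undefined"] by (simp add: continuous_map_cube)
  then have "cst k I = AMap \<iota> (ifun (cube 1) (\<lambda>_. k))"
    unfolding cst_def endpoint_ifun
    using ifun_arr_comp[of "cube 0" "\<lambda>_. k" "cube 1" "\<lambda>_ _. undefined"] assms
    by (simp add: continuous_map_cube)
  then have "app1 (\<lambda>_. k) t = cst k I \<cdot> t" by (simp add: app1_def)
  then show ?thesis using assms by simp
qed

lemma tuple2_simps [simp]:
  assumes "t \<in> Arr C" "s \<in> Arr C" "Cod C t = I" "Cod C s = I" "Dom C t = W" "Dom C s = W"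
  defines "q \<equiv> tuple 2 W (\<lambda>k. if k = 0 then t else s)"
  shows "q \<in> Arr C" "Dom C q = W" "Cod C q = OMap \<iota> (cube 2)"
    "AMap \<iota> (coord 2 0) \<cdot> q = t" "AMap \<iota> (coord 2 1) \<cdot> q = s"
  using tuple_props[of 2 W "\<lambda>k. if k = 0 then t else s"] assms(1-6)
  unfolding q_def by (auto simp: Hom_def)

lemma cube2_eqI:
  assumes "u \<in> Arr C" "v \<in> Arr C" "Dom C u = Dom C v"
    "Cod C u = OMap \<iota> (cube 2)" "Cod C v = OMap \<iota> (cube 2)"
    "AMap \<iota> (coord 2 0) \<cdot> u = AMap \<iota> (coord 2 0) \<cdot> v"
    "AMap \<iota> (coord 2 1) \<cdot> u = AMap \<iota> (coord 2 1) \<cdot> v"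
  shows "u = v"
proof (rule cube_eqI[of 2])
  fix k :: nat assume "k < 2"
  then have "k = 0 \<or> k = 1" by auto
  then show "AMap \<iota> (coord 2 k) \<cdot> u = AMap \<iota> (coord 2 k) \<cdot> v" using assms by auto
qed (use assms in auto)

lemma tuple2_comp [simp]:
  assumes "t \<in> Arr C" "s \<in> Arr C" "Cod C t = I" "Cod C s = I" "Dom C t = W" "Dom C s = W"
    "h \<in> Arr C" "Cod C h = W"
  shows "tuple 2 W (\<lambda>k. if k = 0 then t else s) \<cdot> h =
     tuple 2 (Dom C h) (\<lambda>k. if k = 0 then t \<cdot> h else s \<cdot> h)"
  by (rule cube2_eqI) (use assms in \<open>simp_all flip: comp_assoc\<close>)

lemma app2_simps [simp]:
  assumes "c2 f" "t \<in> Arr C" "s \<in> Arr C" "Cod C t = I" "Cod C s = I" "Dom C t = Dom C s"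
  shows "app2 f t s \<in> Arr C" "Dom C (app2 f t s) = Dom C s" "Cod C (app2 f t s) = I"
    "h \<in> Arr C \<Longrightarrow> Cod C h = Dom C s \<Longrightarrow> app2 f t s \<cdot> h = app2 f (t \<cdot> h) (s \<cdot> h)"
  using assms by (auto simp: app2_def)

lemma app2_ifun:
  assumes "c2 f" "icont X r" "icont X s" "X \<in> Obj Box"
  shows "app2 f (AMap \<iota> (ifun X r)) (AMap \<iota> (ifun X s)) = AMap \<iota> (ifun X (\<lambda>x. f (r x) (s x)))"
proof -
  let ?g = "\<lambda>x. \<lambda>i\<in>{..<2}. if i = 0 then r x else s x"
  have g: "continuous_map X (cube 2) ?g"
    unfolding continuous_map_cube using assms(2,3) by auto
  note G = tmap_arr_simps[OF assms(4) _ g, simplified]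
  have "tuple 2 (OMap \<iota> X) (\<lambda>k. if k = 0 then AMap \<iota> (ifun X r) else AMap \<iota> (ifun X s)) =
      AMap \<iota> (tmap X (cube 2) ?g)"
  proof (rule cube2_eqI)
    show "AMap \<iota> (coord 2 0) \<cdot> tuple 2 (OMap \<iota> X) (\<lambda>k. if k = 0 then AMap \<iota> (ifun X r) else AMap \<iota> (ifun X s)) =
      AMap \<iota> (coord 2 0) \<cdot> AMap \<iota> (tmap X (cube 2) ?g)"
      unfolding coord_ifun[of 2 0]
      using ifun_arr_comp[of "cube 2" "\<lambda>x. x 0" X ?g] g assms by (simp flip: coord_ifun)
    show "AMap \<iota> (coord 2 1) \<cdot> tuple 2 (OMap \<iota> X) (\<lambda>k. if k = 0 then AMap \<iota> (ifun X r) else AMap \<iota> (ifun X s)) =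
      AMap \<iota> (coord 2 1) \<cdot> AMap \<iota> (tmap X (cube 2) ?g)"
      unfolding coord_ifun[of 2 1]
      using ifun_arr_comp[of "cube 2" "\<lambda>x. x 1" X ?g] g assms by (simp flip: coord_ifun)
  qed (use assms G in simp_all)
  then show ?thesis
    using ifun_arr_comp[OF assms(1) _ assms(4) g] assms by (simp add: app2_def)
qed

lemma ifun_cube1_id: "AMap \<iota> (ifun (cube 1) (\<lambda>x. x 0)) = Ide C I"
  using app1_id[of "Ide C I"] by (simp add: app1_def)

lemma cst_ifun:
  assumes "0 \<le> k" "k \<le> 1" "X \<in> Obj Box"
  shows "cst k (OMap \<iota> X) = AMap \<iota> (ifun X (\<lambda>_. k))"
proof -
  have "app1 (\<lambda>_. k) (AMap \<iota> (ifun X (\<lambda>_. k))) = cst k (OMap \<iota> X)"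
    using assms by simp
  moreover have "app1 (\<lambda>_. k) (AMap \<iota> (ifun X (\<lambda>_. k))) = AMap \<iota> (ifun X (\<lambda>_. k))"
    by (rule app1_ifun) (use assms in auto)
  ultimately show ?thesis by simp
qed

lemma c2_sections:
  assumes "c2 f" "0 \<le> k" "k \<le> 1"
  shows "c1 (\<lambda>x. f x k)" "c1 (f k)"
  by (rule icont_comp2[OF assms(1)]; use assms in simp)+

text \<open>By naturality in the source it is enough to treat the identity of \<open>I\<close>,
  where both sides are images of maps of cubes.\<close>

lemma app2_cst_right [simp]:
  assumes "c2 f" "t \<in> Arr C" "Cod C t = I" "Dom C t = X" "0 \<le> k" "k \<le> 1"
  shows "app2 f t (cst k X) = app1 (\<lambda>x. f x k) t"
proof -
  have "app2 f t (cst k X) = app2 f (Ide C I) (cst k I) \<cdot> t" using assms by auto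
  also have "\<dots> = app1 (\<lambda>x. f x k) t"
    using app2_ifun[OF assms(1), of "cube 1" "\<lambda>x. x 0" "\<lambda>_. k"] assms
    by (simp add: cst_ifun ifun_cube1_id app1_def)
  finally show ?thesis .
qed

lemma app2_cst_left [simp]:
  assumes "c2 f" "t \<in> Arr C" "Cod C t = I" "Dom C t = X" "0 \<le> k" "k \<le> 1"
  shows "app2 f (cst k X) t = app1 (f k) t"
proof -
  have "app2 f (cst k X) t = app2 f (cst k I) (Ide C I) \<cdot> t" using assms by auto
  also have "\<dots> = app1 (f k) t"
    using app2_ifun[OF assms(1), of "cube 1" "\<lambda>_. k" "\<lambda>x. x 0"] assms
    by (simp add: cst_ifun ifun_cube1_id app1_def)
  finally show ?thesis .
qed

end

section \<open>Paths of maps\<close>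

lemma endpoint_inj: "endpoint k = endpoint l \<Longrightarrow> k = l"
  by (auto simp: endpoint_def tmap_def restrict_def fun_eq_iff split: if_splits)

lemma c1_range:
  assumes "icont (cube 1) (\<lambda>x. f (x 0))" "0 \<le> t" "t \<le> 1"
  shows "0 \<le> f t" "f t \<le> 1"
proof -
  have "(\<lambda>i\<in>{..<1}. t) \<in> topspace (cube 1)" using assms(2,3) by auto
  with assms(1) have "0 \<le> f ((\<lambda>i\<in>{..<1::nat}. t) 0) \<and> f ((\<lambda>i\<in>{..<1::nat}. t) 0) \<le> 1"
    unfolding icont_iff by blast
  then show "0 \<le> f t" "f t \<le> 1" by simp_all
qed

context good_Q
begin

text \<open>\<open>\<lambda>i\<in>{..<1}. t\<close> is the point \<open>t\<close> of
  \<open>cube 1\<close>, so \<open>fa\<close> and \<open>fb\<close> are \<open>a\<close> and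
  \<open>b\<close> read as real functions.\<close>

definition fa :: "real \<Rightarrow> real" where "fa t = fst (snd a) (\<lambda>i\<in>{..<1}. t) 0"
definition fb :: "real \<Rightarrow> real" where "fb t = fst (snd b) (\<lambda>i\<in>{..<1}. t) 0"

lemma interval_fun:
  assumes "\<phi> \<in> Hom Box2 (cube 1) (cube 1)"
  defines "f \<equiv> \<lambda>t. fst (snd \<phi>) (\<lambda>i\<in>{..<1}. t) 0"
  shows "\<phi> = ifun (cube 1) (\<lambda>x. f (x 0))" "c1 f"
proof -
  have "\<phi> \<in> Hom Box (cube 1) (cube 1)" using assms(1) by (simp add: Box2_Box)
  then obtain r where r: "\<phi> = ifun (cube 1) r" "icont (cube 1) r" by (rule Box_cube1E)
  have x: "x = (\<lambda>i\<in>{..<1}. x 0)" if "x \<in> topspace (cube 1)" for x :: "nat \<Rightarrow> real"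
    using that by (auto simp: PiE_def extensional_def restrict_def fun_eq_iff)
  have f: "f (x 0) = r x" if "x \<in> topspace (cube 1)" for x
    using that x[OF that] by (auto simp: f_def r(1) ifun_def tmap_def)
  show "\<phi> = ifun (cube 1) (\<lambda>x. f (x 0))"
    unfolding r(1) by (rule ifun_cong) (simp add: f)
  show "c1 f" using continuous_map_eq[OF r(2)] f by simp
qed

lemma a_Hom: "a \<in> Hom Box2 (cube 1) (cube 1)" and b_Hom: "b \<in> Hom Box2 (cube 1) (cube 1)"
  using interval by (auto simp: interval_square_def)

lemma a_eq: "a = ifun (cube 1) (\<lambda>x. fa (x 0))" and c1_fa [simp]: "c1 fa"
  using interval_fun[OF a_Hom] by (simp_all add: fa_def[abs_def])

lemma b_eq: "b = ifun (cube 1) (\<lambda>x. fb (x 0))" and c1_fb [simp]: "c1 fb"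
  using interval_fun[OF b_Hom] by (simp_all add: fb_def[abs_def])

lemma ifun_endpoint:
  assumes "0 \<le> k" "k \<le> 1"
  shows "ifun (cube 1) (\<lambda>x. f (x 0)) \<cdot>\<^bsub>Box2\<^esub> endpoint k = endpoint (f k)"
  unfolding Box2_comp endpoint_def ifun_def
  by (subst tmap_comp_Box) (use assms in auto)

lemma fa_0 [simp]: "fa 0 = 0" and fb_1 [simp]: "fb 1 = 1" and fa_fb: "fa 1 = fb 0"
proof -
  have "a \<cdot>\<^bsub>Box2\<^esub> endpoint 0 = endpoint 0" "b \<cdot>\<^bsub>Box2\<^esub> endpoint 1 = endpoint 1"
    "a \<cdot>\<^bsub>Box2\<^esub> endpoint 1 = b \<cdot>\<^bsub>Box2\<^esub> endpoint 0"
    using interval is_pushoutD(9) by (auto simp: interval_square_def)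
  then show "fa 0 = 0" "fb 1 = 1" "fa 1 = fb 0"
    using ifun_endpoint[of 0 fa] ifun_endpoint[of 1 fb] ifun_endpoint[of 1 fa]
      ifun_endpoint[of 0 fb] by (auto simp flip: a_eq b_eq dest!: endpoint_inj)
qed

text \<open>Without formulas for \<open>fa\<close> and \<open>fb\<close> the function cannot be
  written down. It is the map induced by the pushout square in \<open>Box2\<close>.\<close>

lemma reparam_exists:
  assumes "c1 u" "c1 v" "u 1 = v 0"
  obtains \<kappa> where "c1 \<kappa>" "\<And>t. 0 \<le> t \<Longrightarrow> t \<le> 1 \<Longrightarrow> \<kappa> (fa t) = u t"
    "\<And>t. 0 \<le> t \<Longrightarrow> t \<le> 1 \<Longrightarrow> \<kappa> (fb t) = v t"
proof -
  let ?u = "ifun (cube 1) (\<lambda>x. u (x 0))" and ?v = "ifun (cube 1) (\<lambda>x. v (x 0))"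
  have P: "is_pushout Box2 (endpoint 1) (endpoint 0) a b"
    using interval by (simp add: interval_square_def)
  have e: "Cod Box2 (endpoint k) = cube 1" for k
    by (simp add: Box2_def full_Top_def endpoint_def tmap_simps)
  have "Cod Box2 a = cube 1" using a_Hom by (simp add: Hom_def)
  moreover have "?u \<in> Hom Box2 (cube 1) (cube 1)" "?v \<in> Hom Box2 (cube 1) (cube 1)"
    using assms by (simp_all add: Box2_Box)
  moreover have "?u \<cdot>\<^bsub>Box2\<^esub> endpoint 1 = ?v \<cdot>\<^bsub>Box2\<^esub> endpoint 0"
    using assms(3) by (simp add: ifun_endpoint)
  ultimately obtain k where k: "k \<in> Hom Box2 (cube 1) (cube 1)"
      "k \<cdot>\<^bsub>Box2\<^esub> a = ?u" "k \<cdot>\<^bsub>Box2\<^esub> b = ?v"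
    using is_pushoutE[OF P, of "cube 1" ?u ?v] by (auto simp: e)
  define \<kappa> where "\<kappa> = (\<lambda>t. fst (snd k) (\<lambda>i\<in>{..<1}. t) 0)"
  have \<kappa>: "k = ifun (cube 1) (\<lambda>x. \<kappa> (x 0))" "c1 \<kappa>"
    using interval_fun[OF k(1)] by (simp_all add: \<kappa>_def)
  \<comment> \<open>Equal maps of spaces determine the functions only on the space itself, hence the
    restriction to \<open>[0, 1]\<close>.\<close>
  have pt: "f t = g t" if "ifun (cube 1) (\<lambda>x. f (x 0)) = ifun (cube 1) (\<lambda>x. g (x 0))"
      "0 \<le> t" "t \<le> 1" for f g :: "real \<Rightarrow> real" and t
  proof -
    have "fst (snd (ifun (cube 1) (\<lambda>x. f (x 0)))) (\<lambda>i\<in>{..<1}. t) 0 = f t"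
      "fst (snd (ifun (cube 1) (\<lambda>x. g (x 0)))) (\<lambda>i\<in>{..<1}. t) 0 = g t"
      using that(2,3) by (auto simp: ifun_def tmap_def)
    with that(1) show ?thesis by simp
  qed
  have comp: "k \<cdot>\<^bsub>Box2\<^esub> ifun (cube 1) (\<lambda>x. f (x 0)) = ifun (cube 1) (\<lambda>x. \<kappa> (f (x 0)))"
    if "c1 f" for f
  proof -
    have "ifun (cube 1) (\<lambda>x. \<kappa> (x 0)) \<cdot>\<^bsub>Box\<^esub> tmap (cube 1) (cube 1) (\<lambda>x. \<lambda>i\<in>{..<1}. f (x 0)) =
        ifun (cube 1) (\<lambda>x. \<kappa> (f (x 0)))"
      by (subst ifun_comp) (use continuous_map_funspace[OF continuous_ifun[OF that]] in auto)
    then show ?thesis by (simp add: Box2_comp \<kappa>(1) flip: ifun_def)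
  qed
  show ?thesis
  proof
    show "c1 \<kappa>" by (rule \<kappa>)
    fix t :: real assume t: "0 \<le> t" "t \<le> 1"
    show "\<kappa> (fa t) = u t" "\<kappa> (fb t) = v t"
      using k(2,3) comp[OF c1_fa] comp[OF c1_fb]
      by (auto simp flip: a_eq b_eq intro: pt[of "\<lambda>t. \<kappa> (fa t)" u t, OF _ t]
           pt[of "\<lambda>t. \<kappa> (fb t)" v t, OF _ t])
  qed
qed

abbreviation cyl_at :: "real \<Rightarrow> 'o \<Rightarrow> 'm" where
  "cyl_at k A \<equiv> pairing C (Ide C A) (cst k A)"

abbreviation times_I :: "'m \<Rightarrow> 'm" where
  "times_I u \<equiv> pairing C (u \<cdot> pr1 C (Dom C u) I) (pr2 C (Dom C u) I)"

definition reparam :: "'o \<Rightarrow> (real \<Rightarrow> real) \<Rightarrow> 'm \<Rightarrow> 'm" where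
  "reparam A f g = g \<cdot> pairing C (pr1 C A I) (app1 f (pr2 C A I))"

abbreviation paths :: "'o \<Rightarrow> 'o \<Rightarrow> 'm set" where
  "paths A W \<equiv> Hom C (prod_obj C A I) W"

lemma reparam_simps [simp]:
  assumes "c1 f" "g \<in> Arr C" "Dom C g = prod_obj C A I" "A \<in> Obj C"
  shows "reparam A f g \<in> Arr C" "Dom C (reparam A f g) = prod_obj C A I"
    "Cod C (reparam A f g) = Cod C g"
  using assms by (auto simp: reparam_def)

lemma reparam_end [simp]:
  assumes "c1 f" "g \<in> Arr C" "Dom C g = prod_obj C A I" "A \<in> Obj C" "0 \<le> k" "k \<le> 1" "0 \<le> f k" "f k \<le> 1"
  shows "reparam A f g \<cdot> cyl_at k A = g \<cdot> cyl_at (f k) A"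
  using assms by (simp add: reparam_def)

lemma reparam_reparam [simp]:
  assumes "c1 f" "c1 h" "g \<in> Arr C" "Dom C g = prod_obj C A I" "A \<in> Obj C"
  shows "reparam A f (reparam A h g) = reparam A (\<lambda>x. h (f x)) g"
  using assms by (simp add: reparam_def)

lemma reparam_id [simp]:
  assumes "g \<in> Arr C" "Dom C g = prod_obj C A I" "A \<in> Obj C"
  shows "reparam A (\<lambda>x. x) g = g"
  using assms by (simp add: reparam_def)

lemma reparam_const [simp]:
  assumes "g \<in> Arr C" "Dom C g = prod_obj C A I" "A \<in> Obj C" "0 \<le> k" "k \<le> 1"
  shows "reparam A (\<lambda>x. k) g = g \<cdot> cyl_at k A \<cdot> pr1 C A I"
  using assms by (simp add: reparam_def)

lemma reparam_constant [simp]: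
  assumes "c1 f" "u \<in> Arr C" "Dom C u = A"
  shows "reparam A f (u \<cdot> pr1 C A I) = u \<cdot> pr1 C A I"
  using assms by (auto simp: reparam_def)

lemma reparam_cong:
  "(\<And>x. 0 \<le> x \<Longrightarrow> x \<le> 1 \<Longrightarrow> f x = h x) \<Longrightarrow> reparam A f g = reparam A h g"
  unfolding reparam_def using app1_cong[of f h] by metis

text \<open>The square in (S3) stays a pushout after \<open>A \<times> -\<close>, so
  \<open>A \<times> I\<close> is two copies of itself glued along \<open>A\<close>.\<close>

lemma join_ex1:
  assumes A: "A \<in> Obj C" and g: "g \<in> paths A W" and h: "h \<in> paths A W"
    and e: "g \<cdot> cyl_at 1 A = h \<cdot> cyl_at 0 A"
  shows "\<exists>!k. k \<in> paths A W \<and> reparam A fa k = g \<and> reparam A fb k = h"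
proof -
  have P: "is_pushout C (prod_map C (Ide C A) (AMap \<iota> (endpoint 1)))
          (prod_map C (Ide C A) (AMap \<iota> (endpoint 0)))
          (prod_map C (Ide C A) (AMap \<iota> a)) (prod_map C (Ide C A) (AMap \<iota> b))"
    using interval A by (simp add: interval_square_def)
  have ab [simp]: "AMap \<iota> a = app1 fa (Ide C I)" "AMap \<iota> b = app1 fb (Ide C I)"
    using arg_cong[OF a_eq, of "AMap \<iota>"] arg_cong[OF b_eq, of "AMap \<iota>"]
    by (simp_all add: app1_def)
  have W: "W \<in> Obj C" using g Hom_Obj by auto
  \<comment> \<open>The corner of the given pushout is \<open>A \<times> *\<close> rather than
    \<open>A\<close>; the projection to \<open>A\<close> mediates between them.\<close>
  have ends: "prod_map C (Ide C A) (AMap \<iota> (endpoint k)) = cyl_at k A \<cdot> pr1 C A point"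
    if "0 \<le> k" "k \<le> 1" for k
    using A that by (simp add: prod_map_def endpoint_cst)
  have maps: "prod_map C (Ide C A) (app1 f (Ide C I)) = pairing C (pr1 C A I) (app1 f (pr2 C A I))"
    if "c1 f" for f
    using A that by (simp add: prod_map_def)
  have "g \<cdot> cyl_at 1 A \<cdot> pr1 C A point = h \<cdot> cyl_at 0 A \<cdot> pr1 C A point"
    using e by simp
  moreover have "g \<cdot> (cyl_at 1 A \<cdot> pr1 C A point) = g \<cdot> cyl_at 1 A \<cdot> pr1 C A point"
    "h \<cdot> (cyl_at 0 A \<cdot> pr1 C A point) = h \<cdot> cyl_at 0 A \<cdot> pr1 C A point"
    using A g h by (auto simp: Hom_def simp del: pairing_comp)
  ultimately show ?thesis
    using is_pushoutE[OF P W, of g h] g h A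
    by (simp add: ends maps reparam_def del: pairing_comp)
qed

definition join :: "'o \<Rightarrow> 'm \<Rightarrow> 'm \<Rightarrow> 'm" where
  "join A g h = (THE k. k \<in> paths A (Cod C g) \<and> reparam A fa k = g \<and> reparam A fb k = h)"

lemma join_props:
  assumes "A \<in> Obj C" "g \<in> paths A W" "h \<in> paths A W" "g \<cdot> cyl_at 1 A = h \<cdot> cyl_at 0 A"
  shows "join A g h \<in> paths A W" "reparam A fa (join A g h) = g" "reparam A fb (join A g h) = h"
  using theI'[OF join_ex1[OF assms]] assms(2) unfolding join_def by (auto simp: Hom_def)

text \<open>The matching condition of \<open>join_ex1\<close> is automatic: both ends are the value
  of \<open>k\<close> at \<open>fa 1\<close>, which equals \<open>fb 0\<close>.\<close>

lemma join_eqI: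
  assumes "A \<in> Obj C" "k \<in> paths A W" "reparam A fa k = g" "reparam A fb k = h"
  shows "join A g h = k"
proof -
  note k = HomD[OF assms(2)]
  have gh: "g \<in> paths A W" "h \<in> paths A W"
    using k assms(1) unfolding assms(3,4)[symmetric] by (auto simp: Hom_def)
  have 01: "0 \<le> fa 1" "fa 1 \<le> 1"
    using c1_range[OF c1_fa, of 1] by auto
  have "g \<cdot> cyl_at 1 A = k \<cdot> cyl_at (fa 1) A" "h \<cdot> cyl_at 0 A = k \<cdot> cyl_at (fb 0) A"
    unfolding assms(3,4)[symmetric] using k assms(1) 01 by (simp_all flip: fa_fb)
  then have "g \<cdot> cyl_at 1 A = h \<cdot> cyl_at 0 A" by (simp add: fa_fb)
  from join_ex1[OF assms(1) gh this] join_props[OF assms(1) gh this] assms(2-4)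
  show ?thesis by blast
qed

lemma join_ends:
  assumes "A \<in> Obj C" "g \<in> paths A W" "h \<in> paths A W" "g \<cdot> cyl_at 1 A = h \<cdot> cyl_at 0 A"
  shows "join A g h \<cdot> cyl_at 0 A = g \<cdot> cyl_at 0 A" "join A g h \<cdot> cyl_at 1 A = h \<cdot> cyl_at 1 A"
proof -
  note P = join_props[OF assms]
  have "reparam A fa (join A g h) \<cdot> cyl_at 0 A = join A g h \<cdot> cyl_at 0 A"
    "reparam A fb (join A g h) \<cdot> cyl_at 1 A = join A g h \<cdot> cyl_at 1 A"
    using P(1) assms(1) by (simp_all add: HomD)
  then show "join A g h \<cdot> cyl_at 0 A = g \<cdot> cyl_at 0 A" "join A g h \<cdot> cyl_at 1 A = h \<cdot> cyl_at 1 A"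
    unfolding P by simp_all
qed

lemma join_comp:
  assumes "A \<in> Obj C" "g \<in> paths A W" "h \<in> paths A W" "g \<cdot> cyl_at 1 A = h \<cdot> cyl_at 0 A"
    "f \<in> Hom C W V"
  shows "f \<cdot> join A g h = join A (f \<cdot> g) (f \<cdot> h)"
proof -
  note P = join_props[OF assms(1-4)]
  have "reparam A k (f \<cdot> join A g h) = f \<cdot> reparam A k (join A g h)" if "c1 k" for k
    using P(1) assms(1,5) that by (simp add: reparam_def Hom_def)
  from this[OF c1_fa] this[OF c1_fb] show ?thesis
    unfolding P using P(1) assms(5) by (intro join_eqI[symmetric, OF assms(1), of _ V]) (auto simp: Hom_def)
qed

lemma join_pre:
  assumes "A \<in> Obj C" "g \<in> paths A W" "h \<in> paths A W" "g \<cdot> cyl_at 1 A = h \<cdot> cyl_at 0 A"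
    "u \<in> Hom C B A"
  shows "join A g h \<cdot> times_I u = join B (g \<cdot> times_I u) (h \<cdot> times_I u)"
proof -
  note P = join_props[OF assms(1-4)]
  have B: "B \<in> Obj C" using assms(5) Hom_Obj by auto
  have "reparam B k (join A g h \<cdot> times_I u) = reparam A k (join A g h) \<cdot> times_I u" if "c1 k" for k
    using P(1) assms(1,5) that B by (simp add: reparam_def Hom_def)
  from this[OF c1_fa] this[OF c1_fb] show ?thesis
    unfolding P using P(1) assms(1,5) B by (intro join_eqI[symmetric, OF B, of _ W]) (auto simp: Hom_def)
qed

lemma join_const:
  assumes "u \<in> Hom C A W"
  shows "join A (u \<cdot> pr1 C A I) (u \<cdot> pr1 C A I) = u \<cdot> pr1 C A I"
  using assms Hom_Obj[OF assms] by (intro join_eqI[of _ _ W]) (auto simp: Hom_def)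


section \<open>Homotopies of paths\<close>

text \<open>\<open>square A W x y l r\<close>: some \<open>A \<times> I \<times> I \<rightarrow> W\<close> restricts to \<open>x\<close> and \<open>y\<close> where the last coordinate is
  \<open>0\<close> and \<open>1\<close>, and to \<open>l\<close> and \<open>r\<close> where the middle one is.\<close>

definition square :: "'o \<Rightarrow> 'o \<Rightarrow> 'm \<Rightarrow> 'm \<Rightarrow> 'm \<Rightarrow> 'm \<Rightarrow> bool" where
  "square A W x y l r \<longleftrightarrow> A \<in> Obj C \<and> (\<exists>G\<in>Hom C (prod_obj C (prod_obj C A I) I) W.
     G \<cdot> cyl_at 0 (prod_obj C A I) = x \<and> G \<cdot> cyl_at 1 (prod_obj C A I) = y \<and>
     G \<cdot> times_I (cyl_at 0 A) = l \<and> G \<cdot> times_I (cyl_at 1 A) = r)"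

lemma squareE:
  assumes "square A W x y l r"
  obtains G where "A \<in> Obj C" "W \<in> Obj C" "G \<in> Arr C" "Dom C G = prod_obj C (prod_obj C A I) I" "Cod C G = W"
    "x = G \<cdot> cyl_at 0 (prod_obj C A I)" "y = G \<cdot> cyl_at 1 (prod_obj C A I)"
    "l = G \<cdot> times_I (cyl_at 0 A)" "r = G \<cdot> times_I (cyl_at 1 A)"
  using assms unfolding square_def Hom_def by auto

lemma squareI:
  assumes "A \<in> Obj C" "G \<in> Hom C (prod_obj C (prod_obj C A I) I) W"
    "x = G \<cdot> cyl_at 0 (prod_obj C A I)" "y = G \<cdot> cyl_at 1 (prod_obj C A I)"
    "l = G \<cdot> times_I (cyl_at 0 A)" "r = G \<cdot> times_I (cyl_at 1 A)"
  shows "square A W x y l r"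
  using assms unfolding square_def by blast

lemma square_paths:
  assumes "square A W x y l r"
  shows "A \<in> Obj C" "W \<in> Obj C" "x \<in> paths A W" "y \<in> paths A W" "l \<in> paths A W" "r \<in> paths A W"
  using assms by (auto elim!: squareE simp: Hom_def)

lemma square_corners:
  assumes "square A W x y l r"
  shows "l \<cdot> cyl_at 0 A = x \<cdot> cyl_at 0 A" "l \<cdot> cyl_at 1 A = y \<cdot> cyl_at 0 A"
    "r \<cdot> cyl_at 0 A = x \<cdot> cyl_at 1 A" "r \<cdot> cyl_at 1 A = y \<cdot> cyl_at 1 A"
  using assms by (auto elim!: squareE)

lemma square_transpose:
  assumes "square A W x y l r"
  shows "square A W l r x y"
  using assms
proof (rule squareE)
  fix G assume G: "A \<in> Obj C" "W \<in> Obj C" "G \<in> Arr C" "Dom C G = prod_obj C (prod_obj C A I) I" "Cod C G = W"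
    "x = G \<cdot> cyl_at 0 (prod_obj C A I)" "y = G \<cdot> cyl_at 1 (prod_obj C A I)"
    "l = G \<cdot> times_I (cyl_at 0 A)" "r = G \<cdot> times_I (cyl_at 1 A)"
  let ?P = "prod_obj C A I"
  \<comment> \<open>\<open>?T\<close> swaps the two interval coordinates.\<close>
  let ?T = "pairing C (pairing C (pr1 C A I \<cdot> pr1 C ?P I) (pr2 C ?P I)) (pr2 C A I \<cdot> pr1 C ?P I)"
  show ?thesis
    by (rule squareI[where G = "G \<cdot> ?T"]) (use G in \<open>simp_all add: Hom_def\<close>)
qed

text \<open>The fillers are paths of maps on \<open>A \<times> I\<close> and are joined as such;
  \<open>join_pre\<close> then identifies the two sides of the result.\<close>

lemma square_vertical:
  assumes "square A W x m l r" "square A W m y l' r'"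
  shows "square A W x y (join A l l') (join A r r')"
  using assms(1)
proof (rule squareE)
  fix G assume G: "A \<in> Obj C" "W \<in> Obj C" "G \<in> Arr C" "Dom C G = prod_obj C (prod_obj C A I) I" "Cod C G = W"
    "x = G \<cdot> cyl_at 0 (prod_obj C A I)" "m = G \<cdot> cyl_at 1 (prod_obj C A I)"
    "l = G \<cdot> times_I (cyl_at 0 A)" "r = G \<cdot> times_I (cyl_at 1 A)"
  show ?thesis
    using assms(2)
  proof (rule squareE)
    fix H assume H: "A \<in> Obj C" "W \<in> Obj C" "H \<in> Arr C" "Dom C H = prod_obj C (prod_obj C A I) I" "Cod C H = W"
      "m = H \<cdot> cyl_at 0 (prod_obj C A I)" "y = H \<cdot> cyl_at 1 (prod_obj C A I)"
      "l' = H \<cdot> times_I (cyl_at 0 A)" "r' = H \<cdot> times_I (cyl_at 1 A)"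
    let ?P = "prod_obj C A I"
    have P: "?P \<in> Obj C" using G by simp
    have GH: "G \<in> paths ?P W" "H \<in> paths ?P W" using G H by (auto simp: Hom_def)
    have e: "G \<cdot> cyl_at 1 ?P = H \<cdot> cyl_at 0 ?P" using G H by simp
    note c = join_props(1)[OF P GH e] join_ends[OF P GH e]
    have u: "cyl_at k A \<in> Hom C A ?P" if "0 \<le> k" "k \<le> 1" for k using G that by (auto simp: Hom_def)
    show ?thesis
    proof (rule squareI[where G = "join ?P G H"])
      show "join A l l' = join ?P G H \<cdot> times_I (cyl_at 0 A)"
        using join_pre[OF P GH e u[of 0]] G(8) H(8) by simp
      show "join A r r' = join ?P G H \<cdot> times_I (cyl_at 1 A)"
        using join_pre[OF P GH e u[of 1]] G(9) H(9) by simp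
    qed (use c G H in auto)
  qed
qed

lemma square_horizontal:
  assumes "square A W x y l m" "square A W x' y' m r"
  shows "square A W (join A x x') (join A y y') l r"
  using square_vertical[OF assms[THEN square_transpose]] by (rule square_transpose)

text \<open>The source of all concrete squares: the path is pulled back along
  \<open>(t, s) \<mapsto> f t s\<close>, and the four sides are read off by setting \<open>s\<close>
  or \<open>t\<close> to \<open>0\<close> or \<open>1\<close>.\<close>

lemma square_app2:
  assumes "A \<in> Obj C" "g \<in> paths A W" "c2 f"
  shows "square A W (reparam A (\<lambda>t. f t 0) g) (reparam A (\<lambda>t. f t 1) g) (reparam A (f 0) g) (reparam A (f 1) g)"
proof -
  let ?P = "prod_obj C A I"
  let ?T = "pairing C (pr1 C A I \<cdot> pr1 C ?P I) (app2 f (pr2 C A I \<cdot> pr1 C ?P I) (pr2 C ?P I))"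
  note s = c2_sections[OF assms(3), of 0] c2_sections[OF assms(3), of 1]
  show ?thesis
    by (rule squareI[where G = "g \<cdot> ?T"]) (use assms s in \<open>simp_all add: Hom_def reparam_def\<close>)
qed

lemma square_flip:
  assumes "square A W x y l r"
  shows "square A W y x (reparam A (\<lambda>t. 1 - t) l) (reparam A (\<lambda>t. 1 - t) r)"
  using assms
proof (rule squareE)
  fix G assume G: "A \<in> Obj C" "W \<in> Obj C" "G \<in> Arr C" "Dom C G = prod_obj C (prod_obj C A I) I" "Cod C G = W"
    "x = G \<cdot> cyl_at 0 (prod_obj C A I)" "y = G \<cdot> cyl_at 1 (prod_obj C A I)"
    "l = G \<cdot> times_I (cyl_at 0 A)" "r = G \<cdot> times_I (cyl_at 1 A)"
  let ?P = "prod_obj C A I"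
  show ?thesis
    by (rule squareI[where G = "reparam ?P (\<lambda>t. 1 - t) G"])
       (use G in \<open>simp_all add: Hom_def reparam_def\<close>)
qed

text \<open>At every time the map is constant on \<open>A\<close>. In polar coordinates such a path
  is the motion of the center.\<close>

definition along_I :: "'o \<Rightarrow> 'o \<Rightarrow> 'm \<Rightarrow> bool" where
  "along_I A W r \<longleftrightarrow> (\<exists>c\<in>Hom C I W. r = c \<cdot> pr2 C A I)"

lemma along_I_reparam:
  assumes "along_I A W r" "A \<in> Obj C" "c1 f"
  shows "along_I A W (reparam A f r)"
proof -
  obtain c where c: "c \<in> Hom C I W" "r = c \<cdot> pr2 C A I" using assms(1) by (auto simp: along_I_def)
  have "reparam A f r = (c \<cdot> app1 f (Ide C I)) \<cdot> pr2 C A I"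
    using c assms(2,3) by (simp add: reparam_def Hom_def)
  moreover have "c \<cdot> app1 f (Ide C I) \<in> Hom C I W"
    using c assms(2,3) by (simp add: Hom_def)
  ultimately show ?thesis unfolding along_I_def by blast
qed

lemma along_I_const:
  assumes "w \<in> Hom C point W" "A \<in> Obj C"
  shows "along_I A W (w \<cdot> to_pt A \<cdot> pr1 C A I)"
  unfolding along_I_def
  by (rule bexI[of _ "w \<cdot> to_pt I"]) (use assms in \<open>auto simp: Hom_def\<close>)

text \<open>The paths \<open>c\<close> and \<open>d\<close> in \<open>W\<close> are known to match
  only after composition with \<open>A \<rightarrow> *\<close>. The point of \<open>A\<close>
  cancels that map, so they can be joined.\<close>

lemma along_I_join:
  assumes "along_I A W r" "along_I A W r'" "r \<cdot> cyl_at 1 A = r' \<cdot> cyl_at 0 A" "p \<in> Hom C point A"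
  shows "along_I A W (join A r r')"
proof -
  obtain c d where c: "c \<in> Hom C I W" "r = c \<cdot> pr2 C A I" and d: "d \<in> Hom C I W" "r' = d \<cdot> pr2 C A I"
    using assms(1,2) by (auto simp: along_I_def)
  have A: "A \<in> Obj C" using assms(4) Hom_Obj by auto
  have "c \<cdot> cst 1 A = d \<cdot> cst 0 A" using assms(3) c d A by (simp add: Hom_def)
  then have "(c \<cdot> cst 1 A) \<cdot> p = (d \<cdot> cst 0 A) \<cdot> p" by simp
  then have e: "c \<cdot> cst 1 point = d \<cdot> cst 0 point" using assms(4) c d A by (simp add: Hom_def)
  \<comment> \<open>The joining takes place over the one-point object and is then pulled back along
    \<open>A \<rightarrow> *\<close>.\<close>
  let ?c = "c \<cdot> pr2 C point I" and ?d = "d \<cdot> pr2 C point I"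
  have cd: "?c \<in> paths point W" "?d \<in> paths point W" using c d by (auto simp: Hom_def)
  have e': "?c \<cdot> cyl_at 1 point = ?d \<cdot> cyl_at 0 point" using e c d by (simp add: Hom_def)
  have "join point ?c ?d \<cdot> times_I (to_pt A) = join A r r'"
    using join_pre[OF _ cd e' bang_Hom[OF A]] c d A by (simp add: Hom_def)
  then have "join A r r' = (join point ?c ?d \<cdot> pairing C (to_pt I) (Ide C I)) \<cdot> pr2 C A I"
    using join_props(1)[OF _ cd e'] A by (simp add: Hom_def)
  moreover have "join point ?c ?d \<cdot> pairing C (to_pt I) (Ide C I) \<in> Hom C I W"
    using join_props(1)[OF _ cd e'] by (simp add: Hom_def)
  ultimately show ?thesis unfolding along_I_def by blast
qed

text \<open>Homotopy of paths of maps \<open>A \<rightarrow> W\<close> keeping the start fixed and moving the end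
  through constant maps.\<close>

definition path_eq :: "'o \<Rightarrow> 'o \<Rightarrow> 'm \<Rightarrow> 'm \<Rightarrow> bool" where
  "path_eq A W g h \<longleftrightarrow> (\<exists>r. along_I A W r \<and> square A W g h (g \<cdot> cyl_at 0 A \<cdot> pr1 C A I) r)"

abbreviation "rev_path A g \<equiv> reparam A (\<lambda>t. 1 - t) g"

lemma path_eq_start:
  assumes "path_eq A W g h"
  shows "g \<cdot> cyl_at 0 A = h \<cdot> cyl_at 0 A" "A \<in> Obj C" "g \<in> paths A W" "h \<in> paths A W"
proof -
  obtain r where s: "square A W g h (g \<cdot> cyl_at 0 A \<cdot> pr1 C A I) r"
    using assms by (auto simp: path_eq_def)
  note p = square_paths[OF s] square_corners[OF s]
  show "A \<in> Obj C" "g \<in> paths A W" "h \<in> paths A W" by (rule p)+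
  show "g \<cdot> cyl_at 0 A = h \<cdot> cyl_at 0 A" using p by (simp add: Hom_def)
qed

lemma path_eq_sym:
  assumes "path_eq A W g h"
  shows "path_eq A W h g"
proof -
  obtain r where r: "along_I A W r" and s: "square A W g h (g \<cdot> cyl_at 0 A \<cdot> pr1 C A I) r"
    using assms by (auto simp: path_eq_def)
  note p = square_paths[OF s]
  have "reparam A (\<lambda>t. 1 - t) (g \<cdot> cyl_at 0 A \<cdot> pr1 C A I) = h \<cdot> cyl_at 0 A \<cdot> pr1 C A I"
    unfolding path_eq_start(1)[OF assms] using p reparam_constant[of "\<lambda>t. 1 - t" "h \<cdot> cyl_at 0 A" A]
    by (simp add: Hom_def)
  with square_flip[OF s] along_I_reparam[OF r p(1), of "\<lambda>t. 1 - t"] show ?thesis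
    unfolding path_eq_def by auto
qed

lemma path_eq_trans:
  assumes "path_eq A W g h" "path_eq A W h k" "p \<in> Hom C point A"
  shows "path_eq A W g k"
proof -
  obtain r where r: "along_I A W r" and s: "square A W g h (g \<cdot> cyl_at 0 A \<cdot> pr1 C A I) r"
    using assms by (auto simp: path_eq_def)
  obtain r' where r': "along_I A W r'" and s': "square A W h k (h \<cdot> cyl_at 0 A \<cdot> pr1 C A I) r'"
    using assms by (auto simp: path_eq_def)
  have "g \<cdot> cyl_at 0 A \<in> Hom C A W" using path_eq_start[OF assms(1)] by (simp add: Hom_def)
  from join_const[OF this] square_vertical[OF s s'] path_eq_start(1)[OF assms(1)]
  have "square A W g k (g \<cdot> cyl_at 0 A \<cdot> pr1 C A I) (join A r r')" by simp
  moreover have "along_I A W (join A r r')"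
    using along_I_join[OF r r' _ assms(3)] square_corners[OF s] square_corners[OF s'] by simp
  ultimately show ?thesis unfolding path_eq_def by blast
qed


section \<open>Squares obtained from a single path\<close>

lemma square_static:
  assumes "A \<in> Obj C" "g \<in> paths A W"
  shows "square A W g g (g \<cdot> cyl_at 0 A \<cdot> pr1 C A I) (g \<cdot> cyl_at 1 A \<cdot> pr1 C A I)"
  using square_app2[OF assms, of "\<lambda>t s. t"] assms by (simp add: HomD)

lemma square_shrink:
  assumes "A \<in> Obj C" "g \<in> paths A W"
  shows "square A W g (g \<cdot> cyl_at 0 A \<cdot> pr1 C A I) (g \<cdot> cyl_at 0 A \<cdot> pr1 C A I) (rev_path A g)"
  using square_app2[OF assms, of "\<lambda>t s. t * (1 - s)"] assms by (simp add: HomD)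

lemma square_shrink_rev:
  assumes "A \<in> Obj C" "g \<in> paths A W"
  shows "square A W (rev_path A g) (g \<cdot> cyl_at 0 A \<cdot> pr1 C A I) (rev_path A g) (g \<cdot> cyl_at 0 A \<cdot> pr1 C A I)"
  using square_app2[OF assms, of "\<lambda>t s. (1 - t) * (1 - s)"] assms by (simp add: HomD)

text \<open>The function \<open>1 - t * (1 - s)\<close> contracts the reversed path to its start,
  which is the end of \<open>g\<close>; its side \<open>t = 1\<close> runs through
  \<open>g\<close>.\<close>

lemma square_shrink_end:
  assumes "A \<in> Obj C" "g \<in> paths A W"
  shows "square A W (rev_path A g) (g \<cdot> cyl_at 1 A \<cdot> pr1 C A I) (g \<cdot> cyl_at 1 A \<cdot> pr1 C A I) g"
  using square_app2[OF assms, of "\<lambda>t s. 1 - t * (1 - s)"] assms by (simp add: HomD)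

text \<open>Its left side is \<open>g\<close> itself, so it fits to the right of
  \<open>square_shrink_end\<close>.\<close>

lemma square_max:
  assumes "A \<in> Obj C" "g \<in> paths A W"
  shows "square A W g (g \<cdot> cyl_at 1 A \<cdot> pr1 C A I) g (g \<cdot> cyl_at 1 A \<cdot> pr1 C A I)"
proof -
  have "reparam A (max 0) g = reparam A (\<lambda>x. x) g" "reparam A (\<lambda>x. max x 0) g = reparam A (\<lambda>x. x) g"
    "reparam A (max 1) g = reparam A (\<lambda>x. 1) g" "reparam A (\<lambda>x. max x 1) g = reparam A (\<lambda>x. 1) g"
    by (rule reparam_cong; simp)+
  then show ?thesis using square_app2[OF assms, of max] assms by (simp add: HomD)
qed

lemma square_grow:
  assumes "A \<in> Obj C" "g \<in> paths A W"
  shows "square A W (g \<cdot> cyl_at 0 A \<cdot> pr1 C A I) g (g \<cdot> cyl_at 0 A \<cdot> pr1 C A I) g"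
proof -
  have "reparam A ((*) 0) g = reparam A (\<lambda>x. 0) g" "reparam A ((*) 1) g = reparam A (\<lambda>x. x) g"
    by (rule reparam_cong; simp)+
  then show ?thesis using square_app2[OF assms, of "(*)"] assms by (simp add: HomD)
qed

section \<open>Unit and cancellation laws for concatenation\<close>

lemma path_eq_join_left:
  assumes "path_eq A W g h" "f \<in> paths A W" "f \<cdot> cyl_at 1 A = g \<cdot> cyl_at 0 A"
  shows "path_eq A W (join A f g) (join A f h)"
proof -
  obtain r where r: "along_I A W r" and s: "square A W g h (g \<cdot> cyl_at 0 A \<cdot> pr1 C A I) r"
    using assms(1) by (auto simp: path_eq_def)
  note p = path_eq_start[OF assms(1)]
  have "square A W (join A f g) (join A f h) (f \<cdot> cyl_at 0 A \<cdot> pr1 C A I) r"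
    using square_horizontal[OF square_static[OF p(2) assms(2), unfolded assms(3)] s] .
  with r join_ends(1)[OF p(2) assms(2) p(3) assms(3)] show ?thesis
    unfolding path_eq_def by auto
qed

text \<open>The straight line from \<open>\<kappa>\<close> to the identity fixes \<open>0\<close>
  and \<open>1\<close>, so neither end of the path moves.\<close>

lemma path_eq_reparam:
  assumes g: "g \<in> paths A W" "g \<cdot> cyl_at 1 A = w \<cdot> to_pt A" "w \<in> Hom C point W" "A \<in> Obj C"
    and \<kappa>: "c1 \<kappa>" "\<kappa> 0 = 0" "\<kappa> 1 = 1"
  shows "path_eq A W (reparam A \<kappa> g) g"
proof -
  have "c2 (\<lambda>t s. (1 - s) * \<kappa> t + s * t)"
    using icont_comp[OF \<kappa>(1), of "cube 2" "\<lambda>x. x 0"] by simp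
  from square_app2[OF g(4,1) this]
  have "square A W (reparam A \<kappa> g) g (g \<cdot> cyl_at 0 A \<cdot> pr1 C A I) (g \<cdot> cyl_at 1 A \<cdot> pr1 C A I)"
    using g \<kappa> by (simp add: HomD)
  moreover have "reparam A \<kappa> g \<cdot> cyl_at 0 A = g \<cdot> cyl_at 0 A" using g \<kappa> by (simp add: HomD)
  ultimately show ?thesis
    unfolding path_eq_def using along_I_const[OF g(3,4)] g(2) by auto
qed

text \<open>Two pieces of one path that fit together form a reparametrisation of it, by the function
  induced on the glued interval. That function fixes \<open>0\<close> and \<open>1\<close> because
  \<open>fa 0 = 0\<close> and \<open>fb 1 = 1\<close>.\<close>

lemma path_eq_join_reparam:
  assumes g: "g \<in> paths A W" "g \<cdot> cyl_at 1 A = w \<cdot> to_pt A" "w \<in> Hom C point W" "A \<in> Obj C"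
    and u: "c1 u" "u 0 = 0" and v: "c1 v" "v 1 = 1" and e: "u 1 = v 0"
  shows "path_eq A W (join A (reparam A u g) (reparam A v g)) g"
proof -
  obtain \<kappa> where \<kappa>: "c1 \<kappa>" "\<And>t. 0 \<le> t \<Longrightarrow> t \<le> 1 \<Longrightarrow> \<kappa> (fa t) = u t"
     "\<And>t. 0 \<le> t \<Longrightarrow> t \<le> 1 \<Longrightarrow> \<kappa> (fb t) = v t"
    using reparam_exists[OF u(1) v(1) e] by blast
  have "reparam A (\<lambda>t. \<kappa> (fa t)) g = reparam A u g" "reparam A (\<lambda>t. \<kappa> (fb t)) g = reparam A v g"
    by (rule reparam_cong; simp add: \<kappa>)+
  then have "join A (reparam A u g) (reparam A v g) = reparam A \<kappa> g"
    using g(1,4) \<kappa>(1) by (intro join_eqI[of _ _ W]) (auto simp: Hom_def)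
  moreover have "\<kappa> 0 = 0" "\<kappa> 1 = 1" using \<kappa>(2)[of 0] \<kappa>(3)[of 1] u v by auto
  ultimately show ?thesis using path_eq_reparam[OF g \<kappa>(1)] by simp
qed

text \<open>A constant path at an end of \<open>g\<close> is \<open>g\<close> reparametrised by the
  constant function \<open>0\<close> or \<open>1\<close>.\<close>

lemma path_eq_join_const:
  assumes g: "g \<in> paths A W" "g \<cdot> cyl_at 1 A = w \<cdot> to_pt A" "w \<in> Hom C point W" "A \<in> Obj C"
  shows path_eq_join_const_left: "path_eq A W (join A (g \<cdot> cyl_at 0 A \<cdot> pr1 C A I) g) g"
    and path_eq_join_const_right: "path_eq A W (join A g (g \<cdot> cyl_at 1 A \<cdot> pr1 C A I)) g"
  using path_eq_join_reparam[OF g, of "\<lambda>_. 0" "\<lambda>t. t"] path_eq_join_reparam[OF g, of "\<lambda>t. t" "\<lambda>_. 1"]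
    HomD[OF g(1)] g(4) by simp_all

text \<open>Two squares side by side contract both factors to the common end of the whole; along
  their shared side they run through \<open>g\<close>.\<close>

lemma path_eq_join_rev:
  assumes g: "g \<in> paths A W" "g \<cdot> cyl_at 1 A = w \<cdot> to_pt A" "w \<in> Hom C point W" "A \<in> Obj C"
  shows "path_eq A W (join A (rev_path A g) g) (g \<cdot> cyl_at 1 A \<cdot> pr1 C A I)"
proof -
  have r: "rev_path A g \<in> paths A W" "rev_path A g \<cdot> cyl_at 1 A = g \<cdot> cyl_at 0 A"
    "rev_path A g \<cdot> cyl_at 0 A = g \<cdot> cyl_at 1 A"
    using g(1,4) by (auto simp: Hom_def)
  have "g \<cdot> cyl_at 1 A \<in> Hom C A W" using g(1,4) by (simp add: Hom_def)
  from join_const[OF this]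
    square_horizontal[OF square_shrink_end[OF g(4,1)] square_max[OF g(4,1)]]
  have "square A W (join A (rev_path A g) g) (g \<cdot> cyl_at 1 A \<cdot> pr1 C A I)
    (g \<cdot> cyl_at 1 A \<cdot> pr1 C A I) (g \<cdot> cyl_at 1 A \<cdot> pr1 C A I)" by simp
  moreover have "join A (rev_path A g) g \<cdot> cyl_at 0 A = g \<cdot> cyl_at 1 A"
    using join_ends(1)[OF g(4) r(1) g(1) r(2)] r(3) by simp
  ultimately show ?thesis
    unfolding path_eq_def using along_I_const[OF g(3,4)] g(2) by auto
qed

text \<open>Three squares side by side shrink \<open>g\<close> and its reverse together while
  \<open>v\<close> stands still. What remains is \<open>v\<close> behind two constant paths, so the
  brackets never have to be moved.\<close>

lemma path_eq_join_cancel: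
  assumes p: "p \<in> Hom C point A"
    and g: "g \<in> paths A W"
    and v: "v \<in> paths A W" "v \<cdot> cyl_at 1 A = w \<cdot> to_pt A" "w \<in> Hom C point W"
    and e: "v \<cdot> cyl_at 0 A = g \<cdot> cyl_at 0 A"
  shows "path_eq A W (join A g (join A (rev_path A g) v)) v"
proof -
  have A: "A \<in> Obj C" using Hom_Obj[OF p] by simp
  let ?c = "g \<cdot> cyl_at 0 A \<cdot> pr1 C A I"
  have s: "square A W (join A g (join A (rev_path A g) v)) (join A ?c (join A ?c v)) ?c (v \<cdot> cyl_at 1 A \<cdot> pr1 C A I)"
    by (rule square_horizontal[OF square_shrink[OF A g] square_horizontal[OF square_shrink_rev[OF A g]
          square_static[OF A v(1), unfolded e]]])
  have r: "rev_path A g \<in> paths A W" "rev_path A g \<cdot> cyl_at 1 A = g \<cdot> cyl_at 0 A"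
    "rev_path A g \<cdot> cyl_at 0 A = g \<cdot> cyl_at 1 A"
    using g A by (auto simp: Hom_def)
  have r2: "rev_path A g \<cdot> cyl_at 1 A = v \<cdot> cyl_at 0 A" using r e by simp
  note c = join_ends[OF A r(1) v(1) r2] join_props(1)[OF A r(1) v(1) r2]
  have "join A g (join A (rev_path A g) v) \<cdot> cyl_at 0 A = g \<cdot> cyl_at 0 A"
    by (rule join_ends(1)[OF A g c(3)]) (simp add: c r)
  then have 1: "path_eq A W (join A g (join A (rev_path A g) v)) (join A ?c (join A ?c v))"
    unfolding path_eq_def using s along_I_const[OF v(3) A] unfolding v(2) by auto
  have u: "path_eq A W (join A ?c v) v"
    using path_eq_join_const_left[OF v A] unfolding e .
  have "path_eq A W (join A ?c (join A ?c v)) (join A ?c v)"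
    by (rule path_eq_join_left[OF u]) (use g A path_eq_start(1)[OF u] e in \<open>auto simp: Hom_def\<close>)
  from path_eq_trans[OF 1 path_eq_trans[OF this u p] p] show ?thesis .
qed

text \<open>A contraction whose start travels along \<open>l\<close> is traded for one with fixed
  start: \<open>g\<close> is deformed to \<open>l\<close> followed by a constant path, then to
  \<open>l\<close>. Being constant on \<open>A\<close> at all times, \<open>l\<close> may be
  shortened from its end until only its start is left.\<close>

lemma path_eq_null:
  assumes p: "p \<in> Hom C point A"
    and s: "square A W g (w \<cdot> to_pt A \<cdot> pr1 C A I) l r" and w: "w \<in> Hom C point W"
    and l: "along_I A W l" and r: "along_I A W r"
    and e: "g \<cdot> cyl_at 1 A = q \<cdot> to_pt A" "q \<in> Hom C point W"
  shows "path_eq A W g (g \<cdot> cyl_at 0 A \<cdot> pr1 C A I)"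
proof -
  note P = square_paths[OF s] and K = square_corners[OF s]
  let ?c = "g \<cdot> cyl_at 0 A \<cdot> pr1 C A I" and ?w = "w \<cdot> to_pt A \<cdot> pr1 C A I"
  have w1: "?w \<cdot> cyl_at k A = w \<cdot> to_pt A" if "0 \<le> k" "k \<le> 1" for k
    using w P(1) that by (simp add: Hom_def)
  have l1: "l \<cdot> cyl_at 1 A = w \<cdot> to_pt A" using K(2) w1[of 0] by simp
  have 1: "path_eq A W g (join A ?c g)"
    by (rule path_eq_sym[OF path_eq_join_const_left[OF P(3) e P(1)]])
  have cg: "?c \<cdot> cyl_at k A = g \<cdot> cyl_at 0 A" if "0 \<le> k" "k \<le> 1" for k
    using P that by (simp add: Hom_def)
  have cp: "?c \<in> paths A W" using P by (simp add: Hom_def)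
  have "join A ?c g \<cdot> cyl_at 0 A = g \<cdot> cyl_at 0 A"
    using join_ends(1)[OF P(1) cp P(3)] cg by simp
  \<comment> \<open>To the left of the given square goes one that lets \<open>l\<close> grow out of
    its start. This makes the new left side constant.\<close>
  then have 2: "path_eq A W (join A ?c g) (join A l ?w)"
    using square_horizontal[OF square_grow[OF P(1,5)] s] r K(1) unfolding path_eq_def by auto
  have 3: "path_eq A W (join A l ?w) l"
    using path_eq_join_const_right[OF P(5) l1 w P(1)] unfolding l1 .
  have 4: "path_eq A W l ?c"
    using square_shrink[OF P(1,5)] along_I_reparam[OF l P(1), of "\<lambda>t. 1 - t"] K(1)
    unfolding path_eq_def by auto
  from path_eq_trans[OF 1 path_eq_trans[OF 2 path_eq_trans[OF 3 4 p] p] p] show ?thesis .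
qed


section \<open>Homotopy extension and polar coordinates\<close>

abbreviation "Sph k \<equiv> OMap \<iota> (bdry k)"
abbreviation "Cub k \<equiv> OMap \<iota> (cube k)"
abbreviation "inc k \<equiv> AMap \<iota> (bdry_incl k)"
abbreviation "homotopic k \<equiv> homotopic_rel C \<iota> (inc k)"

lemma inc_simps [simp]: "inc k \<in> Arr C" "Dom C (inc k) = Sph k" "Cod C (inc k) = Cub k"
  using AMap_simps[OF tmap_Box[OF _ _ continuous_map_bdry_incl]] by (simp_all add: bdry_incl_def)

text \<open>Forgetting the last coordinate is a retraction of the inclusion, so any map on the base
  extends by composition.\<close>

lemma extendable_base_incl:
  assumes "Z \<in> Obj C"
  shows "extendable Z (AMap \<iota> (base_incl n))"
proof -
  let ?r = "\<lambda>x :: nat \<Rightarrow> real. restrict x {..<n}" and ?j = "\<lambda>x :: nat \<Rightarrow> real. x(n := 0)"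
  have r: "continuous_map (cube (Suc n)) (cube n) ?r"
    unfolding continuous_map_cube by auto
  have j: "continuous_map (cube n) (cube (Suc n)) ?j"
    unfolding continuous_map_cube by (auto simp: extensional_def PiE_def less_Suc_eq)
  note J = tmap_Box[OF _ _ j] and R = tmap_Box[OF _ _ r]
  have "tmap (cube (Suc n)) (cube n) ?r \<cdot>\<^bsub>Box\<^esub> tmap (cube n) (cube (Suc n)) ?j = tmap (cube n) (cube n) (\<lambda>x. x)"
    unfolding tmap_comp_Box[OF continuous_map_funspace[OF j]]
    by (rule tmap_eqI) (auto simp: PiE_def extensional_def restrict_def fun_eq_iff)
  then have e: "AMap \<iota> (tmap (cube (Suc n)) (cube n) ?r) \<cdot> AMap \<iota> (base_incl n) = Ide C (Cub n)"
    unfolding base_incl_def using AMap_comp[OF J R] AMap_Ide by simp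
  note J' = AMap_simps[OF J, folded base_incl_def, simplified] and R' = AMap_simps[OF R, simplified]
  show ?thesis unfolding extendable_def
  proof (intro conjI ballI)
    fix g assume g: "g \<in> Hom C (Dom C (AMap \<iota> (base_incl n))) Z"
    show "\<exists>h\<in>Hom C (Cod C (AMap \<iota> (base_incl n))) Z. h \<cdot> AMap \<iota> (base_incl n) = g"
      by (rule bexI[of _ "g \<cdot> AMap \<iota> (tmap (cube (Suc n)) (cube n) ?r)"])
        (use g e J' R' in \<open>auto simp: Hom_def\<close>)
  qed (use J' in simp)
qed

lemma base_incl_0: "AMap \<iota> (base_incl 0) = cst 0 point"
proof -
  have "base_incl 0 = endpoint 0"
    unfolding base_incl_def endpoint_def One_nat_def
    by (rule tmap_eqI) (auto simp: PiE_def extensional_def restrict_def fun_eq_iff)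
  then show ?thesis by (simp add: endpoint_cst)
qed

text \<open>Only \<open>j_0\<close>, the inclusion of the endpoint \<open>0\<close>, enters from
  \<open>\<J>\<close>. Its pushout product with \<open>inc k\<close> is the inclusion of the base
  and the walls into the cylinder, and \<open>\<alpha>\<close> and \<open>h\<close> together define
  a map on its source.\<close>

lemma homotopy_extension:
  assumes \<alpha>: "\<alpha> \<in> Hom C (Cub k) X" and h: "h \<in> paths (Sph k) X"
    and e: "h \<cdot> cyl_at 0 (Sph k) = \<alpha> \<cdot> inc k"
  obtains H where "H \<in> paths (Cub k) X" "H \<cdot> cyl_at 0 (Cub k) = \<alpha>" "H \<cdot> times_I (inc k) = h"
proof -
  have X: "X \<in> Obj C" using Hom_Obj[OF \<alpha>] by simp
  let ?f = "inc k" and ?g = "AMap \<iota> (base_incl 0)"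
  let ?u = "prod_map C ?f (Ide C point)" and ?v = "prod_map C (Ide C (Sph k)) ?g"
  let ?U = "prod_map C (Ide C (Cub k)) ?g" and ?V = "prod_map C ?f (Ide C I)"
  have g [simp]: "?g \<in> Arr C" "Dom C ?g = point" "Cod C ?g = I"
    by (simp_all add: base_incl_0)
  obtain a b where P: "is_pushout C ?u ?v a b"
    using pushout_exists_arr[of ?u ?v] by auto
  note P' = is_pushoutD[OF P]
  have "?U \<cdot> ?u = ?V \<cdot> ?v"
    by (simp add: prod_map_def base_incl_0)
  then obtain j where j: "j \<in> Hom C (Cod C a) (cyl C \<iota> (Cub k))" "j \<cdot> a = ?U" "j \<cdot> b = ?V"
    using is_pushoutE[OF P, of "cyl C \<iota> (Cub k)" ?U ?V] by (auto simp: Hom_def)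
  have "is_pushout_product C ?f ?g j"
    unfolding is_pushout_product_def
    by (intro conjI exI[of _ a] exI[of _ b]) (use P j in simp_all)
  moreover have "inc k \<in> gen_I \<iota>" "?g \<in> gen_J \<iota>" by (auto simp: gen_I_def gen_J_def)
  ultimately have "j \<in> pushout_products C (gen_I \<iota>) (gen_J \<iota>)" by (auto simp: pushout_products_def)
  then have "j \<in> cof U C (gen_J \<iota>)" using Q by (auto simp: Q_structure_def)
  moreover have "extendable X k" if "k \<in> gen_J \<iota>" for k
    using that extendable_base_incl[OF X] by (auto simp: gen_J_def)
  ultimately have ext: "extendable X j" by (rule extendable_cof[rotated])
  have "(\<alpha> \<cdot> pr1 C (Cub k) point) \<cdot> ?u = (\<alpha> \<cdot> inc k) \<cdot> pr1 C (Sph k) point"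
    using \<alpha> by (simp add: prod_map_def Hom_def)
  also have "\<dots> = h \<cdot> ?v"
    unfolding e[symmetric] using h by (simp add: prod_map_def base_incl_0 Hom_def)
  finally obtain m where m: "m \<in> Hom C (Cod C a) X" "m \<cdot> a = \<alpha> \<cdot> pr1 C (Cub k) point" "m \<cdot> b = h"
    using is_pushoutE[OF P X, of "\<alpha> \<cdot> pr1 C (Cub k) point" h] \<alpha> h by (auto simp: Hom_def)
  obtain H where H: "H \<in> Hom C (Cod C j) X" "H \<cdot> j = m"
    using ext m(1) j(1) unfolding extendable_def by (auto simp: Hom_def)
  have H': "H \<in> Arr C" "Dom C H = cyl C \<iota> (Cub k)" "Cod C H = X" using H(1) j(1) by (auto simp: Hom_def)
  have "H \<cdot> ?U = \<alpha> \<cdot> pr1 C (Cub k) point" "H \<cdot> ?V = h"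
    unfolding j(2,3)[symmetric] m(2,3)[symmetric] H(2)[symmetric] using H' j(1) P' by (auto simp: Hom_def)
  \<comment> \<open>In the pushout product the base appears as \<open>Cub k \<times> *\<close>;
    composing with the isomorphism from \<open>Cub k\<close> removes the point.\<close>
  from arg_cong[OF this(1), of "\<lambda>z. z \<cdot> pairing C (Ide C (Cub k)) (to_pt (Cub k))"] this(2)
  have "H \<cdot> cyl_at 0 (Cub k) = \<alpha>" "H \<cdot> times_I (inc k) = h"
    using H' \<alpha> by (simp_all add: prod_map_def base_incl_0 Hom_def)
  with H' show ?thesis by (intro that[of H]) (auto simp: Hom_def)
qed

text \<open>\<open>E Y\<close> is the path object of \<open>Y\<close>, obtained from
  exponentiability of \<open>I\<close> (Q5). Naturality of the adjunction is kept in the source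
  variable, with the identity inserted in the target.\<close>

lemma exponential:
  obtains E \<phi> where "\<And>Y. Y \<in> Obj C \<Longrightarrow> E Y \<in> Obj C"
    "\<And>X Y. X \<in> Obj C \<Longrightarrow> Y \<in> Obj C \<Longrightarrow> bij_betw (\<phi> X Y) (paths X Y) (Hom C X (E Y))"
    "\<And>X Y B u g. u \<in> Hom C B X \<Longrightarrow> g \<in> paths X Y \<Longrightarrow> \<phi> B Y (g \<cdot> times_I u) = \<phi> X Y g \<cdot> u"
proof -
  let ?F = "\<lparr>OMap = \<lambda>X. prod_obj C X I, AMap = \<lambda>h. prod_map C h (Ide C I)\<rparr>"
  have "exponentiable C I" using Q by (simp add: Q_structure_def)
  then obtain G \<phi> where G: "is_functor C C G" and
    bij: "\<forall>X\<in>Obj C. \<forall>Y\<in>Obj C.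
             bij_betw (\<phi> X Y) (Hom C (OMap ?F X) Y) (Hom C X (OMap G Y))" and
    nat: "\<forall>X\<in>Obj C. \<forall>X'\<in>Obj C. \<forall>Y\<in>Obj C. \<forall>Y'\<in>Obj C.
             \<forall>u\<in>Hom C X' X. \<forall>v\<in>Hom C Y Y'. \<forall>g\<in>Hom C (OMap ?F X) Y.
               \<phi> X' Y' (v \<cdot> g \<cdot> AMap ?F u) = AMap G v \<cdot> \<phi> X Y g \<cdot> u"
    unfolding exponentiable_def adjoint_functors_def by blast
  have GI: "OMap G Y \<in> Obj C" "AMap G (Ide C Y) = Ide C (OMap G Y)" if "Y \<in> Obj C" for Y
    using G that by (auto simp: is_functor_def)
  show ?thesis
  proof (rule that[of "OMap G" \<phi>])
    fix X Y B u g assume u: "u \<in> Hom C B X" and g: "g \<in> paths X Y"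
    have o: "X \<in> Obj C" "B \<in> Obj C" "Y \<in> Obj C" using Hom_Obj[OF u] Hom_Obj[OF g] by auto
    have "\<phi> X Y g \<in> Hom C X (OMap G Y)"
      using bij[THEN bspec, OF o(1), THEN bspec, OF o(3)] g by (simp add: bij_betw_apply)
    then show "\<phi> B Y (g \<cdot> times_I u) = \<phi> X Y g \<cdot> u"
      using nat[THEN bspec, OF o(1), THEN bspec, OF o(2), THEN bspec, OF o(3), THEN bspec, OF o(3),
          THEN bspec, OF u, THEN bspec, of "Ide C Y", THEN bspec, of g] GI[OF o(3)] u g o
      by (simp add: Hom_def prod_map_def)
  qed (use GI bij in auto)
qed

text \<open>A left adjoint preserves pushouts; the universal property is carried through the
  transposition \<open>\<phi>\<close>. This allows homotopies, and not only maps, to be glued along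
  the two pushouts of (Q8).\<close>

lemma pushout_times_I:
  assumes P: "is_pushout C f g d s"
  shows "is_pushout C (times_I f) (times_I g) (times_I d) (times_I s)"
proof -
  note P' = is_pushoutD[OF P]
  obtain E \<phi> where E: "\<And>Y. Y \<in> Obj C \<Longrightarrow> E Y \<in> Obj C"
    and bij: "\<And>X Y. X \<in> Obj C \<Longrightarrow> Y \<in> Obj C \<Longrightarrow> bij_betw (\<phi> X Y) (paths X Y) (Hom C X (E Y))"
    and nat: "\<And>X Y B u g. u \<in> Hom C B X \<Longrightarrow> g \<in> paths X Y \<Longrightarrow> \<phi> B Y (g \<cdot> times_I u) = \<phi> X Y g \<cdot> u"
    by (rule exponential) blast
  have ump: "\<exists>!h. h \<in> paths (Cod C d) Z \<and> h \<cdot> times_I d = u \<and> h \<cdot> times_I s = v"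
    if Z: "Z \<in> Obj C" and u: "u \<in> paths (Cod C f) Z" and v: "v \<in> paths (Cod C g) Z"
      and e: "u \<cdot> times_I f = v \<cdot> times_I g" for Z u v
  proof -
    let ?u = "\<phi> (Cod C f) Z u" and ?v = "\<phi> (Cod C g) Z v"
    have f: "f \<in> Hom C (Dom C f) (Cod C f)" "g \<in> Hom C (Dom C f) (Cod C g)"
      "d \<in> Hom C (Cod C f) (Cod C d)" "s \<in> Hom C (Cod C g) (Cod C d)"
      using P' by (auto simp: Hom_def)
    have "?u \<cdot> f = ?v \<cdot> g" using nat[OF f(1) u] nat[OF f(2) v] e by simp
    then have ex: "\<exists>!k. k \<in> Hom C (Cod C d) (E Z) \<and> k \<cdot> d = ?u \<and> k \<cdot> s = ?v"
      using is_pushoutE[OF P E[OF Z], of ?u ?v] bij_betw_apply[OF bij u] bij_betw_apply[OF bij v] P' Z by auto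
    have B: "bij_betw (\<phi> (Cod C d) Z) (paths (Cod C d) Z) (Hom C (Cod C d) (E Z))"
      using bij P' Z by simp
    have inj: "x = y" if "\<phi> A Z x = \<phi> A Z y" "x \<in> paths A Z" "y \<in> paths A Z" "A \<in> Obj C" for A x y
      using bij[OF that(4) Z] that unfolding bij_betw_def inj_on_def by blast
    have iff: "h \<cdot> times_I d = u \<and> h \<cdot> times_I s = v \<longleftrightarrow> \<phi> (Cod C d) Z h \<cdot> d = ?u \<and> \<phi> (Cod C d) Z h \<cdot> s = ?v"
      if h: "h \<in> paths (Cod C d) Z" for h
    proof -
      have "h \<cdot> times_I d \<in> paths (Cod C f) Z" "h \<cdot> times_I s \<in> paths (Cod C g) Z"
        using h P' by (auto simp: Hom_def)
      then have "\<phi> (Cod C f) Z (h \<cdot> times_I d) = ?u \<longleftrightarrow> h \<cdot> times_I d = u"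
        "\<phi> (Cod C g) Z (h \<cdot> times_I s) = ?v \<longleftrightarrow> h \<cdot> times_I s = v"
        using inj[OF _ _ u] inj[OF _ _ v] arr_obj(2)[OF P'(1)] arr_obj(2)[OF P'(2)] by blast+
      then show ?thesis unfolding nat[OF f(3) h] nat[OF f(4) h] by blast
    qed
    obtain k where k: "k \<in> Hom C (Cod C d) (E Z)" "k \<cdot> d = ?u" "k \<cdot> s = ?v" using ex by blast
    then obtain h where h: "h \<in> paths (Cod C d) Z" "\<phi> (Cod C d) Z h = k"
      using bij_betw_imp_surj_on[OF B] by (metis imageE)
    show ?thesis
    proof (rule ex1I)
      show "h \<in> paths (Cod C d) Z \<and> h \<cdot> times_I d = u \<and> h \<cdot> times_I s = v"
        using iff[OF h(1)] h(1) k(2,3) unfolding h(2) by simp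
      fix h' assume h': "h' \<in> paths (Cod C d) Z \<and> h' \<cdot> times_I d = u \<and> h' \<cdot> times_I s = v"
      have h1: "h' \<in> paths (Cod C d) Z" using h' by (rule conjunct1)
      have "\<phi> (Cod C d) Z h' \<cdot> d = ?u \<and> \<phi> (Cod C d) Z h' \<cdot> s = ?v"
        using iff[OF h1, THEN iffD1, OF conjunct2[OF h']] .
      with Uniq_D[OF ex1_iff_ex_Uniq[THEN iffD1, THEN conjunct2, OF ex], of "\<phi> (Cod C d) Z h'" k] bij_betw_apply[OF B h1] k
      have "\<phi> (Cod C d) Z h' = \<phi> (Cod C d) Z h" unfolding h(2) by blast
      from inj[OF this h1 h(1) arr_obj(2)[OF P'(3)]] show "h' = h" .
    qed
  qed
  have "times_I d \<cdot> times_I f = times_I s \<cdot> times_I g"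
  proof -
    have "d \<cdot> f \<cdot> pr1 C (Dom C f) I = s \<cdot> g \<cdot> pr1 C (Dom C f) I"
      by (simp only: P'(9))
    then show ?thesis using P'(1-8) by simp
  qed
  moreover have "Cod C (times_I f) = prod_obj C (Cod C f) I" "Cod C (times_I g) = prod_obj C (Cod C g) I"
    "Cod C (times_I d) = prod_obj C (Cod C d) I" using P'(1-8) by simp_all
  ultimately show ?thesis
    unfolding is_pushout_def using P'(1-8) ump by simp
qed

lemma homotopic_rel_iff:
  assumes "f \<in> Hom C A X" "j \<in> Hom C B A"
  shows "homotopic_rel C \<iota> j f g \<longleftrightarrow> g \<in> Hom C A X \<and> f \<cdot> j = g \<cdot> j \<and>
    (\<exists>H\<in>paths A X. H \<cdot> cyl_at 0 A = f \<and> H \<cdot> cyl_at 1 A = g \<and> H \<cdot> times_I j = f \<cdot> j \<cdot> pr1 C B I)"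
proof -
  have A: "A \<in> Obj C" "B \<in> Obj C" using Hom_Obj[OF assms(2)] by auto
  have "prod_map C j (Ide C I) = times_I j" "Dom C f = A" "Cod C f = X" "f \<in> Arr C" "Dom C j = B"
    using assms by (auto simp: prod_map_def Hom_def)
  then show ?thesis
    unfolding homotopic_rel_def is_homotopy_def using A by (auto simp: cyl_end_eq)
qed

lemma homotopic_relE:
  assumes "homotopic_rel C \<iota> j f g" "f \<in> Hom C A X" "j \<in> Hom C B A"
  obtains H where "H \<in> paths A X" "f = H \<cdot> cyl_at 0 A" "g = H \<cdot> cyl_at 1 A"
    "H \<cdot> times_I j = f \<cdot> j \<cdot> pr1 C B I" "g \<in> Hom C A X" "f \<cdot> j = g \<cdot> j"
  using assms(1) unfolding homotopic_rel_iff[OF assms(2,3)] by (elim conjE bexE) metis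

text \<open>Agreement of \<open>f\<close> and \<open>g\<close> on \<open>B\<close> is no assumption:
  it follows by restricting the last equation to time \<open>1\<close>.\<close>

lemma homotopic_relI:
  assumes "H \<in> paths A X" "H \<cdot> cyl_at 0 A = f" "H \<cdot> cyl_at 1 A = g" "j \<in> Hom C B A"
    "H \<cdot> times_I j = f \<cdot> j \<cdot> pr1 C B I"
  shows "homotopic_rel C \<iota> j f g"
proof -
  have A: "A \<in> Obj C" "B \<in> Obj C" using Hom_Obj[OF assms(4)] by auto
  note H = HomD[OF assms(1)]
  have fg: "f \<in> Hom C A X" "g \<in> Hom C A X"
    unfolding assms(2,3)[symmetric] using H A by (auto simp: Hom_def)
  have "(H \<cdot> times_I j) \<cdot> cyl_at 1 B = g \<cdot> j"
    unfolding assms(3)[symmetric] using H A assms(4) by (simp add: Hom_def)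
  then have "f \<cdot> j = g \<cdot> j"
    unfolding assms(5) using fg A assms(4) by (simp add: Hom_def)
  with assms fg show ?thesis
    by (subst homotopic_rel_iff[OF fg(1) assms(4)]) blast
qed

section \<open>Cubes as cones, with the boundary at time 0 and the center at time 1\<close>

definition polar :: "nat \<Rightarrow> 'm \<Rightarrow> 'm \<Rightarrow> bool" where
  "polar k c \<rho> \<longleftrightarrow> c \<in> Hom C point (Cub k) \<and> \<rho> \<in> paths (Sph k) (Cub k) \<and>
     is_pushout C (to_pt (Sph k)) (cyl_at 1 (Sph k)) c \<rho> \<and> \<rho> \<cdot> cyl_at 0 (Sph k) = inc k"

lemma polar_exists: "k \<ge> 1 \<Longrightarrow> \<exists>c \<rho>. polar k c \<rho>"
  using good unfolding good_Q_structure_def polar_def by (simp add: cyl_end_eq)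

lemma Sph_point:
  assumes "k \<ge> 1"
  obtains p where "p \<in> Hom C point (Sph k)"
proof -
  have "continuous_map (cube 0) (bdry k) (\<lambda>_. \<lambda>i\<in>{..<k}. 0)"
    unfolding continuous_map_bdry continuous_map_cube using assms by (auto intro!: exI[of _ 0])
  from AMap_Hom[OF tmap_Box[OF _ _ this]] show ?thesis by (intro that) auto
qed

lemma polarD:
  assumes "polar k c \<rho>"
  shows "c \<in> Arr C" "Dom C c = point" "Cod C c = Cub k" "\<rho> \<in> Arr C" "Dom C \<rho> = prod_obj C (Sph k) I"
    "Cod C \<rho> = Cub k" "\<rho> \<cdot> cyl_at 0 (Sph k) = inc k" "\<rho> \<cdot> cyl_at 1 (Sph k) = c \<cdot> to_pt (Sph k)"
    "is_pushout C (to_pt (Sph k)) (cyl_at 1 (Sph k)) c \<rho>"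
  using assms is_pushoutD(9)[of C "to_pt (Sph k)" "cyl_at 1 (Sph k)" c \<rho>]
  unfolding polar_def Hom_def by auto

lemma polar_extend:
  assumes P: "polar k c \<rho>" and "g \<in> paths (Sph k) W" "w \<in> Hom C point W"
    "g \<cdot> cyl_at 1 (Sph k) = w \<cdot> to_pt (Sph k)"
  obtains h where "h \<in> Hom C (Cub k) W" "h \<cdot> c = w" "h \<cdot> \<rho> = g"
  using is_pushoutE[OF polarD(9)[OF P], of W w g] assms polarD[OF P] Hom_Obj[OF assms(2)] by auto

text \<open>For \<open>k \<ge> 1\<close> the boundary has a point, and evaluating the constant end
  of the path there recovers the value at the center.\<close>

lemma polar_center:
  assumes P: "polar k c \<rho>" and k: "k \<ge> 1"
    and g: "g \<in> Hom C (Cub k) W" and w: "w \<in> Hom C point W"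
    and e: "g \<cdot> \<rho> \<cdot> cyl_at 1 (Sph k) = w \<cdot> to_pt (Sph k)"
  shows "g \<cdot> c = w"
proof -
  note P' = polarD[OF P]
  obtain p where p: "p \<in> Hom C point (Sph k)" using Sph_point[OF k] .
  have "(g \<cdot> (\<rho> \<cdot> cyl_at 1 (Sph k))) \<cdot> p = (w \<cdot> to_pt (Sph k)) \<cdot> p"
    using e g P'(1-7) by (simp add: Hom_def del: pairing_comp)
  then show ?thesis unfolding P'(8) using p P' g w by (simp add: Hom_def)
qed

text \<open>The pushout has a second leg \<open>c\<close>, but the value there is already determined
  by the path.\<close>

lemma polar_epi:
  assumes P: "polar k c \<rho>" and k: "k \<ge> 1"
    and g: "g \<in> Hom C (Cub k) W" and h: "h \<in> Hom C (Cub k) W" and e: "g \<cdot> \<rho> = h \<cdot> \<rho>"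
  shows "g = h"
proof -
  note P' = polarD[OF P]
  have "h \<cdot> \<rho> \<cdot> cyl_at 1 (Sph k) = (h \<cdot> c) \<cdot> to_pt (Sph k)"
    using h P' by (simp add: Hom_def)
  then have "g \<cdot> c = h \<cdot> c"
    by (intro polar_center[OF P k g]) (use h P' e in \<open>auto simp: Hom_def\<close>)
  then show ?thesis
    using is_pushoutE[OF P'(9), of W "h \<cdot> c" "h \<cdot> \<rho>"] g h P' e Hom_Obj[OF g] is_pushoutD(9)[OF P'(9)]
    by (auto simp: Hom_def)
qed

lemma polar_extend_homotopy:
  assumes P: "polar k c \<rho>" and G: "G \<in> paths (prod_obj C (Sph k) I) W" and "\<omega> \<in> Hom C I W"
    and e: "G \<cdot> times_I (cyl_at 1 (Sph k)) = \<omega> \<cdot> pr2 C (Sph k) I"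
  obtains H where "H \<in> paths (Cub k) W" "H \<cdot> times_I \<rho> = G"
proof -
  note P' = polarD[OF P]
  have W: "W \<in> Obj C" using Hom_Obj[OF G] by simp
  show ?thesis
    using is_pushoutE[OF pushout_times_I[OF P'(9)] W, of "\<omega> \<cdot> pr2 C point I" G] assms P' that
    by (auto simp: Hom_def)
qed

text \<open>Composing with \<open>times_I \<rho>\<close> turns a homotopy into a square. The way
  back uses that the cylinder on the cone is again a pushout, after which \<open>polar_epi\<close>
  identifies the two ends.\<close>

lemma homotopic_rel_polar:
  assumes P: "polar k c \<rho>" and k: "k \<ge> 1"
    and \<alpha>: "\<alpha> \<in> Hom C (Cub k) W" and \<beta>: "\<beta> \<in> Hom C (Cub k) W"
  shows "homotopic k \<alpha> \<beta> \<longleftrightarrow> path_eq (Sph k) W (\<alpha> \<cdot> \<rho>) (\<beta> \<cdot> \<rho>)"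
proof
  note P' = polarD[OF P]
  have i: "inc k \<in> Hom C (Sph k) (Cub k)" by (simp add: Hom_def)
  {
    assume "homotopic k \<alpha> \<beta>"
    then obtain H where H: "H \<in> paths (Cub k) W" "\<alpha> = H \<cdot> cyl_at 0 (Cub k)" "\<beta> = H \<cdot> cyl_at 1 (Cub k)"
      "H \<cdot> times_I (inc k) = \<alpha> \<cdot> inc k \<cdot> pr1 C (Sph k) I" by (rule homotopic_relE[OF _ \<alpha> i])
    note H' = HomD[OF H(1)]
    have \<alpha>': "\<alpha> \<in> Arr C" "Dom C \<alpha> = Cub k" "Cod C \<alpha> = W" using \<alpha> by (auto simp: Hom_def)
    have t: "times_I \<rho> \<cdot> times_I (cyl_at l (Sph k)) = times_I (\<rho> \<cdot> cyl_at l (Sph k))"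
      if "0 \<le> l" "l \<le> 1" for l using that P'(1-6) by simp
    \<comment> \<open>The right side is the track of the center under \<open>H\<close>.\<close>
    have "square (Sph k) W (\<alpha> \<cdot> \<rho>) (\<beta> \<cdot> \<rho>) (\<alpha> \<cdot> \<rho> \<cdot> cyl_at 0 (Sph k) \<cdot> pr1 C (Sph k) I)
       ((H \<cdot> pairing C (c \<cdot> to_pt I) (Ide C I)) \<cdot> pr2 C (Sph k) I)"
    proof (rule squareI[of _ "H \<cdot> times_I \<rho>"])
      show "\<alpha> \<cdot> \<rho> = H \<cdot> times_I \<rho> \<cdot> cyl_at 0 (prod_obj C (Sph k) I)"
        unfolding H(2) using H' P'(1-6) by simp
      show "\<beta> \<cdot> \<rho> = H \<cdot> times_I \<rho> \<cdot> cyl_at 1 (prod_obj C (Sph k) I)"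
        unfolding H(3) using H' P'(1-6) by simp
      have "\<alpha> \<cdot> \<rho> \<cdot> cyl_at 0 (Sph k) \<cdot> pr1 C (Sph k) I = \<alpha> \<cdot> (\<rho> \<cdot> cyl_at 0 (Sph k)) \<cdot> pr1 C (Sph k) I"
        using \<alpha>' P'(1-6) by simp
      also have "\<dots> = H \<cdot> times_I (\<rho> \<cdot> cyl_at 0 (Sph k))"
        unfolding P'(7) using H(4) \<alpha>' P' by simp
      also have "\<dots> = (H \<cdot> times_I \<rho>) \<cdot> times_I (cyl_at 0 (Sph k))"
        using t[of 0] H' P'(1-6) by simp
      finally show "\<alpha> \<cdot> \<rho> \<cdot> cyl_at 0 (Sph k) \<cdot> pr1 C (Sph k) I = H \<cdot> times_I \<rho> \<cdot> times_I (cyl_at 0 (Sph k))" .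
      have "(H \<cdot> times_I \<rho>) \<cdot> times_I (cyl_at 1 (Sph k)) = H \<cdot> times_I (\<rho> \<cdot> cyl_at 1 (Sph k))"
        using t[of 1] H' P'(1-6) by simp
      also have "\<dots> = (H \<cdot> pairing C (c \<cdot> to_pt I) (Ide C I)) \<cdot> pr2 C (Sph k) I"
        unfolding P'(8) using H' P'(1-6) by simp
      finally show "(H \<cdot> pairing C (c \<cdot> to_pt I) (Ide C I)) \<cdot> pr2 C (Sph k) I =
         H \<cdot> times_I \<rho> \<cdot> times_I (cyl_at 1 (Sph k))" by simp
    qed (use H' P' in \<open>auto simp: Hom_def\<close>)
    moreover have "along_I (Sph k) W ((H \<cdot> pairing C (c \<cdot> to_pt I) (Ide C I)) \<cdot> pr2 C (Sph k) I)"
      unfolding along_I_def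
      by (rule bexI[of _ "H \<cdot> pairing C (c \<cdot> to_pt I) (Ide C I)"])
        (use H' P'(1-6) in \<open>simp_all add: Hom_def\<close>)
    ultimately show "path_eq (Sph k) W (\<alpha> \<cdot> \<rho>) (\<beta> \<cdot> \<rho>)" unfolding path_eq_def by blast
  }
  assume "path_eq (Sph k) W (\<alpha> \<cdot> \<rho>) (\<beta> \<cdot> \<rho>)"
  then obtain r where r: "along_I (Sph k) W r"
    "square (Sph k) W (\<alpha> \<cdot> \<rho>) (\<beta> \<cdot> \<rho>) (\<alpha> \<cdot> \<rho> \<cdot> cyl_at 0 (Sph k) \<cdot> pr1 C (Sph k) I) r"
    by (auto simp: path_eq_def)
  obtain \<omega> where \<omega>: "\<omega> \<in> Hom C I W" "r = \<omega> \<cdot> pr2 C (Sph k) I" using r(1) by (auto simp: along_I_def)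
  show "homotopic k \<alpha> \<beta>"
    using r(2)
  proof (rule squareE)
    fix G assume G: "G \<in> Arr C" "Dom C G = prod_obj C (prod_obj C (Sph k) I) I" "Cod C G = W"
      "\<alpha> \<cdot> \<rho> = G \<cdot> cyl_at 0 (prod_obj C (Sph k) I)" "\<beta> \<cdot> \<rho> = G \<cdot> cyl_at 1 (prod_obj C (Sph k) I)"
      "\<alpha> \<cdot> \<rho> \<cdot> cyl_at 0 (Sph k) \<cdot> pr1 C (Sph k) I = G \<cdot> times_I (cyl_at 0 (Sph k))"
      "r = G \<cdot> times_I (cyl_at 1 (Sph k))"
    have "G \<in> paths (prod_obj C (Sph k) I) W" using G by (simp add: Hom_def)
    from polar_extend_homotopy[OF P this \<omega>(1)] G(7) \<omega>(2)
    obtain H where H: "H \<in> paths (Cub k) W" "H \<cdot> times_I \<rho> = G" by auto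
    note H' = HomD[OF H(1)]
    show ?thesis
    proof (rule homotopic_relI[OF H(1) _ _ i])
      have "(H \<cdot> cyl_at 0 (Cub k)) \<cdot> \<rho> = (H \<cdot> times_I \<rho>) \<cdot> cyl_at 0 (prod_obj C (Sph k) I)"
        "(H \<cdot> cyl_at 1 (Cub k)) \<cdot> \<rho> = (H \<cdot> times_I \<rho>) \<cdot> cyl_at 1 (prod_obj C (Sph k) I)"
        using H' P'(1-6) by simp_all
      then show "H \<cdot> cyl_at 0 (Cub k) = \<alpha>" "H \<cdot> cyl_at 1 (Cub k) = \<beta>"
        unfolding H(2) G(4,5)[symmetric]
        by (intro polar_epi[OF P k _ \<alpha>] polar_epi[OF P k _ \<beta>]; use H' in \<open>simp add: Hom_def\<close>)+
      have \<alpha>': "\<alpha> \<in> Arr C" "Dom C \<alpha> = Cub k" "Cod C \<alpha> = W" using \<alpha> by (auto simp: Hom_def)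
      have "H \<cdot> times_I (\<rho> \<cdot> cyl_at 0 (Sph k)) = (H \<cdot> times_I \<rho>) \<cdot> times_I (cyl_at 0 (Sph k))"
        using H' P'(1-6) by simp
      also have "\<dots> = \<alpha> \<cdot> (\<rho> \<cdot> cyl_at 0 (Sph k)) \<cdot> pr1 C (Sph k) I"
        unfolding H(2) G(6)[symmetric] using \<alpha>' P'(1-6) by simp
      finally show "H \<cdot> times_I (inc k) = \<alpha> \<cdot> inc k \<cdot> pr1 C (Sph k) I" unfolding P'(7) .
    qed
  qed
qed


section \<open>Null-homotopic loops and difference loops\<close>

text \<open>The index is shifted so that \<open>Sph (k + 1)\<close> is the \<open>k\<close>-cube
  with its boundary collapsed to \<open>pt\<close>, including the case \<open>k = 0\<close>.\<close>

definition pole :: "nat \<Rightarrow> 'm \<Rightarrow> 'm \<Rightarrow> bool" where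
  "pole k pt \<sigma> \<longleftrightarrow> pt \<in> Hom C point (Sph (k + 1)) \<and> \<sigma> \<in> Hom C (Cub k) (Sph (k + 1)) \<and>
     is_pushout C (to_pt (Sph k)) (inc k) pt \<sigma>"

lemma pole_exists: "\<exists>pt \<sigma>. pole k pt \<sigma>"
proof -
  have "\<forall>n\<ge>1. \<exists>pt \<sigma>. pt \<in> Hom C point (Sph n) \<and> \<sigma> \<in> Hom C (Cub (n - 1)) (Sph n) \<and>
        is_pushout C (to_pt (Sph (n - 1))) (inc (n - 1)) pt \<sigma>"
    using good unfolding good_Q_structure_def by blast
  from this[rule_format, of "k + 1"] show ?thesis by (simp add: pole_def)
qed

lemma poleD:
  assumes "pole k pt \<sigma>"
  shows "pt \<in> Arr C" "Dom C pt = point" "Cod C pt = Sph (k + 1)" "\<sigma> \<in> Arr C" "Dom C \<sigma> = Cub k"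
    "Cod C \<sigma> = Sph (k + 1)" "\<sigma> \<cdot> inc k = pt \<cdot> to_pt (Sph k)"
    "is_pushout C (to_pt (Sph k)) (inc k) pt \<sigma>"
  using assms is_pushoutD(9)[of C "to_pt (Sph k)" "inc k" pt \<sigma>]
  unfolding pole_def Hom_def by auto

lemma pole_extend:
  assumes "pole k pt \<sigma>" "w \<in> Hom C point W" "D \<in> Hom C (Cub k) W" "D \<cdot> inc k = w \<cdot> to_pt (Sph k)"
  obtains u where "u \<in> Hom C (Sph (k + 1)) W" "u \<cdot> pt = w" "u \<cdot> \<sigma> = D"
  using is_pushoutE[OF poleD(8)[OF assms(1)], of W w D] assms poleD[OF assms(1)] Hom_Obj[OF assms(2)]
  by auto

lemma pole_eqI:
  assumes P: "pole k pt \<sigma>" and g: "g \<in> Hom C (Sph (k + 1)) W" and h: "h \<in> Hom C (Sph (k + 1)) W"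
    and e: "g \<cdot> pt = h \<cdot> pt" "g \<cdot> \<sigma> = h \<cdot> \<sigma>"
  shows "g = h"
proof -
  note P' = poleD[OF P]
  have "(h \<cdot> pt) \<cdot> to_pt (Sph k) = (h \<cdot> \<sigma>) \<cdot> inc k"
    using P' h by (simp add: Hom_def)
  then show ?thesis
    using is_pushoutE[OF P'(8), of W "h \<cdot> pt" "h \<cdot> \<sigma>"] g h P' e Hom_Obj[OF g]
    by (auto simp: Hom_def)
qed

lemma pole_extend_homotopy:
  assumes P: "pole k pt \<sigma>" and K: "K \<in> paths (Cub k) W" and \<omega>: "\<omega> \<in> Hom C I W"
    and e: "K \<cdot> times_I (inc k) = \<omega> \<cdot> pr2 C (Sph k) I"
  obtains N where "N \<in> paths (Sph (k + 1)) W" "N \<cdot> times_I pt = \<omega> \<cdot> pr2 C point I"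
    "N \<cdot> times_I \<sigma> = K"
proof -
  note P' = poleD[OF P]
  have W: "W \<in> Obj C" using Hom_Obj[OF K] by simp
  show ?thesis
    using is_pushoutE[OF pushout_times_I[OF P'(8)] W, of "\<omega> \<cdot> pr2 C point I" K] assms P' that
    by (auto simp: Hom_def)
qed

text \<open>\<open>null k W D x\<close>: the map \<open>D\<close> contracts to a point through maps that are constant on the
  boundary, where they trace out a path starting at \<open>x\<close>.\<close>

definition null :: "nat \<Rightarrow> 'o \<Rightarrow> 'm \<Rightarrow> 'm \<Rightarrow> 'm \<Rightarrow> bool" where
  "null k W D x w \<longleftrightarrow> (\<exists>K\<in>paths (Cub k) W. \<exists>\<omega>\<in>Hom C I W. w \<in> Hom C point W \<and>
     K \<cdot> cyl_at 0 (Cub k) = D \<and> K \<cdot> cyl_at 1 (Cub k) = w \<cdot> to_pt (Cub k) \<and>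
     K \<cdot> times_I (inc k) = \<omega> \<cdot> pr2 C (Sph k) I \<and> \<omega> \<cdot> cst 0 point = x \<and> \<omega> \<cdot> cst 1 point = w)"

lemma nullE:
  assumes "null k W D x w"
  obtains K \<omega> where "K \<in> Arr C" "Dom C K = prod_obj C (Cub k) I" "Cod C K = W"
    "\<omega> \<in> Arr C" "Dom C \<omega> = I" "Cod C \<omega> = W" "w \<in> Arr C" "Dom C w = point" "Cod C w = W"
    "K \<cdot> cyl_at 0 (Cub k) = D" "K \<cdot> cyl_at 1 (Cub k) = w \<cdot> to_pt (Cub k)"
    "K \<cdot> times_I (inc k) = \<omega> \<cdot> pr2 C (Sph k) I" "\<omega> \<cdot> cst 0 point = x" "\<omega> \<cdot> cst 1 point = w"
  using assms unfolding null_def Hom_def by blast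

text \<open>Moving the sphere along the rays to the center contracts the loop, and the ray through
  \<open>pt\<close> is the track of its base point.\<close>

lemma null_of_extension:
  assumes P: "pole k pt \<sigma>" and R: "polar (k + 1) c \<rho>" and v: "v \<in> Hom C (Cub (k + 1)) W"
  shows "null k W (v \<cdot> inc (k + 1) \<cdot> \<sigma>) (v \<cdot> inc (k + 1) \<cdot> pt) (v \<cdot> c)"
proof -
  note P' = poleD[OF P] and R' = polarD[OF R]
  note v' = HomD[OF v]
  let ?K = "(v \<cdot> \<rho>) \<cdot> times_I \<sigma>" and ?\<omega> = "v \<cdot> \<rho> \<cdot> pairing C (pt \<cdot> to_pt I) (Ide C I)"
  have 0: "?K \<cdot> cyl_at 0 (Cub k) = v \<cdot> (\<rho> \<cdot> cyl_at 0 (Sph (k + 1))) \<cdot> \<sigma>"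
    "?\<omega> \<cdot> cst 0 point = v \<cdot> (\<rho> \<cdot> cyl_at 0 (Sph (k + 1))) \<cdot> pt"
    using v' P'(1-6) R'(1-6) by simp_all
  have 1: "?K \<cdot> cyl_at 1 (Cub k) = v \<cdot> (\<rho> \<cdot> cyl_at 1 (Sph (k + 1))) \<cdot> \<sigma>"
    "?\<omega> \<cdot> cst 1 point = v \<cdot> (\<rho> \<cdot> cyl_at 1 (Sph (k + 1))) \<cdot> pt"
    using v' P'(1-6) R'(1-6) by simp_all
  have "?K \<cdot> times_I (inc k) = v \<cdot> \<rho> \<cdot> times_I (\<sigma> \<cdot> inc k)"
    using v' P'(1-6) R'(1-6) by simp
  also have "\<dots> = ?\<omega> \<cdot> pr2 C (Sph k) I"
    unfolding P'(7) using v' P'(1-6) R'(1-6) by simp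
  finally have i: "?K \<cdot> times_I (inc k) = ?\<omega> \<cdot> pr2 C (Sph k) I" .
  have e: "?K \<cdot> cyl_at 0 (Cub k) = v \<cdot> inc (k + 1) \<cdot> \<sigma>" "?\<omega> \<cdot> cst 0 point = v \<cdot> inc (k + 1) \<cdot> pt"
    "?K \<cdot> cyl_at 1 (Cub k) = (v \<cdot> c) \<cdot> to_pt (Cub k)" "?\<omega> \<cdot> cst 1 point = v \<cdot> c"
    unfolding 0 1 R'(7,8) using v' P'(1-6) R'(1-3) by simp_all
  have m: "?K \<in> paths (Cub k) W" "?\<omega> \<in> Hom C I W" "v \<cdot> c \<in> Hom C point W"
    using v' P'(1-6) R'(1-6) by (simp_all add: Hom_def)
  show ?thesis
    unfolding null_def by (intro bexI[of _ ?K] bexI[of _ ?\<omega>] conjI) (fact e i m)+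
qed

text \<open>The contraction and the track of the base point glue to a homotopy on the sphere,
  because the cylinder on the second pushout of (Q8) is a pushout. It ends in a constant map, so it
  is the polar form of a map on the cube.\<close>

lemma extension_of_null:
  assumes P: "pole k pt \<sigma>" and R: "polar (k + 1) c \<rho>" and u: "u \<in> Hom C (Sph (k + 1)) W"
    and n: "null k W (u \<cdot> \<sigma>) (u \<cdot> pt) w"
  obtains h where "h \<in> Hom C (Cub (k + 1)) W" "h \<cdot> inc (k + 1) = u" "h \<cdot> c = w"
proof -
  note P' = poleD[OF P] and R' = polarD[OF R]
  obtain K \<omega> where K: "K \<in> Arr C" "Dom C K = prod_obj C (Cub k) I" "Cod C K = W"
    "\<omega> \<in> Arr C" "Dom C \<omega> = I" "Cod C \<omega> = W" "w \<in> Arr C" "Dom C w = point" "Cod C w = W"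
    "K \<cdot> cyl_at 0 (Cub k) = u \<cdot> \<sigma>" "K \<cdot> cyl_at 1 (Cub k) = w \<cdot> to_pt (Cub k)"
    "K \<cdot> times_I (inc k) = \<omega> \<cdot> pr2 C (Sph k) I" "\<omega> \<cdot> cst 0 point = u \<cdot> pt" "\<omega> \<cdot> cst 1 point = w"
    by (rule nullE[OF n])
  obtain N where N: "N \<in> paths (Sph (k + 1)) W" "N \<cdot> times_I pt = \<omega> \<cdot> pr2 C point I"
    "N \<cdot> times_I \<sigma> = K"
    by (rule pole_extend_homotopy[OF P _ _ K(12)]) (use K in \<open>auto simp: Hom_def\<close>)
  note N' = HomD[OF N(1)]
  have ends: "(N \<cdot> cyl_at l (Sph (k + 1))) \<cdot> pt = \<omega> \<cdot> cst l point"
    "(N \<cdot> cyl_at l (Sph (k + 1))) \<cdot> \<sigma> = K \<cdot> cyl_at l (Cub k)" if "0 \<le> l" "l \<le> 1" for l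
  proof -
    have "(N \<cdot> cyl_at l (Sph (k + 1))) \<cdot> pt = (N \<cdot> times_I pt) \<cdot> cyl_at l point"
      "(N \<cdot> cyl_at l (Sph (k + 1))) \<cdot> \<sigma> = (N \<cdot> times_I \<sigma>) \<cdot> cyl_at l (Cub k)"
      using N' P'(1-6) that by simp_all
    then show "(N \<cdot> cyl_at l (Sph (k + 1))) \<cdot> pt = \<omega> \<cdot> cst l point"
      "(N \<cdot> cyl_at l (Sph (k + 1))) \<cdot> \<sigma> = K \<cdot> cyl_at l (Cub k)"
      unfolding N(2,3) using K(1-9) that by simp_all
  qed
  have N0: "N \<cdot> cyl_at 0 (Sph (k + 1)) = u"
    by (rule pole_eqI[OF P _ u]) (use ends[of 0] N' K in \<open>simp_all add: Hom_def\<close>)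
  have N1: "N \<cdot> cyl_at 1 (Sph (k + 1)) = w \<cdot> to_pt (Sph (k + 1))"
    by (rule pole_eqI[OF P, where W = W]) (use ends[of 1] N' K P' in \<open>simp_all add: Hom_def\<close>)
  obtain h where h: "h \<in> Hom C (Cub (k + 1)) W" "h \<cdot> c = w" "h \<cdot> \<rho> = N"
    by (rule polar_extend[OF R N(1) _ N1]) (use K in \<open>auto simp: Hom_def\<close>)
  have "h \<cdot> inc (k + 1) = (h \<cdot> \<rho>) \<cdot> cyl_at 0 (Sph (k + 1))"
    unfolding R'(7)[symmetric] using h(1) R'(1-6) by (simp add: Hom_def)
  then have "h \<cdot> inc (k + 1) = u" unfolding h(3) N0 .
  with h show ?thesis by (intro that)
qed

lemma loopsD:
  assumes "\<alpha> \<in> loops C \<iota> k X x"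
  shows "\<alpha> \<in> Arr C" "Dom C \<alpha> = Cub k" "Cod C \<alpha> = X" "\<alpha> \<cdot> inc k = x \<cdot> to_pt (Sph k)"
  using assms by (auto simp: loops_def const_map_def Hom_def)

lemma loopsI:
  "\<alpha> \<in> Hom C (Cub k) X \<Longrightarrow> \<alpha> \<cdot> inc k = x \<cdot> to_pt (Sph k) \<Longrightarrow> \<alpha> \<in> loops C \<iota> k X x"
  by (simp add: loops_def const_map_def)

text \<open>By (S4) a product with the empty object is initial again. This settles boundary
  conditions on homotopies in degree 0.\<close>

lemma Sph_0_cyl_eq:
  assumes "f \<in> Hom C (prod_obj C (Sph 0) Z) X" "g \<in> Hom C (prod_obj C (Sph 0) Z) X" "Z \<in> Obj C"
  shows "f = g"
proof -
  have "isomorphic C (prod_obj C (Sph 0) Z) (Sph 0)" "is_initial C (Sph 0)"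
    using Q assms(3) by (auto simp: Q_structure_def category_with_intervals_def)
  then obtain s t where s: "s \<in> Hom C (prod_obj C (Sph 0) Z) (Sph 0)" "t \<in> Hom C (Sph 0) (prod_obj C (Sph 0) Z)"
    "t \<cdot> s = Ide C (prod_obj C (Sph 0) Z)" and i: "\<And>h h'. h \<in> Hom C (Sph 0) X \<Longrightarrow> h' \<in> Hom C (Sph 0) X \<Longrightarrow> h = h'"
    unfolding isomorphic_def is_initial_def using Hom_Obj[OF assms(1)] by blast
  have "f \<cdot> t = g \<cdot> t" by (rule i) (use assms s in \<open>auto simp: Hom_def\<close>)
  then have "(f \<cdot> t) \<cdot> s = (g \<cdot> t) \<cdot> s" by simp
  then show ?thesis using assms s by (simp add: Hom_def)
qed

lemma Sph_0_eq:
  assumes "f \<in> Hom C (Sph 0) X" "g \<in> Hom C (Sph 0) X"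
  shows "f = g"
proof -
  have "is_initial C (Sph 0)"
    using Q by (auto simp: Q_structure_def category_with_intervals_def)
  then show ?thesis unfolding is_initial_def using Hom_Obj[OF assms(1)] assms by blast
qed

lemma null_of_homotopic_const:
  assumes "homotopic k D (x \<cdot> to_pt (Cub k))" "D \<in> loops C \<iota> k W x" "x \<in> Hom C point W"
  shows "null k W D x x"
proof -
  note D = loopsD[OF assms(2)]
  obtain H where H: "H \<in> paths (Cub k) W" "D = H \<cdot> cyl_at 0 (Cub k)" "x \<cdot> to_pt (Cub k) = H \<cdot> cyl_at 1 (Cub k)"
    "H \<cdot> times_I (inc k) = D \<cdot> inc k \<cdot> pr1 C (Sph k) I"
    by (rule homotopic_relE[OF assms(1), of "Cub k" W "Sph k"]) (use D in \<open>auto simp: Hom_def\<close>)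
  have "H \<cdot> times_I (inc k) = (x \<cdot> to_pt I) \<cdot> pr2 C (Sph k) I"
    unfolding H(4) D(4) using assms(3) by (simp add: Hom_def)
  then show ?thesis
    unfolding null_def using H(1,2,3) assms(3)
    by (intro bexI[of _ H] bexI[of _ "x \<cdot> to_pt I"]) (simp_all add: Hom_def)
qed

text \<open>The passage from a travelling base point to a fixed one. For \<open>k \<ge> 1\<close> it
  is \<open>path_eq_null\<close> in polar coordinates, applied to the square swept out along the
  rays.\<close>

lemma homotopic_const_of_null:
  assumes n: "null k W D x w" and D: "D \<in> loops C \<iota> k W x" and x: "x \<in> Hom C point W"
  shows "homotopic k D (x \<cdot> to_pt (Cub k))"
proof -
  note D' = loopsD[OF D]
  obtain K \<omega> where K: "K \<in> Arr C" "Dom C K = prod_obj C (Cub k) I" "Cod C K = W"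
    "\<omega> \<in> Arr C" "Dom C \<omega> = I" "Cod C \<omega> = W" "w \<in> Arr C" "Dom C w = point" "Cod C w = W"
    "K \<cdot> cyl_at 0 (Cub k) = D" "K \<cdot> cyl_at 1 (Cub k) = w \<cdot> to_pt (Cub k)"
    "K \<cdot> times_I (inc k) = \<omega> \<cdot> pr2 C (Sph k) I" "\<omega> \<cdot> cst 0 point = x" "\<omega> \<cdot> cst 1 point = w"
    by (rule nullE[OF n])
  show ?thesis
  proof (cases "k = 0")
    case True
    \<comment> \<open>In degree 0 there is no boundary to respect: the contraction leads to
      \<open>w\<close>, and the reversed track leads from \<open>w\<close> back to
      \<open>x\<close>.\<close>
    let ?g = "rev_path point (\<omega> \<cdot> pr2 C point I)"
    have g: "?g \<in> paths point W" "?g \<cdot> cyl_at 0 point = w" "?g \<cdot> cyl_at 1 point = x"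
      using K by (simp_all add: Hom_def)
    have h: "K \<in> paths point W" "K \<cdot> cyl_at 0 point = D" "K \<cdot> cyl_at 1 point = ?g \<cdot> cyl_at 0 point"
      using K True unfolding g(2) by (simp_all add: Hom_def)
    have o: "point \<in> Obj C" by simp
    note c = join_props(1)[OF o h(1) g(1) h(3)] join_ends[OF o h(1) g(1) h(3)]
    have "homotopic 0 D x"
    proof (rule homotopic_relI[OF c(1)])
      show "join point K ?g \<cdot> times_I (inc 0) = D \<cdot> inc 0 \<cdot> pr1 C (Sph 0) I"
        by (rule Sph_0_cyl_eq[of _ I W]) (use c(1) D' True x in \<open>auto simp: Hom_def\<close>)
    qed (use c h g in \<open>auto simp: Hom_def\<close>)
    then show ?thesis using True x by (simp add: Hom_def)
  next
    case False
    then have k: "k \<ge> 1" by simp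
    obtain c \<rho> where P: "polar k c \<rho>" using polar_exists[OF k] by blast
    note P' = polarD[OF P]
    obtain p where p: "p \<in> Hom C point (Sph k)" using Sph_point[OF k] .
    let ?r = "(K \<cdot> pairing C (c \<cdot> to_pt I) (Ide C I)) \<cdot> pr2 C (Sph k) I"
    have s: "square (Sph k) W (D \<cdot> \<rho>) (w \<cdot> to_pt (Sph k) \<cdot> pr1 C (Sph k) I) (\<omega> \<cdot> pr2 C (Sph k) I) ?r"
    proof (rule squareI[of _ "K \<cdot> times_I \<rho>"])
      show "D \<cdot> \<rho> = K \<cdot> times_I \<rho> \<cdot> cyl_at 0 (prod_obj C (Sph k) I)"
        unfolding K(10)[symmetric] using K(1-9) P'(1-6) by simp
      have "K \<cdot> times_I \<rho> \<cdot> cyl_at 1 (prod_obj C (Sph k) I) = (K \<cdot> cyl_at 1 (Cub k)) \<cdot> \<rho>"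
        using K(1-9) P'(1-6) by simp
      then show "w \<cdot> to_pt (Sph k) \<cdot> pr1 C (Sph k) I = K \<cdot> times_I \<rho> \<cdot> cyl_at 1 (prod_obj C (Sph k) I)"
        unfolding K(11) using K(1-9) P'(1-6) by simp
      have "K \<cdot> times_I \<rho> \<cdot> times_I (cyl_at 0 (Sph k)) = K \<cdot> times_I (\<rho> \<cdot> cyl_at 0 (Sph k))"
        using K(1-9) P'(1-6) by simp
      then show "\<omega> \<cdot> pr2 C (Sph k) I = K \<cdot> times_I \<rho> \<cdot> times_I (cyl_at 0 (Sph k))"
        unfolding P'(7) using K(12) by simp
      have "(K \<cdot> times_I \<rho>) \<cdot> times_I (cyl_at 1 (Sph k)) = K \<cdot> times_I (\<rho> \<cdot> cyl_at 1 (Sph k))"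
        using K(1-9) P'(1-6) by simp
      also have "\<dots> = ?r"
        unfolding P'(8) using K(1-9) P'(1-6) by simp
      finally show "?r = K \<cdot> times_I \<rho> \<cdot> times_I (cyl_at 1 (Sph k))" by simp
    qed (use K(1-9) P' in \<open>auto simp: Hom_def\<close>)
    have "path_eq (Sph k) W (D \<cdot> \<rho>) ((D \<cdot> \<rho>) \<cdot> cyl_at 0 (Sph k) \<cdot> pr1 C (Sph k) I)"
    proof (rule path_eq_null[OF p s])
      show "along_I (Sph k) W (\<omega> \<cdot> pr2 C (Sph k) I)"
        unfolding along_I_def using K by (auto simp: Hom_def)
      show "along_I (Sph k) W ?r"
        unfolding along_I_def
        by (rule bexI[of _ "K \<cdot> pairing C (c \<cdot> to_pt I) (Ide C I)"])
          (use K P' in \<open>simp_all add: Hom_def\<close>)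
      have "(D \<cdot> \<rho>) \<cdot> cyl_at 1 (Sph k) = D \<cdot> (\<rho> \<cdot> cyl_at 1 (Sph k))" using D'(1-3) P'(1-6) by simp
      then show "(D \<cdot> \<rho>) \<cdot> cyl_at 1 (Sph k) = (D \<cdot> c) \<cdot> to_pt (Sph k)"
        unfolding P'(8) using D'(1-3) P'(1-3) by simp
    qed (use K D' P' in \<open>auto simp: Hom_def\<close>)
    moreover have "(D \<cdot> \<rho>) \<cdot> cyl_at 0 (Sph k) \<cdot> pr1 C (Sph k) I = (D \<cdot> (\<rho> \<cdot> cyl_at 0 (Sph k))) \<cdot> pr1 C (Sph k) I"
      using D'(1-3) P'(1-6) by simp
    moreover have "\<dots> = (x \<cdot> to_pt (Cub k)) \<cdot> \<rho>"
      unfolding P'(7) D'(4) using x P'(1-6) by (simp add: Hom_def)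
    ultimately show ?thesis
      by (subst homotopic_rel_polar[OF P k, of _ W]) (use D' x in \<open>auto simp: Hom_def\<close>)
  qed
qed

text \<open>The loop becomes a map \<open>u\<close> on the sphere. A contraction of its image
  extends \<open>f \<cdot> u\<close> over the cube, compressing that extension extends
  \<open>u\<close> as well, and an extension of \<open>u\<close> contracts the loop.\<close>

lemma compressible_null:
  assumes f: "f \<in> Hom C X Y" and c: "compressible C \<iota> (k + 1) f" and x: "x \<in> Hom C point X"
    and D: "D \<in> loops C \<iota> k X x"
    and h: "homotopic k (f \<cdot> D) ((f \<cdot> x) \<cdot> to_pt (Cub k))"
  shows "homotopic k D (x \<cdot> to_pt (Cub k))"
proof -
  obtain pt \<sigma> where P: "pole k pt \<sigma>" using pole_exists by blast
  obtain c \<rho> where R: "polar (k + 1) c \<rho>" using polar_exists[of "k + 1"] by auto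
  note P' = poleD[OF P] and D' = loopsD[OF D]
  note f' = HomD[OF f]
  note x' = HomD[OF x]
  obtain u where u: "u \<in> Hom C (Sph (k + 1)) X" "u \<cdot> pt = x" "u \<cdot> \<sigma> = D"
    by (rule pole_extend[OF P x _ D'(4)]) (use D' in \<open>auto simp: Hom_def\<close>)
  note u' = HomD[OF u(1)]
  have "(f \<cdot> D) \<cdot> inc k = f \<cdot> x \<cdot> to_pt (Sph k)" using D' f' x' by simp
  then have "f \<cdot> D \<in> loops C \<iota> k Y (f \<cdot> x)"
    by (intro loopsI) (use f' D' x' in \<open>auto simp: Hom_def\<close>)
  from null_of_homotopic_const[OF h this] f' x'
  have "null k Y (f \<cdot> D) (f \<cdot> x) (f \<cdot> x)" by (simp add: Hom_def)
  then have n: "null k Y ((f \<cdot> u) \<cdot> \<sigma>) ((f \<cdot> u) \<cdot> pt) (f \<cdot> x)"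
    using u f' u' P' by simp
  have fu: "f \<cdot> u \<in> Hom C (Sph (k + 1)) Y" using f' u' by (simp add: Hom_def)
  obtain v where v: "v \<in> Hom C (Cub (k + 1)) Y" "v \<cdot> inc (k + 1) = f \<cdot> u"
    by (rule extension_of_null[OF P R fu n])
  obtain h where "h \<in> Hom C (Cub (k + 1)) X" "h \<cdot> inc (k + 1) = u"
    using c u v f' unfolding compressible_def by metis
  with null_of_extension[OF P R, of h X] u' u P' have "null k X D x (h \<cdot> c)"
    by (simp add: Hom_def flip: comp_assoc)
  from homotopic_const_of_null[OF this D x] show ?thesis .
qed

section \<open>Difference loops and their action\<close>

lemma polar_path:
  assumes P: "polar k c \<rho>" and h: "h \<in> Hom C (Cub k) W"
  shows "h \<cdot> \<rho> \<in> paths (Sph k) W" "(h \<cdot> \<rho>) \<cdot> cyl_at 0 (Sph k) = h \<cdot> inc k"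
    "(h \<cdot> \<rho>) \<cdot> cyl_at 1 (Sph k) = (h \<cdot> c) \<cdot> to_pt (Sph k)" "h \<cdot> c \<in> Hom C point W"
    "rev_path (Sph k) (h \<cdot> \<rho>) \<in> paths (Sph k) W"
    "rev_path (Sph k) (h \<cdot> \<rho>) \<cdot> cyl_at 0 (Sph k) = (h \<cdot> c) \<cdot> to_pt (Sph k)"
    "rev_path (Sph k) (h \<cdot> \<rho>) \<cdot> cyl_at 1 (Sph k) = h \<cdot> inc k"
proof -
  note P' = polarD[OF P]
  note h' = HomD[OF h]
  have a: "(h \<cdot> \<rho>) \<cdot> cyl_at l (Sph k) = h \<cdot> (\<rho> \<cdot> cyl_at l (Sph k))" if "0 \<le> l" "l \<le> 1" for l
    using h' P'(1-6) that by simp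
  show 0: "(h \<cdot> \<rho>) \<cdot> cyl_at 0 (Sph k) = h \<cdot> inc k"
    "(h \<cdot> \<rho>) \<cdot> cyl_at 1 (Sph k) = (h \<cdot> c) \<cdot> to_pt (Sph k)"
    using a[of 0] a[of 1] h' P' by simp_all
  show 1: "h \<cdot> \<rho> \<in> paths (Sph k) W" "h \<cdot> c \<in> Hom C point W" "rev_path (Sph k) (h \<cdot> \<rho>) \<in> paths (Sph k) W"
    using h' P' by (auto simp: Hom_def)
  have "rev_path (Sph k) (h \<cdot> \<rho>) \<cdot> cyl_at l (Sph k) = (h \<cdot> \<rho>) \<cdot> cyl_at (1 - l) (Sph k)"
    if "0 \<le> l" "l \<le> 1" for l
    using 1(1) that by (intro reparam_end) (auto simp: Hom_def)
  from this[of 0] this[of 1] show "rev_path (Sph k) (h \<cdot> \<rho>) \<cdot> cyl_at 0 (Sph k) = (h \<cdot> c) \<cdot> to_pt (Sph k)"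
    "rev_path (Sph k) (h \<cdot> \<rho>) \<cdot> cyl_at 1 (Sph k) = h \<cdot> inc k" using 0 by simp_all
qed

text \<open>\<open>difference k \<rho> W h v d\<close>: the two maps \<open>h\<close> and \<open>v\<close>, which agree on the boundary, are glued to a
  loop at the center of \<open>h\<close>.\<close>

definition difference :: "nat \<Rightarrow> 'm \<Rightarrow> 'o \<Rightarrow> 'm \<Rightarrow> 'm \<Rightarrow> 'm \<Rightarrow> bool" where
  "difference k \<rho> W h v d \<longleftrightarrow> h \<in> Hom C (Cub k) W \<and> v \<in> Hom C (Cub k) W \<and> d \<in> Hom C (Cub k) W \<and>
     h \<cdot> inc k = v \<cdot> inc k \<and> d \<cdot> \<rho> = join (Sph k) (rev_path (Sph k) (h \<cdot> \<rho>)) (v \<cdot> \<rho>)"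

text \<open>The glued path starts at the center of \<open>h\<close> and ends, like \<open>v\<close>,
  in a constant map, so it is the polar form of a map on the cube.\<close>

lemma difference_exists:
  assumes P: "polar k c \<rho>" and h: "h \<in> Hom C (Cub k) W" and v: "v \<in> Hom C (Cub k) W"
    and e: "h \<cdot> inc k = v \<cdot> inc k"
  obtains d where "difference k \<rho> W h v d"
proof -
  note ph = polar_path[OF P h] and pv = polar_path[OF P v]
  have S: "Sph k \<in> Obj C" by simp
  have e': "rev_path (Sph k) (h \<cdot> \<rho>) \<cdot> cyl_at 1 (Sph k) = (v \<cdot> \<rho>) \<cdot> cyl_at 0 (Sph k)"
    unfolding ph(7) pv(2) e ..
  note c = join_props(1)[OF S ph(5) pv(1) e'] join_ends[OF S ph(5) pv(1) e', unfolded pv(3)]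
  obtain d where "d \<in> Hom C (Cub k) W" "d \<cdot> \<rho> = join (Sph k) (rev_path (Sph k) (h \<cdot> \<rho>)) (v \<cdot> \<rho>)"
    by (rule polar_extend[OF P c(1) pv(4) c(3)])
  then show ?thesis using that h v e by (simp add: difference_def)
qed

lemma difference_loop:
  assumes P: "polar k c \<rho>" and d: "difference k \<rho> W h v d"
  shows "d \<in> loops C \<iota> k W (h \<cdot> c)"
proof -
  have D: "h \<in> Hom C (Cub k) W" "v \<in> Hom C (Cub k) W" "d \<in> Hom C (Cub k) W" "h \<cdot> inc k = v \<cdot> inc k"
    "d \<cdot> \<rho> = join (Sph k) (rev_path (Sph k) (h \<cdot> \<rho>)) (v \<cdot> \<rho>)"
    using d by (auto simp: difference_def)
  note ph = polar_path[OF P D(1)] and pv = polar_path[OF P D(2)] and pd = polar_path[OF P D(3)]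
  have S: "Sph k \<in> Obj C" by simp
  have e': "rev_path (Sph k) (h \<cdot> \<rho>) \<cdot> cyl_at 1 (Sph k) = (v \<cdot> \<rho>) \<cdot> cyl_at 0 (Sph k)"
    unfolding ph(7) pv(2) D(4) ..
  have "d \<cdot> inc k = (h \<cdot> c) \<cdot> to_pt (Sph k)"
    using join_ends(1)[OF S ph(5) pv(1) e'] pd(2) unfolding D(5) ph(6) by simp
  then show ?thesis by (intro loopsI D)
qed

lemma difference_comp:
  assumes P: "polar k c \<rho>" and d: "difference k \<rho> W h v d" and f: "f \<in> Hom C W V"
  shows "difference k \<rho> V (f \<cdot> h) (f \<cdot> v) (f \<cdot> d)"
proof -
  have D: "h \<in> Hom C (Cub k) W" "v \<in> Hom C (Cub k) W" "d \<in> Hom C (Cub k) W" "h \<cdot> inc k = v \<cdot> inc k"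
    "d \<cdot> \<rho> = join (Sph k) (rev_path (Sph k) (h \<cdot> \<rho>)) (v \<cdot> \<rho>)"
    using d by (auto simp: difference_def)
  note ph = polar_path[OF P D(1)] and pv = polar_path[OF P D(2)] and P' = polarD[OF P]
  have S: "Sph k \<in> Obj C" by simp
  have e': "rev_path (Sph k) (h \<cdot> \<rho>) \<cdot> cyl_at 1 (Sph k) = (v \<cdot> \<rho>) \<cdot> cyl_at 0 (Sph k)"
    unfolding ph(7) pv(2) D(4) ..
  have F: "f \<in> Arr C" "Dom C f = W" "Cod C f = V" "h \<in> Arr C" "Dom C h = Cub k" "Cod C h = W"
     "v \<in> Arr C" "Dom C v = Cub k" "Cod C v = W" "d \<in> Arr C" "Dom C d = Cub k" "Cod C d = W"
    using f D by (auto simp: Hom_def)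
  have "f \<cdot> rev_path (Sph k) (h \<cdot> \<rho>) = rev_path (Sph k) ((f \<cdot> h) \<cdot> \<rho>)"
    using F P' by (simp add: reparam_def)
  moreover have "f \<cdot> (v \<cdot> \<rho>) = (f \<cdot> v) \<cdot> \<rho>" "(f \<cdot> d) \<cdot> \<rho> = f \<cdot> (d \<cdot> \<rho>)" using F P' by simp_all
  ultimately show ?thesis
    using join_comp[OF S ph(5) pv(1) e' f] F D(4,5) by (simp add: difference_def Hom_def)
qed

text \<open>Replacing \<open>v\<close> by \<open>h\<close> in the second factor leaves a reversed
  path followed by the path itself, which contracts to the center of \<open>h\<close>.\<close>

lemma difference_homotopic:
  assumes P: "polar k c \<rho>" and k: "k \<ge> 1" and d: "difference k \<rho> W h v d"
    and hv: "homotopic k h v"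
  shows "homotopic k d ((h \<cdot> c) \<cdot> to_pt (Cub k))"
proof -
  have D: "h \<in> Hom C (Cub k) W" "v \<in> Hom C (Cub k) W" "d \<in> Hom C (Cub k) W" "h \<cdot> inc k = v \<cdot> inc k"
    "d \<cdot> \<rho> = join (Sph k) (rev_path (Sph k) (h \<cdot> \<rho>)) (v \<cdot> \<rho>)"
    using d by (auto simp: difference_def)
  note ph = polar_path[OF P D(1)] and pv = polar_path[OF P D(2)] and P' = polarD[OF P]
  have S: "Sph k \<in> Obj C" by simp
  obtain p where p: "p \<in> Hom C point (Sph k)" using Sph_point[OF k] .
  have "path_eq (Sph k) W (v \<cdot> \<rho>) (h \<cdot> \<rho>)"
    using hv homotopic_rel_polar[OF P k D(1,2)] path_eq_sym by simp
  then have 1: "path_eq (Sph k) W (d \<cdot> \<rho>) (join (Sph k) (rev_path (Sph k) (h \<cdot> \<rho>)) (h \<cdot> \<rho>))"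
    unfolding D(5) by (rule path_eq_join_left[OF _ ph(5)]) (simp only: ph pv D(4))
  have 2: "path_eq (Sph k) W (join (Sph k) (rev_path (Sph k) (h \<cdot> \<rho>)) (h \<cdot> \<rho>)) ((h \<cdot> \<rho>) \<cdot> cyl_at 1 (Sph k) \<cdot> pr1 C (Sph k) I)"
    by (rule path_eq_join_rev[OF ph(1,3,4) S])
  have "(h \<cdot> \<rho>) \<cdot> cyl_at 1 (Sph k) \<cdot> pr1 C (Sph k) I = ((h \<cdot> c) \<cdot> to_pt (Cub k)) \<cdot> \<rho>"
    unfolding ph(3) using P'(1-6) ph(4) by (simp add: Hom_def)
  moreover have "(h \<cdot> c) \<cdot> to_pt (Cub k) \<in> Hom C (Cub k) W"
    using ph(4) by (simp add: Hom_def)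
  ultimately show ?thesis
    using path_eq_trans[OF 1 2 p] homotopic_rel_polar[OF P k D(3)] by simp
qed

text \<open>This is the action \<open>h # w\<close>: each ray follows \<open>h\<close> to its center
  and continues along \<open>w\<close>, whose boundary value is that center.\<close>

lemma act_exists:
  assumes P: "polar k c \<rho>" and h: "h \<in> Hom C (Cub k) W" and w: "w \<in> loops C \<iota> k W (h \<cdot> c)"
  obtains h' where "h' \<in> Hom C (Cub k) W" "h' \<cdot> inc k = h \<cdot> inc k" "h' \<cdot> \<rho> = join (Sph k) (h \<cdot> \<rho>) (w \<cdot> \<rho>)"
    "(h \<cdot> \<rho>) \<cdot> cyl_at 1 (Sph k) = (w \<cdot> \<rho>) \<cdot> cyl_at 0 (Sph k)"
proof -
  have w': "w \<in> Hom C (Cub k) W" using loopsD[OF w] by (simp add: Hom_def)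
  note ph = polar_path[OF P h] and pw = polar_path[OF P w']
  have S: "Sph k \<in> Obj C" by simp
  have e: "(h \<cdot> \<rho>) \<cdot> cyl_at 1 (Sph k) = (w \<cdot> \<rho>) \<cdot> cyl_at 0 (Sph k)"
    unfolding ph(3) pw(2) loopsD(4)[OF w] ..
  note c = join_props(1)[OF S ph(1) pw(1) e] join_ends[OF S ph(1) pw(1) e]
  obtain h' where h': "h' \<in> Hom C (Cub k) W" "h' \<cdot> \<rho> = join (Sph k) (h \<cdot> \<rho>) (w \<cdot> \<rho>)"
    by (rule polar_extend[OF P c(1) pw(4)]) (simp_all add: c(3) pw(3) del: pairing_comp)
  moreover have "h' \<cdot> inc k = h \<cdot> inc k"
    using polar_path(2)[OF P h'(1)] unfolding h'(2) c(2) ph(2) by simp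
  ultimately show ?thesis using e that by blast
qed

text \<open>In polar coordinates \<open>f \<cdot> h'\<close> is \<open>f \<cdot> h\<close> followed
  by \<open>f \<cdot> w\<close>. Replacing the latter by \<open>d\<close> gives
  \<open>f \<cdot> h\<close>, its reverse, and \<open>v\<close>, so the cancellation law
  applies.\<close>

lemma act_difference:
  assumes P: "polar k c \<rho>" and k: "k \<ge> 1" and f: "f \<in> Hom C X Y"
    and h: "h \<in> Hom C (Cub k) X" and d: "difference k \<rho> Y (f \<cdot> h) v d"
    and w: "w \<in> loops C \<iota> k X (h \<cdot> c)" and wd: "homotopic k (f \<cdot> w) d"
  obtains h' where "h' \<in> Hom C (Cub k) X" "h' \<cdot> inc k = h \<cdot> inc k"
    "h' \<cdot> \<rho> = join (Sph k) (h \<cdot> \<rho>) (w \<cdot> \<rho>)" "homotopic k (f \<cdot> h') v"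
proof -
  have D: "v \<in> Hom C (Cub k) Y" "d \<in> Hom C (Cub k) Y" "(f \<cdot> h) \<cdot> inc k = v \<cdot> inc k"
    "d \<cdot> \<rho> = join (Sph k) (rev_path (Sph k) ((f \<cdot> h) \<cdot> \<rho>)) (v \<cdot> \<rho>)"
    using d by (auto simp: difference_def)
  have w': "w \<in> Hom C (Cub k) X" using loopsD[OF w] by (simp add: Hom_def)
  obtain h' where h': "h' \<in> Hom C (Cub k) X" "h' \<cdot> inc k = h \<cdot> inc k" "h' \<cdot> \<rho> = join (Sph k) (h \<cdot> \<rho>) (w \<cdot> \<rho>)"
    "(h \<cdot> \<rho>) \<cdot> cyl_at 1 (Sph k) = (w \<cdot> \<rho>) \<cdot> cyl_at 0 (Sph k)"
    by (rule act_exists[OF P h w])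
  have F: "f \<cdot> h \<in> Hom C (Cub k) Y" "f \<cdot> w \<in> Hom C (Cub k) Y" "f \<cdot> h' \<in> Hom C (Cub k) Y"
    using f h h' w' by (simp_all add: Hom_def)
  have S: "Sph k \<in> Obj C" by simp
  note P' = polarD[OF P]
  note ph = polar_path[OF P h] and pw = polar_path[OF P w'] and pv = polar_path[OF P D(1)]
    and pfh = polar_path[OF P F(1)] and pfw = polar_path[OF P F(2)]
  have a: "(f \<cdot> h') \<cdot> \<rho> = f \<cdot> (h' \<cdot> \<rho>)" "(f \<cdot> h) \<cdot> \<rho> = f \<cdot> (h \<cdot> \<rho>)" "(f \<cdot> w) \<cdot> \<rho> = f \<cdot> (w \<cdot> \<rho>)"
    using f h h' w' P' by (simp_all add: Hom_def)
  have e: "(f \<cdot> h' ) \<cdot> \<rho> = join (Sph k) ((f \<cdot> h) \<cdot> \<rho>) ((f \<cdot> w) \<cdot> \<rho>)"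
    using join_comp[OF S ph(1) pw(1) h'(4) f] unfolding a h'(3) .
  obtain p where p: "p \<in> Hom C point (Sph k)" using Sph_point[OF k] .
  have fw: "(f \<cdot> w) \<cdot> inc k = ((f \<cdot> h) \<cdot> c) \<cdot> to_pt (Sph k)"
    using loopsD[OF w] f h P' by (simp add: Hom_def)
  have "path_eq (Sph k) Y ((f \<cdot> w) \<cdot> \<rho>) (d \<cdot> \<rho>)"
    using wd homotopic_rel_polar[OF P k F(2) D(2)] by simp
  then have 1: "path_eq (Sph k) Y ((f \<cdot> h') \<cdot> \<rho>) (join (Sph k) ((f \<cdot> h) \<cdot> \<rho>) (d \<cdot> \<rho>))"
    unfolding e by (rule path_eq_join_left[OF _ pfh(1)]) (simp only: pfh pfw fw)
  have 2: "path_eq (Sph k) Y (join (Sph k) ((f \<cdot> h) \<cdot> \<rho>) (d \<cdot> \<rho>)) (v \<cdot> \<rho>)"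
    unfolding D(4) by (rule path_eq_join_cancel[OF p pfh(1) pv(1,3,4)]) (simp only: pfh pv D(3))
  have "homotopic k (f \<cdot> h') v"
    using path_eq_trans[OF 1 2 p] homotopic_rel_polar[OF P k F(3) D(1)] by simp
  with h' show ?thesis by (intro that)
qed

text \<open>Acting by the constant loop changes \<open>h\<close> only up to homotopy, by the unit
  law. If that loop is homotopic to the difference, the action also leads to \<open>v\<close>; this
  is \<open>act_difference\<close> for the identity map.\<close>

lemma homotopic_of_difference:
  assumes P: "polar k c \<rho>" and k: "k \<ge> 1" and d: "difference k \<rho> W h v d"
    and dc: "homotopic k d ((h \<cdot> c) \<cdot> to_pt (Cub k))"
  shows "homotopic k h v"
proof -
  let ?w = "(h \<cdot> c) \<cdot> to_pt (Cub k)"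
  have D: "h \<in> Hom C (Cub k) W" "v \<in> Hom C (Cub k) W" "d \<in> Hom C (Cub k) W"
    using d by (auto simp: difference_def)
  note ph = polar_path[OF P D(1)]
  have S: "Sph k \<in> Obj C" and W: "W \<in> Obj C" using Hom_Obj[OF D(1)] by auto
  obtain p where p: "p \<in> Hom C point (Sph k)" using Sph_point[OF k] .
  have w: "?w \<in> Hom C (Cub k) W" "?w \<in> loops C \<iota> k W (h \<cdot> c)"
    using ph(4) by (auto simp: Hom_def intro!: loopsI)
  have i: "Ide C W \<cdot> g = g" if "g \<in> Hom C A W" for A g using that by (auto simp: Hom_def)
  have "path_eq (Sph k) W (?w \<cdot> \<rho>) (d \<cdot> \<rho>)"
    using dc homotopic_rel_polar[OF P k D(3) w(1)] path_eq_sym by simp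
  then have "homotopic k (Ide C W \<cdot> ?w) d"
    unfolding i[OF w(1)] using homotopic_rel_polar[OF P k w(1) D(3)] by simp
  from act_difference[OF P k Ide_Hom[OF W] D(1) _ w(2) this, of v] d
  obtain h' where h': "h' \<in> Hom C (Cub k) W" "h' \<cdot> \<rho> = join (Sph k) (h \<cdot> \<rho>) (?w \<cdot> \<rho>)"
    "homotopic k h' v"
    using i D by metis
  have "?w \<cdot> \<rho> = (h \<cdot> \<rho>) \<cdot> cyl_at 1 (Sph k) \<cdot> pr1 C (Sph k) I"
    unfolding ph(3) using polarD(4-6)[OF P] ph(4) by (simp add: Hom_def)
  then have 1: "path_eq (Sph k) W (h \<cdot> \<rho>) (h' \<cdot> \<rho>)"
    unfolding h'(2) using path_eq_sym[OF path_eq_join_const_right[OF ph(1,3,4) S]] by simp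
  have 2: "path_eq (Sph k) W (h' \<cdot> \<rho>) (v \<cdot> \<rho>)"
    using h'(3) homotopic_rel_polar[OF P k h'(1) D(2)] by simp
  from path_eq_trans[OF 1 2 p] homotopic_rel_polar[OF P k D(1,2)] show ?thesis by simp
qed


section \<open>Products of loops\<close>

lemma tmap_arr_comp:
  assumes "X \<in> Obj Box" "Y \<in> Obj Box" "Z \<in> Obj Box" "continuous_map X Y f" "continuous_map Y Z g"
  shows "AMap \<iota> (tmap Y Z g) \<cdot> AMap \<iota> (tmap X Y f) = AMap \<iota> (tmap X Z (\<lambda>x. g (f x)))"
  using AMap_comp[OF tmap_Box[OF assms(1,2,4)] tmap_Box[OF assms(2,3,5)]]
    tmap_comp_Box[of f X Y Z g] continuous_map_funspace[OF assms(4)] by simp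

definition init :: "nat \<Rightarrow> 'm" where
  "init n = AMap \<iota> (tmap (cube (Suc n)) (cube n) (\<lambda>x. restrict x {..<n}))"

definition final :: "nat \<Rightarrow> 'm" where
  "final n = AMap \<iota> (coord (Suc n) n)"

definition snoc :: "nat \<Rightarrow> 'm \<Rightarrow> 'm \<Rightarrow> 'm" where
  "snoc n g t = tuple (Suc n) (Dom C g) (\<lambda>k. if k < n then AMap \<iota> (coord n k) \<cdot> g else t)"

lemma continuous_map_init: "continuous_map (cube (Suc n)) (cube n) (\<lambda>x. restrict x {..<n})"
  unfolding continuous_map_cube by auto

lemma init_final_simps [simp]:
  "init n \<in> Arr C" "Dom C (init n) = Cub (Suc n)" "Cod C (init n) = Cub n"
  "final n \<in> Arr C" "Dom C (final n) = Cub (Suc n)" "Cod C (final n) = I"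
  unfolding init_def final_def using tmap_arr_simps[OF _ _ continuous_map_init] by simp_all

lemma coord_init:
  assumes "k < n"
  shows "AMap \<iota> (coord n k) \<cdot> init n = AMap \<iota> (coord (Suc n) k)"
  unfolding coord_ifun init_def
  by (subst ifun_arr_comp[OF _ _ _ continuous_map_init]) (use assms in auto)

lemma cube_Suc_eqI:
  assumes "u \<in> Arr C" "v \<in> Arr C" "Dom C u = Dom C v"
    "Cod C u = Cub (Suc n)" "Cod C v = Cub (Suc n)"
    "init n \<cdot> u = init n \<cdot> v" "final n \<cdot> u = final n \<cdot> v"
  shows "u = v"
proof (rule cube_eqI[of "Suc n"])
  fix k assume "k < Suc n"
  show "AMap \<iota> (coord (Suc n) k) \<cdot> u = AMap \<iota> (coord (Suc n) k) \<cdot> v"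
  proof (cases "k < n")
    case True
    then have "AMap \<iota> (coord n k) \<cdot> (init n \<cdot> u) = AMap \<iota> (coord n k) \<cdot> (init n \<cdot> v)" by (simp only: assms(6))
    then show ?thesis using True assms(1-5) by (simp add: coord_init flip: comp_assoc)
  next
    case False
    then have "k = n" using \<open>k < Suc n\<close> by simp
    then show ?thesis using assms(7) by (simp add: final_def)
  qed
qed (use assms in auto)

lemma snoc_simps [simp]:
  assumes "g \<in> Arr C" "t \<in> Arr C" "Dom C g = Dom C t" "Cod C g = Cub n" "Cod C t = I"
  shows "snoc n g t \<in> Arr C" "Dom C (snoc n g t) = Dom C t" "Cod C (snoc n g t) = Cub (Suc n)"
    "init n \<cdot> snoc n g t = g" "final n \<cdot> snoc n g t = t"
proof -
  let ?t = "\<lambda>k. if k < n then AMap \<iota> (coord n k) \<cdot> g else t"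
  have "?t k \<in> Hom C (Dom C g) I" if "k < Suc n" for k
    using assms by (auto simp: Hom_def)
  note T = tuple_props[of "Suc n" "Dom C g" ?t, OF _ _ this, folded snoc_def]
  show 1: "snoc n g t \<in> Arr C" "Dom C (snoc n g t) = Dom C t" "Cod C (snoc n g t) = Cub (Suc n)"
    "final n \<cdot> snoc n g t = t"
    using T(1-3) T(4)[of n] assms by (simp_all add: final_def)
  show "init n \<cdot> snoc n g t = g"
  proof (cases "n = 0")
    \<comment> \<open>(Q7) describes \<open>I\<^sup>n\<close> as a product for
      \<open>n \<ge> 1\<close> only; for \<open>n = 0\<close> terminality takes its place.\<close>
    case True
    then show ?thesis using to_point_eq[of g] to_point_eq[of "init n \<cdot> snoc n g t"] 1 assms by simp
  next
    case False
    show ?thesis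
    proof (rule cube_eqI[of n])
      fix k assume k: "k < n"
      have "AMap \<iota> (coord n k) \<cdot> (init n \<cdot> snoc n g t) = (AMap \<iota> (coord n k) \<cdot> init n) \<cdot> snoc n g t"
        using 1 k by simp
      also have "\<dots> = AMap \<iota> (coord n k) \<cdot> g"
        unfolding coord_init[OF k] using T(4)[of k] k assms by simp
      finally show "AMap \<iota> (coord n k) \<cdot> (init n \<cdot> snoc n g t) = AMap \<iota> (coord n k) \<cdot> g" .
    qed (use False 1 assms in auto)
  qed
qed

lemma snoc_comp [simp]:
  assumes "g \<in> Arr C" "t \<in> Arr C" "Dom C g = Dom C t" "Cod C g = Cub n" "Cod C t = I"
    "h \<in> Arr C" "Cod C h = Dom C t"
  shows "snoc n g t \<cdot> h = snoc n (g \<cdot> h) (t \<cdot> h)"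
  by (rule cube_Suc_eqI[of _ _ n]) (use assms in \<open>simp_all flip: comp_assoc\<close>)

lemma snoc_eta [simp]:
  assumes "h \<in> Arr C" "Cod C h = Cub (Suc n)"
  shows "snoc n (init n \<cdot> h) (final n \<cdot> h) = h"
  by (rule cube_Suc_eqI[of _ _ n]) (use assms in simp_all)

lemma snoc_init_final [simp]: "snoc n (init n) (final n) = Ide C (Cub (Suc n))"
  using snoc_eta[of "Ide C (Cub (Suc n))" n] by simp

abbreviation stretch :: "nat \<Rightarrow> (real \<Rightarrow> real) \<Rightarrow> 'm" where
  "stretch n f \<equiv> snoc n (init n) (app1 f (final n))"

text \<open>The product of loops is defined through maps of spaces. This expresses them by
  coordinates in the category, where the rules for \<open>snoc\<close> apply.\<close>

lemma on_last_stretch: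
  assumes "a' \<in> Hom Box2 (cube 1) (cube 1)"
  shows "AMap \<iota> (on_last (Suc n) a') = stretch n (\<lambda>t. fst (snd a') (\<lambda>i\<in>{..<1}. t) 0)"
proof -
  define f where "f t = fst (snd a') (\<lambda>i\<in>{..<1}. t) 0" for t
  have f: "c1 f" using interval_fun(2)[OF assms] by (simp add: f_def[abs_def])
  let ?g = "\<lambda>x. x(n := f (x n))"
  have g: "continuous_map (cube (Suc n)) (cube (Suc n)) ?g"
    unfolding continuous_map_cube
  proof (intro conjI allI impI)
    fix k assume "k < Suc n"
    moreover have "icont (cube (Suc n)) (\<lambda>x. f (x n))" by (rule icont_comp[OF f]) simp
    ultimately show "icont (cube (Suc n)) (\<lambda>x. ?g x k)" by (cases "k = n") auto
  qed (auto simp: PiE_def extensional_def)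
  note G = tmap_arr_simps[OF _ _ g, simplified]
  have e: "on_last (Suc n) a' = tmap (cube (Suc n)) (cube (Suc n)) ?g"
    by (simp add: on_last_def f_def)
  have i: "init n \<cdot> AMap \<iota> (on_last (Suc n) a') = init n"
    unfolding e init_def
    by (subst tmap_arr_comp[OF _ _ _ g continuous_map_init])
      (auto intro!: arg_cong[of _ _ "AMap \<iota>"] tmap_eqI)
  have j: "final n \<cdot> AMap \<iota> (on_last (Suc n) a') = app1 f (final n)"
    unfolding e final_def coord_ifun
    by (subst ifun_arr_comp[OF _ _ _ g]; (subst app1_ifun[OF f])?) simp_all
  show ?thesis
    unfolding f_def[symmetric]
    by (rule cube_Suc_eqI[of _ _ n]) (use i j f G in \<open>simp_all add: e\<close>)
qed

lemma on_last_a: "AMap \<iota> (on_last (Suc n) a) = stretch n fa"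
  and on_last_b: "AMap \<iota> (on_last (Suc n) b) = stretch n fb"
  using on_last_stretch[OF a_Hom] on_last_stretch[OF b_Hom] by (simp_all add: fa_def[abs_def] fb_def[abs_def])

section \<open>Gluing loops along the last coordinate\<close>

lemma final_inc: "final n \<cdot> inc (Suc n) = AMap \<iota> (ifun (bdry (Suc n)) (\<lambda>x. x n))"
  unfolding final_def coord_ifun bdry_incl_def
  by (rule ifun_arr_comp) (simp_all add: continuous_map_bdry_incl)

lemma init_inc: "init n \<cdot> inc (Suc n) = AMap \<iota> (tmap (bdry (Suc n)) (cube n) (\<lambda>x. restrict x {..<n}))"
  unfolding init_def bdry_incl_def
  by (rule tmap_arr_comp) (simp_all add: continuous_map_bdry_incl continuous_map_init)

text \<open>The bottom and top faces lie in the boundary, so the value of a loop on them is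
  known.\<close>

lemma face:
  assumes "l = 0 \<or> l = 1"
  obtains d where "d \<in> Hom C (Cub n) (Sph (Suc n))" "inc (Suc n) \<cdot> d = snoc n (Ide C (Cub n)) (cst l (Cub n))"
proof -
  let ?d = "\<lambda>x :: nat \<Rightarrow> real. x(n := l)"
  have l: "0 \<le> l" "l \<le> 1" using assms by auto
  have d: "continuous_map (cube n) (bdry (Suc n)) ?d"
    unfolding continuous_map_bdry continuous_map_cube
    using assms by (auto simp: extensional_def PiE_def less_Suc_eq intro!: exI[of _ n])
  note D = tmap_arr_simps[OF _ _ d, simplified]
  have r: "continuous_map (bdry (Suc n)) (cube n) (\<lambda>x. restrict x {..<n})"
    using continuous_map_compose[OF continuous_map_bdry_incl continuous_map_init] by (simp add: comp_def)
  have "(init n \<cdot> inc (Suc n)) \<cdot> AMap \<iota> (tmap (cube n) (bdry (Suc n)) ?d) = AMap \<iota> (tmap (cube n) (cube n) (\<lambda>x. x))"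
    unfolding init_inc
    by (subst tmap_arr_comp[OF _ _ _ d r])
      (auto intro!: arg_cong[of _ _ "AMap \<iota>"] tmap_eqI simp: PiE_def extensional_def restrict_def fun_eq_iff)
  then have i: "init n \<cdot> inc (Suc n) \<cdot> AMap \<iota> (tmap (cube n) (bdry (Suc n)) ?d) = Ide C (Cub n)"
    by (simp add: AMap_Ide)
  have "icont (bdry (Suc n)) (\<lambda>x. x n)"
    unfolding bdry_def by (intro continuous_map_from_subtopology) simp
  then have "(final n \<cdot> inc (Suc n)) \<cdot> AMap \<iota> (tmap (cube n) (bdry (Suc n)) ?d) = cst l (Cub n)"
    unfolding final_inc cst_ifun[OF l Box_Obj(1)]
    by (subst ifun_arr_comp[OF _ _ _ d]) simp_all
  then have "inc (Suc n) \<cdot> AMap \<iota> (tmap (cube n) (bdry (Suc n)) ?d) = snoc n (Ide C (Cub n)) (cst l (Cub n))"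
    using i D l by - (rule cube_Suc_eqI[of _ _ n]; simp)
  with D show ?thesis by (intro that[OF HomI])
qed

text \<open>Since \<open>f\<close> fixes \<open>0\<close> and \<open>1\<close>, a point with some
  coordinate \<open>0\<close> or \<open>1\<close> keeps that coordinate value.\<close>

lemma stretch_boundary:
  assumes f: "c1 f" "f 0 = 0" "f 1 = 1"
  obtains d where "d \<in> Hom C (Sph (Suc n)) (Sph (Suc n))" "inc (Suc n) \<cdot> d = stretch n f \<cdot> inc (Suc n)"
proof -
  let ?d = "\<lambda>x. x(n := f (x n))"
  have x: "icont (bdry (Suc n)) (\<lambda>x. x k)" if "k < Suc n" for k
    unfolding bdry_def by (intro continuous_map_from_subtopology) (use that in simp)
  have d: "continuous_map (bdry (Suc n)) (bdry (Suc n)) ?d"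
    unfolding continuous_map_bdry continuous_map_cube
  proof (intro conjI allI impI ballI)
    fix k assume k: "k < Suc n"
    show "icont (bdry (Suc n)) (\<lambda>x. ?d x k)"
      using icont_comp[OF f(1) x[of n]] x[OF k] by (cases "k = n") auto
  next
    fix x assume "x \<in> topspace (bdry (Suc n))"
    then obtain k where "k < Suc n" "x k = 0 \<or> x k = 1" by auto
    then show "\<exists>k<Suc n. ?d x k = 0 \<or> ?d x k = 1"
      using f(2,3) by (intro exI[of _ k]) auto
  qed (auto simp: PiE_def extensional_def)
  note D = tmap_arr_simps[OF _ _ d, simplified]
  have r: "continuous_map (bdry (Suc n)) (cube n) (\<lambda>x. restrict x {..<n})"
    using continuous_map_compose[OF continuous_map_bdry_incl continuous_map_init] by (simp add: comp_def)
  have "(init n \<cdot> inc (Suc n)) \<cdot> AMap \<iota> (tmap (bdry (Suc n)) (bdry (Suc n)) ?d) = init n \<cdot> inc (Suc n)"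
    unfolding init_inc
    by (subst tmap_arr_comp[OF _ _ _ d r]) (auto intro!: arg_cong[of _ _ "AMap \<iota>"] tmap_eqI)
  moreover have "(final n \<cdot> inc (Suc n)) \<cdot> AMap \<iota> (tmap (bdry (Suc n)) (bdry (Suc n)) ?d) = app1 f (final n \<cdot> inc (Suc n))"
    unfolding final_inc
    by (subst ifun_arr_comp[OF _ _ _ d]; (subst app1_ifun[OF f(1)])?) (simp_all add: x)
  ultimately have "inc (Suc n) \<cdot> AMap \<iota> (tmap (bdry (Suc n)) (bdry (Suc n)) ?d) = stretch n f \<cdot> inc (Suc n)"
    using D f(1) by - (rule cube_Suc_eqI[of _ _ n]; simp)
  with D show ?thesis by (intro that[OF HomI])
qed

text \<open>Under \<open>I\<^sup>n\<^sup>+\<^sup>1 \<cong> I\<^sup>n \<times> I\<close> this is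
  \<open>join_ex1\<close>. The two maps match because the top face of \<open>\<alpha>\<close> and
  the bottom face of \<open>\<beta>\<close> are both constant at \<open>x\<close>.\<close>

lemma glue_ex1:
  assumes \<alpha>: "\<alpha> \<in> loops C \<iota> (Suc n) X x" and \<beta>: "\<beta> \<in> loops C \<iota> (Suc n) X x" and x: "x \<in> Hom C point X"
  shows "\<exists>!\<gamma>. \<gamma> \<in> Hom C (Cub (Suc n)) X \<and> \<gamma> \<cdot> stretch n fa = \<alpha> \<and> \<gamma> \<cdot> stretch n fb = \<beta>"
proof -
  let ?\<psi> = "snoc n (pr1 C (Cub n) I) (pr2 C (Cub n) I)"
  let ?\<phi> = "pairing C (init n) (final n)"
  have \<phi>: "?\<psi> \<cdot> ?\<phi> = Ide C (Cub (Suc n))" "?\<phi> \<cdot> ?\<psi> = Ide C (prod_obj C (Cub n) I)" by simp_all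
  have face: "(\<delta> \<cdot> ?\<psi>) \<cdot> cyl_at l (Cub n) = x \<cdot> to_pt (Cub n)"
    if \<delta>: "\<delta> \<in> loops C \<iota> (Suc n) X x" and l: "l = 0 \<or> l = 1" for \<delta> l
  proof -
    obtain d where d: "d \<in> Hom C (Cub n) (Sph (Suc n))" "inc (Suc n) \<cdot> d = snoc n (Ide C (Cub n)) (cst l (Cub n))"
      using face[OF l] .
    have "(\<delta> \<cdot> ?\<psi>) \<cdot> cyl_at l (Cub n) = \<delta> \<cdot> (inc (Suc n) \<cdot> d)"
      unfolding d(2) using loopsD(1-3)[OF \<delta>] l by auto
    also have "\<dots> = (\<delta> \<cdot> inc (Suc n)) \<cdot> d" using loopsD(1-3)[OF \<delta>] d(1) by (simp add: Hom_def)
    also have "\<dots> = x \<cdot> to_pt (Cub n)"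
      unfolding loopsD(4)[OF \<delta>] using d(1) x by (simp add: Hom_def)
    finally show ?thesis .
  qed
  have \<alpha>': "\<alpha> \<cdot> ?\<psi> \<in> paths (Cub n) X" "\<beta> \<cdot> ?\<psi> \<in> paths (Cub n) X"
    using loopsD[OF \<alpha>] loopsD[OF \<beta>] by (simp_all add: Hom_def)
  have e: "(\<alpha> \<cdot> ?\<psi>) \<cdot> cyl_at 1 (Cub n) = (\<beta> \<cdot> ?\<psi>) \<cdot> cyl_at 0 (Cub n)"
    using face[OF \<alpha>, of 1] face[OF \<beta>, of 0] by simp
  have tr: "(\<gamma> \<cdot> stretch n f) \<cdot> ?\<psi> = reparam (Cub n) f (\<gamma> \<cdot> ?\<psi>)"
    if "\<gamma> \<in> Hom C (Cub (Suc n)) X" "c1 f" for \<gamma> f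
    using that by (simp add: reparam_def Hom_def)
  have cancel: "g = h" if "g \<cdot> ?\<psi> = h \<cdot> ?\<psi>" "g \<in> Hom C (Cub (Suc n)) X" "h \<in> Hom C (Cub (Suc n)) X" for g h
    using arg_cong[OF that(1), of "\<lambda>z. z \<cdot> ?\<phi>"] that(2,3) by (simp add: Hom_def)
  note c = join_props[OF _ \<alpha>' e, simplified]
  let ?\<gamma> = "join (Cub n) (\<alpha> \<cdot> ?\<psi>) (\<beta> \<cdot> ?\<psi>) \<cdot> ?\<phi>"
  have \<gamma>: "?\<gamma> \<in> Hom C (Cub (Suc n)) X" "?\<gamma> \<cdot> ?\<psi> = join (Cub n) (\<alpha> \<cdot> ?\<psi>) (\<beta> \<cdot> ?\<psi>)"
    using c(1) by (simp_all add: Hom_def)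
  show ?thesis
  proof (rule ex1I[of _ ?\<gamma>])
    have "(?\<gamma> \<cdot> stretch n fa) \<cdot> ?\<psi> = \<alpha> \<cdot> ?\<psi>" "(?\<gamma> \<cdot> stretch n fb) \<cdot> ?\<psi> = \<beta> \<cdot> ?\<psi>"
      unfolding tr[OF \<gamma>(1) c1_fa] tr[OF \<gamma>(1) c1_fb] \<gamma>(2) by (rule c)+
    moreover have "?\<gamma> \<cdot> stretch n f \<in> Hom C (Cub (Suc n)) X" if "c1 f" for f
      by (rule Comp_Hom[OF _ \<gamma>(1)]) (use that in \<open>simp add: Hom_def\<close>)
    moreover have "\<alpha> \<in> Hom C (Cub (Suc n)) X" "\<beta> \<in> Hom C (Cub (Suc n)) X"
      using loopsD[OF \<alpha>] loopsD[OF \<beta>] by (simp_all add: Hom_def)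
    ultimately show "?\<gamma> \<in> Hom C (Cub (Suc n)) X \<and> ?\<gamma> \<cdot> stretch n fa = \<alpha> \<and> ?\<gamma> \<cdot> stretch n fb = \<beta>"
      using \<gamma>(1) cancel c1_fa c1_fb by blast
    fix \<gamma> assume g: "\<gamma> \<in> Hom C (Cub (Suc n)) X \<and> \<gamma> \<cdot> stretch n fa = \<alpha> \<and> \<gamma> \<cdot> stretch n fb = \<beta>"
    then have "join (Cub n) (\<alpha> \<cdot> ?\<psi>) (\<beta> \<cdot> ?\<psi>) = \<gamma> \<cdot> ?\<psi>"
      using tr[of \<gamma> fa] tr[of \<gamma> fb] by (intro join_eqI[of _ _ X]) (auto simp: Hom_def)
    then have "\<gamma> \<cdot> ?\<psi> = ?\<gamma> \<cdot> ?\<psi>" unfolding \<gamma>(2) ..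
    then show "\<gamma> = ?\<gamma>" by (rule cancel[OF _ conjunct1[OF g] \<gamma>(1)])
  qed
qed

text \<open>Sliding the value of \<open>\<alpha>\<close> on the boundary along \<open>\<beta>\<close> extends to a homotopy \<open>H\<close> of \<open>\<alpha>\<close>, and \<open>\<gamma>\<close> is the
  pullback of \<open>H\<close> along a map \<open>I\<^sup>n\<^sup>+\<^sup>1 \<rightarrow> I\<^sup>n\<^sup>+\<^sup>1 \<times> I\<close> that runs through the first coordinate and then
  through the second.\<close>

lemma glue_loop:
  assumes \<alpha>: "\<alpha> \<in> loops C \<iota> (Suc n) X x" and \<beta>: "\<beta> \<in> loops C \<iota> (Suc n) X x" and x: "x \<in> Hom C point X"
    and \<gamma>: "\<gamma> \<in> Hom C (Cub (Suc n)) X" "\<gamma> \<cdot> stretch n fa = \<alpha>" "\<gamma> \<cdot> stretch n fb = \<beta>"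
  shows "\<gamma> \<in> loops C \<iota> (Suc n) X x"
proof -
  let ?Q = "Cub (Suc n)" and ?S = "Sph (Suc n)" and ?i = "inc (Suc n)"
  note \<alpha>' = loopsD[OF \<alpha>] and \<beta>' = loopsD[OF \<beta>]
  note x' = HomD[OF x]
  \<comment> \<open>\<open>A\<close> runs on the first half and then waits at \<open>1\<close>;
    \<open>B\<close> waits at \<open>0\<close> and runs on the second half.\<close>
  obtain A where A: "c1 A" "\<And>t. 0 \<le> t \<Longrightarrow> t \<le> 1 \<Longrightarrow> A (fa t) = t" "\<And>t. 0 \<le> t \<Longrightarrow> t \<le> 1 \<Longrightarrow> A (fb t) = 1"
    using reparam_exists[of "\<lambda>t. t" "\<lambda>_. 1"] by auto
  obtain B where B: "c1 B" "\<And>t. 0 \<le> t \<Longrightarrow> t \<le> 1 \<Longrightarrow> B (fa t) = 0" "\<And>t. 0 \<le> t \<Longrightarrow> t \<le> 1 \<Longrightarrow> B (fb t) = t"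
    using reparam_exists[of "\<lambda>_. 0" "\<lambda>t. t"] by auto
  have AB: "A 0 = 0" "A 1 = 1" "B 0 = 0" "B 1 = 1"
    using A(2)[of 0] A(3)[of 1] B(2)[of 0] B(3)[of 1] by auto
  obtain d0 where d0: "d0 \<in> Hom C (Cub n) ?S" "?i \<cdot> d0 = snoc n (Ide C (Cub n)) (cst 0 (Cub n))"
    using face[of 0] by auto
  obtain d1 where d1: "d1 \<in> Hom C (Cub n) ?S" "?i \<cdot> d1 = snoc n (Ide C (Cub n)) (cst 1 (Cub n))"
    using face[of 1] by auto
  obtain dA where dA: "dA \<in> Hom C ?S ?S" "?i \<cdot> dA = stretch n A \<cdot> ?i"
    using stretch_boundary[OF A(1) AB(1,2)] .
  obtain dB where dB: "dB \<in> Hom C ?S ?S" "?i \<cdot> dB = stretch n B \<cdot> ?i"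
    using stretch_boundary[OF B(1) AB(3,4)] .
  \<comment> \<open>A boundary point keeps its first \<open>n\<close> coordinates, and its last one
    is replaced by the time: the walls carry the values of \<open>\<beta>\<close>.\<close>
  let ?h = "\<beta> \<cdot> snoc n (init n \<cdot> ?i \<cdot> pr1 C ?S I) (pr2 C ?S I)"
  have h: "?h \<in> paths ?S X" using \<beta>' by (simp add: Hom_def)
  have "?h \<cdot> cyl_at 0 ?S = \<beta> \<cdot> snoc n (Ide C (Cub n)) (cst 0 (Cub n)) \<cdot> init n \<cdot> ?i"
    using \<beta>'(1-3) by simp
  also have "\<dots> = (\<beta> \<cdot> ?i) \<cdot> d0 \<cdot> init n \<cdot> ?i"
    unfolding d0(2)[symmetric] using \<beta>'(1-3) d0(1) by (simp add: Hom_def)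
  also have "\<dots> = \<alpha> \<cdot> ?i"
    unfolding \<alpha>'(4) \<beta>'(4) using x' d0(1) by (simp add: Hom_def)
  finally have "?h \<cdot> cyl_at 0 ?S = \<alpha> \<cdot> ?i" .
  from homotopy_extension[OF _ h this] \<alpha>'
  obtain H where H: "H \<in> paths ?Q X" "H \<cdot> cyl_at 0 ?Q = \<alpha>" "H \<cdot> times_I ?i = ?h"
    by (auto simp: Hom_def)
  note H' = HomD[OF H(1)]
  let ?J = "pairing C (stretch n A) (app1 B (final n))"
  have c: "app1 (\<lambda>t. A (fa t)) (final n) = app1 (\<lambda>t. t) (final n)"
    "app1 (\<lambda>t. B (fa t)) (final n) = app1 (\<lambda>_. 0) (final n)"
    "app1 (\<lambda>t. A (fb t)) (final n) = app1 (\<lambda>_. 1) (final n)"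
    "app1 (\<lambda>t. B (fb t)) (final n) = app1 (\<lambda>t. t) (final n)"
    by (rule app1_cong; simp add: A B)+
  have "(H \<cdot> ?J) \<cdot> stretch n fa = \<alpha>"
    unfolding H(2)[symmetric] using H' A(1) B(1) by (simp add: c)
  moreover have "(H \<cdot> ?J) \<cdot> stretch n fb = \<beta>"
  proof -
    \<comment> \<open>On the second half \<open>A\<close> is \<open>1\<close>, so the first argument
      of \<open>H\<close> lies on the top face. There \<open>H\<close> is given by
      \<open>?h\<close>, hence by \<open>\<beta>\<close>.\<close>
    have "(H \<cdot> ?J) \<cdot> stretch n fb = H \<cdot> pairing C (snoc n (Ide C (Cub n)) (cst 1 (Cub n)) \<cdot> init n) (final n)"
      using H' A(1) B(1) by (simp add: c)
    also have "\<dots> = (H \<cdot> times_I ?i) \<cdot> pairing C (d1 \<cdot> init n) (final n)"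
      unfolding d1(2)[symmetric] using H' d1(1) by (simp add: Hom_def)
    also have "\<dots> = \<beta> \<cdot> snoc n (init n \<cdot> (?i \<cdot> d1) \<cdot> init n) (final n)"
      unfolding H(3) using \<beta>'(1-3) d1(1) by (simp add: Hom_def)
    also have "\<dots> = \<beta>"
      unfolding d1(2) using \<beta>'(1-3) by simp
    finally show ?thesis .
  qed
  moreover have "H \<cdot> ?J \<in> Hom C ?Q X" using H' A(1) B(1) by (simp add: Hom_def)
  ultimately have "\<gamma> = H \<cdot> ?J"
    using glue_ex1[OF \<alpha> \<beta> x] \<gamma> by blast
  \<comment> \<open>As \<open>stretch n A\<close> preserves the boundary, \<open>H\<close> may be
    replaced by \<open>?h\<close>. What results is \<open>\<beta>\<close> composed with
    \<open>stretch n B\<close>, which preserves the boundary too, so the value is constant.\<close>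
  then have "\<gamma> \<cdot> ?i = H \<cdot> pairing C (stretch n A \<cdot> ?i) (app1 B (final n) \<cdot> ?i)"
    using H' A(1) B(1) by simp
  also have "\<dots> = (H \<cdot> times_I ?i) \<cdot> pairing C dA (app1 B (final n) \<cdot> ?i)"
    unfolding dA(2)[symmetric] using H' dA(1) B(1) by (simp add: Hom_def)
  also have "\<dots> = \<beta> \<cdot> snoc n (init n \<cdot> (?i \<cdot> dA)) (app1 B (final n) \<cdot> ?i)"
    unfolding H(3) using \<beta>'(1-3) dA(1) B(1) by (simp add: Hom_def)
  also have "\<dots> = \<beta> \<cdot> (stretch n B \<cdot> ?i)"
    unfolding dA(2) using \<beta>'(1-3) A(1) B(1) by simp
  also have "\<dots> = (\<beta> \<cdot> ?i) \<cdot> dB"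
    unfolding dB(2)[symmetric] using \<beta>'(1-3) dB(1) by (simp add: Hom_def)
  also have "\<dots> = x \<cdot> to_pt ?S"
    unfolding \<beta>'(4) using dB(1) x' by (simp add: Hom_def)
  finally show ?thesis by (rule loopsI[OF \<gamma>(1)])
qed

abbreviation "conc n \<equiv> concat_loops C \<iota> a b (Suc n)"

lemma concat_loops_props:
  assumes "\<alpha> \<in> loops C \<iota> (Suc n) X x" "\<beta> \<in> loops C \<iota> (Suc n) X x" "x \<in> Hom C point X"
  defines "\<gamma> \<equiv> conc n \<alpha> \<beta>"
  shows "\<gamma> \<in> loops C \<iota> (Suc n) X x" "\<gamma> \<cdot> stretch n fa = \<alpha>" "\<gamma> \<cdot> stretch n fb = \<beta>"
proof -
  have "\<gamma> \<in> Hom C (Cub (Suc n)) X \<and> \<gamma> \<cdot> stretch n fa = \<alpha> \<and> \<gamma> \<cdot> stretch n fb = \<beta>"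
    unfolding \<gamma>_def concat_loops_def on_last_a on_last_b loopsD(3)[OF assms(1)]
    by (rule theI'[OF glue_ex1[OF assms(1-3)]])
  then show "\<gamma> \<in> loops C \<iota> (Suc n) X x" "\<gamma> \<cdot> stretch n fa = \<alpha>" "\<gamma> \<cdot> stretch n fb = \<beta>"
    using glue_loop[OF assms(1-3)] by auto
qed

lemma concat_loops_eqI:
  assumes "\<alpha> \<in> loops C \<iota> (Suc n) X x" "\<beta> \<in> loops C \<iota> (Suc n) X x" "x \<in> Hom C point X"
    "\<gamma> \<in> Hom C (Cub (Suc n)) X" "\<gamma> \<cdot> stretch n fa = \<alpha>" "\<gamma> \<cdot> stretch n fb = \<beta>"
  shows "conc n \<alpha> \<beta> = \<gamma>"
proof -
  note c = concat_loops_props[OF assms(1-3)]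
  have "conc n \<alpha> \<beta> \<in> Hom C (Cub (Suc n)) X"
    using loopsD[OF c(1)] by (simp add: Hom_def)
  with glue_ex1[OF assms(1-3)] c(2,3) assms(4-6) show ?thesis by blast
qed

lemma loops_comp:
  assumes "\<alpha> \<in> loops C \<iota> k X x" "x \<in> Hom C point X" "f \<in> Hom C X Y"
  shows "f \<cdot> \<alpha> \<in> loops C \<iota> k Y (f \<cdot> x)"
  using loopsD[OF assms(1)] assms(2,3) by (intro loopsI) (auto simp: Hom_def)

lemma concat_loops_comp:
  assumes \<alpha>: "\<alpha> \<in> loops C \<iota> (Suc n) X x" and \<beta>: "\<beta> \<in> loops C \<iota> (Suc n) X x" and x: "x \<in> Hom C point X"
    and f: "f \<in> Hom C X Y"
  shows "f \<cdot> conc n \<alpha> \<beta> = conc n (f \<cdot> \<alpha>) (f \<cdot> \<beta>)"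
proof (rule concat_loops_eqI[symmetric, OF loops_comp[OF \<alpha> x f] loops_comp[OF \<beta> x f]])
  let ?\<gamma> = "conc n \<alpha> \<beta>"
  note c = concat_loops_props[OF \<alpha> \<beta> x] and g = loopsD[OF concat_loops_props(1)[OF \<alpha> \<beta> x]]
  have "(f \<cdot> ?\<gamma>) \<cdot> stretch n h = f \<cdot> (?\<gamma> \<cdot> stretch n h)" if "c1 h" for h
    using g f that by (simp add: Hom_def del: snoc_comp)
  then show "(f \<cdot> ?\<gamma>) \<cdot> stretch n fa = f \<cdot> \<alpha>" "(f \<cdot> ?\<gamma>) \<cdot> stretch n fb = f \<cdot> \<beta>"
    using c(2,3) by simp_all
qed (use f x loopsD[OF concat_loops_props(1)[OF \<alpha> \<beta> x]] in \<open>auto simp: Hom_def\<close>)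

text \<open>A homotopy of loops in \<open>X\<close> is a loop in the path object of \<open>X\<close>, and loops there can be
  concatenated.\<close>

lemma concat_loops_homotopic:
  assumes \<alpha>: "\<alpha> \<in> loops C \<iota> (Suc n) X x" and \<beta>: "\<beta> \<in> loops C \<iota> (Suc n) X x" and x: "x \<in> Hom C point X"
    and \<alpha>2: "\<alpha>' \<in> loops C \<iota> (Suc n) X x" and \<beta>2: "\<beta>' \<in> loops C \<iota> (Suc n) X x"
    and h: "homotopic (Suc n) \<alpha> \<alpha>'" and k: "homotopic (Suc n) \<beta> \<beta>'"
  shows "homotopic (Suc n) (conc n \<alpha> \<beta>) (conc n \<alpha>' \<beta>')"
proof -
  let ?Q = "Cub (Suc n)" and ?S = "Sph (Suc n)" and ?i = "inc (Suc n)"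
  have X: "X \<in> Obj C" using Hom_Obj[OF x] by simp
  note x' = HomD[OF x]
  obtain E \<phi> where E: "\<And>Y. Y \<in> Obj C \<Longrightarrow> E Y \<in> Obj C"
    and bij: "\<And>X Y. X \<in> Obj C \<Longrightarrow> Y \<in> Obj C \<Longrightarrow> bij_betw (\<phi> X Y) (paths X Y) (Hom C X (E Y))"
    and nat: "\<And>X Y B u g. u \<in> Hom C B X \<Longrightarrow> g \<in> paths X Y \<Longrightarrow> \<phi> B Y (g \<cdot> times_I u) = \<phi> X Y g \<cdot> u"
    by (rule exponential) blast
  have inj: "g = h" if "\<phi> A X g = \<phi> A X h" "g \<in> paths A X" "h \<in> paths A X" "A \<in> Obj C" for A g h
    using bij_betw_imp_inj_on[OF bij[OF that(4) X]] that(1-3) by (simp add: inj_on_eq_iff)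
  have i: "?i \<in> Hom C ?S ?Q" by (simp add: Hom_def)
  \<comment> \<open>The base point in the path object is the constant path at
    \<open>x\<close>.\<close>
  let ?x = "\<phi> point X (x \<cdot> to_pt (prod_obj C point I))"
  have xb: "x \<cdot> to_pt (prod_obj C point I) \<in> paths point X" using x' by (simp add: Hom_def)
  have x1: "?x \<in> Hom C point (E X)"
    by (rule bij_betw_apply[OF bij xb]) (use X in simp_all)
  have const: "\<phi> ?S X (x \<cdot> to_pt (prod_obj C ?S I)) = ?x \<cdot> to_pt ?S"
    using nat[OF _ xb, of "to_pt ?S" ?S] x' by (simp add: Hom_def)
  have curry: "\<phi> ?Q X H \<in> loops C \<iota> (Suc n) (E X) ?x"
    if "H \<in> paths ?Q X" "H \<cdot> times_I ?i = x \<cdot> to_pt (prod_obj C ?S I)" for H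
  proof (rule loopsI)
    show "\<phi> ?Q X H \<in> Hom C ?Q (E X)" by (rule bij_betw_apply[OF bij that(1)]) (use X in simp_all)
    show "\<phi> ?Q X H \<cdot> ?i = ?x \<cdot> to_pt ?S"
      using nat[OF i that(1)] unfolding that(2) const by simp
  qed
  have rel: "g \<cdot> ?i \<cdot> pr1 C ?S I = x \<cdot> to_pt (prod_obj C ?S I)" if "g \<in> loops C \<iota> (Suc n) X x" for g
    unfolding loopsD(4)[OF that] using x' by simp
  obtain H where H: "H \<in> paths ?Q X" "\<alpha> = H \<cdot> cyl_at 0 ?Q" "\<alpha>' = H \<cdot> cyl_at 1 ?Q"
    "H \<cdot> times_I ?i = \<alpha> \<cdot> ?i \<cdot> pr1 C ?S I"
    by (rule homotopic_relE[OF h HomI[OF loopsD(1-3)[OF \<alpha>]] i])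
  obtain K where K: "K \<in> paths ?Q X" "\<beta> = K \<cdot> cyl_at 0 ?Q" "\<beta>' = K \<cdot> cyl_at 1 ?Q"
    "K \<cdot> times_I ?i = \<beta> \<cdot> ?i \<cdot> pr1 C ?S I"
    by (rule homotopic_relE[OF k HomI[OF loopsD(1-3)[OF \<beta>]] i])
  have HK: "\<phi> ?Q X H \<in> loops C \<iota> (Suc n) (E X) ?x" "\<phi> ?Q X K \<in> loops C \<iota> (Suc n) (E X) ?x"
    by (rule curry; use H K rel[OF \<alpha>] rel[OF \<beta>] in simp)+
  let ?\<gamma> = "conc n (\<phi> ?Q X H) (\<phi> ?Q X K)"
  note c = concat_loops_props[OF HK x1]
  have Qo: "?Q \<in> Obj C" by simp
  have "?\<gamma> \<in> \<phi> ?Q X ` paths ?Q X"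
    unfolding bij_betw_imp_surj_on[OF bij[OF Qo X]] by (rule HomI[OF loopsD(1-3)[OF c(1)]])
  then obtain G where G: "G \<in> paths ?Q X" "\<phi> ?Q X G = ?\<gamma>" by (rule imageE) (rule that[OF _ sym])
  note G' = HomD[OF G(1)]
  \<comment> \<open>That the glued homotopy is again relative to the boundary is
    \<open>glue_loop\<close> in the path object, transposed back.\<close>
  have "\<phi> ?S X (G \<cdot> times_I ?i) = \<phi> ?S X (x \<cdot> to_pt (prod_obj C ?S I))"
    unfolding const nat[OF i G(1)] G(2) using loopsD(4)[OF c(1)] .
  then have Gi: "G \<cdot> times_I ?i = x \<cdot> to_pt (prod_obj C ?S I)"
    by (rule inj) (use G' x' in \<open>auto simp: Hom_def\<close>)
  have s: "stretch n f \<in> Hom C ?Q ?Q" if "c1 f" for f using that by (simp add: Hom_def)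
  have e: "\<phi> ?Q X (G \<cdot> times_I (stretch n fa)) = \<phi> ?Q X H" "\<phi> ?Q X (G \<cdot> times_I (stretch n fb)) = \<phi> ?Q X K"
    unfolding nat[OF s[OF c1_fa] G(1)] nat[OF s[OF c1_fb] G(1)] G(2) by (rule c)+
  have Gs: "G \<cdot> times_I (stretch n fa) = H" "G \<cdot> times_I (stretch n fb) = K"
    by (rule inj[OF e(1)] inj[OF e(2)]; use G' H(1) K(1) in \<open>simp add: Hom_def\<close>)+
  have ends: "(G \<cdot> cyl_at l ?Q) \<cdot> stretch n f = (G \<cdot> times_I (stretch n f)) \<cdot> cyl_at l ?Q"
    if "c1 f" "0 \<le> l" "l \<le> 1" for f l
    using that G' by simp
  have Gl: "G \<cdot> cyl_at l ?Q \<in> Hom C ?Q X" if "0 \<le> l" "l \<le> 1" for l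
    using that G' by (simp add: Hom_def)
  have 0: "conc n \<alpha> \<beta> = G \<cdot> cyl_at 0 ?Q"
    using Gl[of 0] ends[OF c1_fa, of 0] ends[OF c1_fb, of 0] unfolding Gs H(2)[symmetric] K(2)[symmetric]
    by (intro concat_loops_eqI[OF \<alpha> \<beta> x]) simp_all
  have 1: "conc n \<alpha>' \<beta>' = G \<cdot> cyl_at 1 ?Q"
    using Gl[of 1] ends[OF c1_fa, of 1] ends[OF c1_fb, of 1] unfolding Gs H(3)[symmetric] K(3)[symmetric]
    by (intro concat_loops_eqI[OF \<alpha>2 \<beta>2 x]) simp_all
  show ?thesis
    by (rule homotopic_relI[OF G(1) 0[symmetric] 1[symmetric] i])
      (use Gi rel[OF concat_loops_props(1)[OF \<alpha> \<beta> x]] in simp)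
qed


section \<open>Homotopy groups and compressibility\<close>

lemma homotopic_rel_refl:
  assumes "f \<in> Hom C A X" "j \<in> Hom C B A"
  shows "homotopic_rel C \<iota> j f f"
  by (rule homotopic_relI[of "f \<cdot> pr1 C A I" A X]) (use assms Hom_Obj[OF assms(2)] in \<open>auto simp: Hom_def\<close>)

lemma homotopic_rel_sym:
  assumes "homotopic_rel C \<iota> j f g" "f \<in> Hom C A X" "j \<in> Hom C B A"
  shows "homotopic_rel C \<iota> j g f"
proof -
  have A: "A \<in> Obj C" "B \<in> Obj C" using Hom_Obj[OF assms(3)] by auto
  obtain H where H: "H \<in> paths A X" "f = H \<cdot> cyl_at 0 A" "g = H \<cdot> cyl_at 1 A"
    "H \<cdot> times_I j = f \<cdot> j \<cdot> pr1 C B I" "g \<in> Hom C A X" "f \<cdot> j = g \<cdot> j"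
    by (rule homotopic_relE[OF assms])
  note H' = HomD[OF H(1)]
  note j = HomD[OF assms(3)]
  have fj: "f \<cdot> j \<in> Arr C" "Dom C (f \<cdot> j) = B" using assms(2) j by (auto simp: Hom_def)
  have "rev_path A H \<cdot> times_I j = rev_path B (H \<cdot> times_I j)"
    using H' j A by (simp add: reparam_def)
  also have "\<dots> = f \<cdot> j \<cdot> pr1 C B I"
    unfolding H(4) by (rule reparam_constant) (use fj in simp_all)
  finally have "rev_path A H \<cdot> times_I j = g \<cdot> j \<cdot> pr1 C B I" unfolding H(6) .
  then show ?thesis
    by (intro homotopic_relI[OF _ _ _ assms(3)]) (use H' A in \<open>simp_all add: H(2,3) Hom_def\<close>)
qed

lemma homotopic_rel_trans:
  assumes "homotopic_rel C \<iota> j f g" "homotopic_rel C \<iota> j g h" "f \<in> Hom C A X" "j \<in> Hom C B A"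
  shows "homotopic_rel C \<iota> j f h"
proof -
  have A: "A \<in> Obj C" "B \<in> Obj C" using Hom_Obj[OF assms(4)] by auto
  obtain H where H: "H \<in> paths A X" "f = H \<cdot> cyl_at 0 A" "g = H \<cdot> cyl_at 1 A"
    "H \<cdot> times_I j = f \<cdot> j \<cdot> pr1 C B I" "g \<in> Hom C A X" "f \<cdot> j = g \<cdot> j"
    by (rule homotopic_relE[OF assms(1,3,4)])
  obtain K where K: "K \<in> paths A X" "g = K \<cdot> cyl_at 0 A" "h = K \<cdot> cyl_at 1 A"
    "K \<cdot> times_I j = g \<cdot> j \<cdot> pr1 C B I"
    by (rule homotopic_relE[OF assms(2) H(5) assms(4)])
  have e: "H \<cdot> cyl_at 1 A = K \<cdot> cyl_at 0 A" using H(3) K(2) by simp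
  note c = join_props(1)[OF A(1) H(1) K(1) e] join_ends[OF A(1) H(1) K(1) e, folded H(2) K(3)]
  have fj: "f \<cdot> j \<in> Hom C B X" using assms(3,4) by (simp add: Hom_def)
  show ?thesis
    by (rule homotopic_relI[OF c assms(4)])
      (simp only: join_pre[OF A(1) H(1) K(1) e assms(4)] H(4) K(4) join_const[OF fj] flip: H(6))
qed

lemma homotopic_rel_comp:
  assumes "homotopic_rel C \<iota> j f g" "f \<in> Hom C A X" "j \<in> Hom C B A" "h \<in> Hom C X Y"
  shows "homotopic_rel C \<iota> j (h \<cdot> f) (h \<cdot> g)"
proof -
  have A: "A \<in> Obj C" "B \<in> Obj C" using Hom_Obj[OF assms(3)] by auto
  obtain H where H: "H \<in> paths A X" "f = H \<cdot> cyl_at 0 A" "g = H \<cdot> cyl_at 1 A"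
    "H \<cdot> times_I j = f \<cdot> j \<cdot> pr1 C B I"
    by (rule homotopic_relE[OF assms(1-3)])
  note H' = HomD[OF H(1)]
  have F: "f \<in> Arr C" "Dom C f = A" "Cod C f = X" "j \<in> Arr C" "Dom C j = B" "Cod C j = A"
    "h \<in> Arr C" "Dom C h = X" "Cod C h = Y"
    using assms(2-4) by (auto simp: Hom_def)
  have "(h \<cdot> H) \<cdot> times_I j = h \<cdot> (H \<cdot> times_I j)" using H' F A by simp
  then have e: "(h \<cdot> H) \<cdot> times_I j = (h \<cdot> f) \<cdot> j \<cdot> pr1 C B I"
    unfolding H(4) using F A by simp
  show ?thesis
    by (rule homotopic_relI[OF _ _ _ assms(3) e]) (use H' F A in \<open>simp_all add: H(2,3) Hom_def\<close>)
qed

lemma inc_Hom: "inc k \<in> Hom C (Sph k) (Cub k)"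
  by (simp add: Hom_def)

lemma loops_Hom: "\<alpha> \<in> loops C \<iota> k X x \<Longrightarrow> \<alpha> \<in> Hom C (Cub k) X"
  by (simp add: loops_def)

section \<open>Homotopy groups in terms of representatives\<close>

lemma equiv_loop_rel: "equiv (loops C \<iota> k X x) (loop_rel C \<iota> k X x)"
proof (rule equivI)
  show "loop_rel C \<iota> k X x \<subseteq> loops C \<iota> k X x \<times> loops C \<iota> k X x"
    by (auto simp: loop_rel_def)
  show "refl_on (loops C \<iota> k X x) (loop_rel C \<iota> k X x)"
    using homotopic_rel_refl[OF loops_Hom inc_Hom] by (auto simp: refl_on_def loop_rel_def)
  show "sym (loop_rel C \<iota> k X x)"
    using homotopic_rel_sym[OF _ loops_Hom inc_Hom] by (auto simp: sym_def loop_rel_def)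
  show "trans (loop_rel C \<iota> k X x)"
    using homotopic_rel_trans[OF _ _ loops_Hom inc_Hom] by (auto simp: trans_def loop_rel_def)
qed

abbreviation "loop_class k X x \<alpha> \<equiv> loop_rel C \<iota> k X x `` {\<alpha>}"

lemma loop_class_eq_iff:
  assumes "\<alpha> \<in> loops C \<iota> k X x" "\<beta> \<in> loops C \<iota> k X x"
  shows "loop_class k X x \<alpha> = loop_class k X x \<beta> \<longleftrightarrow> homotopic k \<alpha> \<beta>"
  using eq_equiv_class_iff[OF equiv_loop_rel assms] assms by (simp add: loop_rel_def)

lemma in_loop_class:
  "\<alpha>' \<in> loop_class k X x \<alpha> \<longleftrightarrow>
     \<alpha> \<in> loops C \<iota> k X x \<and> \<alpha>' \<in> loops C \<iota> k X x \<and> homotopic k \<alpha> \<alpha>'"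
  by (auto simp: loop_rel_def)

text \<open>The induced map is defined as a union over representatives; all its members coincide,
  and a class is not empty.\<close>

lemma homotopy_map_class:
  assumes f: "f \<in> Hom C X Y" and x: "x \<in> Hom C point X" and \<alpha>: "\<alpha> \<in> loops C \<iota> k X x"
  shows "homotopy_map C \<iota> k f x (loop_class k X x \<alpha>) = loop_class k Y (f \<cdot> x) (f \<cdot> \<alpha>)"
proof -
  have "loop_class k Y (f \<cdot> x) (f \<cdot> \<alpha>') = loop_class k Y (f \<cdot> x) (f \<cdot> \<alpha>)"
    if \<alpha>': "\<alpha>' \<in> loop_class k X x \<alpha>" for \<alpha>'
  proof -
    have "\<alpha>' \<in> loops C \<iota> k X x" "homotopic k \<alpha> \<alpha>'"
      using \<alpha>' unfolding in_loop_class by auto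
    then show ?thesis
      using homotopic_rel_comp[OF _ loops_Hom[OF \<alpha>] inc_Hom f] loops_comp[OF _ x f] \<alpha>
      by (intro sym[OF iffD2[OF loop_class_eq_iff]]) auto
  qed
  moreover have "loop_class k X x \<alpha> \<noteq> {}"
    using equiv_class_self[OF equiv_loop_rel \<alpha>] by blast
  ultimately show ?thesis
    unfolding homotopy_map_def HomD(3)[OF f] by (intro SUP_eq_const)
qed

abbreviation "\<pi> \<equiv> homotopy_group C \<iota> a b"

text \<open>By \<open>concat_loops_homotopic\<close> the union over both representatives has a
  single value.\<close>

lemma mult_loop_class:
  assumes x: "x \<in> Hom C point X" and \<alpha>: "\<alpha> \<in> loops C \<iota> (Suc n) X x" and \<beta>: "\<beta> \<in> loops C \<iota> (Suc n) X x"
  shows "loop_class (Suc n) X x \<alpha> \<otimes>\<^bsub>\<pi> (Suc n) X x\<^esub> loop_class (Suc n) X x \<beta>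
    = loop_class (Suc n) X x (conc n \<alpha> \<beta>)"
proof -
  have "loop_class (Suc n) X x (conc n \<alpha>' \<beta>') =
      loop_class (Suc n) X x (conc n \<alpha> \<beta>)"
    if \<alpha>': "\<alpha>' \<in> loop_class (Suc n) X x \<alpha>" and \<beta>': "\<beta>' \<in> loop_class (Suc n) X x \<beta>" for \<alpha>' \<beta>'
  proof -
    have "\<alpha>' \<in> loops C \<iota> (Suc n) X x" "homotopic (Suc n) \<alpha> \<alpha>'"
      "\<beta>' \<in> loops C \<iota> (Suc n) X x" "homotopic (Suc n) \<beta> \<beta>'"
      using \<alpha>' \<beta>' unfolding in_loop_class by auto
    then show ?thesis
      using concat_loops_homotopic[OF \<alpha> \<beta> x] concat_loops_props(1)[OF _ _ x] \<alpha> \<beta>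
      by (intro sym[OF iffD2[OF loop_class_eq_iff]]) auto
  qed
  moreover have "loop_class (Suc n) X x \<alpha> \<noteq> {}" "loop_class (Suc n) X x \<beta> \<noteq> {}"
    using equiv_class_self[OF equiv_loop_rel \<alpha>] equiv_class_self[OF equiv_loop_rel \<beta>] by blast+
  ultimately show ?thesis
    unfolding homotopy_group_def monoid.simps by (intro SUP_eq_const) auto
qed

text \<open>Stating injectivity and surjectivity on loops removes classes and group structure from
  the rest of the argument.\<close>

definition pi_inj :: "nat \<Rightarrow> 'o \<Rightarrow> 'm \<Rightarrow> 'm \<Rightarrow> bool" where
  "pi_inj k X f x \<longleftrightarrow> (\<forall>\<alpha>\<in>loops C \<iota> k X x. \<forall>\<beta>\<in>loops C \<iota> k X x.
     homotopic k (f \<cdot> \<alpha>) (f \<cdot> \<beta>) \<longrightarrow> homotopic k \<alpha> \<beta>)"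

definition pi_surj :: "nat \<Rightarrow> 'o \<Rightarrow> 'o \<Rightarrow> 'm \<Rightarrow> 'm \<Rightarrow> bool" where
  "pi_surj k X Y f x \<longleftrightarrow> (\<forall>\<beta>\<in>loops C \<iota> k Y (f \<cdot> x). \<exists>\<alpha>\<in>loops C \<iota> k X x.
     homotopic k (f \<cdot> \<alpha>) \<beta>)"

lemma carrier_homotopy_group:
  "carrier (\<pi> k X x) = (\<lambda>\<alpha>. loop_class k X x \<alpha>) ` loops C \<iota> k X x"
  by (auto simp: homotopy_group_def quotient_def)

lemma homotopy_map_image:
  assumes f: "f \<in> Hom C X Y" and x: "x \<in> Hom C point X"
  shows "homotopy_map C \<iota> k f x ` carrier (\<pi> k X x) =
     (\<lambda>\<alpha>. loop_class k Y (f \<cdot> x) (f \<cdot> \<alpha>)) ` loops C \<iota> k X x"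
  unfolding carrier_homotopy_group image_image
  by (rule image_cong[OF refl]) (rule homotopy_map_class[OF f x])

lemma homotopy_map_surj_iff:
  assumes f: "f \<in> Hom C X Y" and x: "x \<in> Hom C point X"
  shows "homotopy_map_surj C \<iota> a b k f x \<longleftrightarrow> pi_surj k X Y f x"
proof -
  have "(\<lambda>\<alpha>. loop_class k Y (f \<cdot> x) (f \<cdot> \<alpha>)) ` loops C \<iota> k X x
    \<subseteq> (\<lambda>\<alpha>. loop_class k Y (f \<cdot> x) \<alpha>) ` loops C \<iota> k Y (f \<cdot> x)"
    using loops_comp[OF _ x f] by blast
  moreover have "(\<lambda>\<alpha>. loop_class k Y (f \<cdot> x) \<alpha>) ` loops C \<iota> k Y (f \<cdot> x)
    \<subseteq> (\<lambda>\<alpha>. loop_class k Y (f \<cdot> x) (f \<cdot> \<alpha>)) ` loops C \<iota> k X x \<longleftrightarrow> pi_surj k X Y f x"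
    unfolding pi_surj_def image_subset_iff image_iff
    using loop_class_eq_iff[OF loops_comp[OF _ x f]] by (metis (no_types, lifting))
  ultimately show ?thesis
    unfolding homotopy_map_surj_def HomD(2,3)[OF f] homotopy_map_image[OF f x] carrier_homotopy_group[of k Y]
    by blast
qed

lemma homotopy_map_inj_iff:
  assumes f: "f \<in> Hom C X Y" and x: "x \<in> Hom C point X"
  shows "inj_on (homotopy_map C \<iota> k f x) (carrier (\<pi> k X x)) \<longleftrightarrow> pi_inj k X f x"
  unfolding inj_on_def carrier_homotopy_group pi_inj_def
  using homotopy_map_class[OF f x] loop_class_eq_iff loops_comp[OF _ x f] by simp

lemma homotopy_map_hom:
  assumes f: "f \<in> Hom C X Y" and x: "x \<in> Hom C point X"
  shows "homotopy_map C \<iota> (Suc n) f x \<in>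
    hom (\<pi> (Suc n) X x) (\<pi> (Suc n) Y (f \<cdot> x))"
proof -
  have fx: "f \<cdot> x \<in> Hom C point Y" using f x by (simp add: Hom_def)
  show ?thesis
    unfolding hom_def carrier_homotopy_group
    using homotopy_map_class[OF f x] mult_loop_class[OF x] mult_loop_class[OF fx] loops_comp[OF _ x f]
      concat_loops_comp[OF _ _ x f] concat_loops_props(1)[OF _ _ x] by auto
qed

text \<open>The induced map is always a homomorphism in positive degrees, so being an isomorphism is
  bijectivity in every degree.\<close>

lemma homotopy_map_iso_iff:
  assumes f: "f \<in> Hom C X Y" and x: "x \<in> Hom C point X"
  shows "homotopy_map_iso C \<iota> a b k f x \<longleftrightarrow> pi_inj k X f x \<and> pi_surj k X Y f x"
proof -
  have "bij_betw (homotopy_map C \<iota> k f x) (carrier (\<pi> k X x))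
     (carrier (\<pi> k Y (f \<cdot> x))) \<longleftrightarrow> pi_inj k X f x \<and> pi_surj k X Y f x"
    unfolding bij_betw_def homotopy_map_inj_iff[OF f x]
    using homotopy_map_surj_iff[OF f x] unfolding homotopy_map_surj_def HomD(2,3)[OF f] by simp
  moreover have "k = 0 \<or> homotopy_map C \<iota> k f x \<in> hom (\<pi> k X x) (\<pi> k Y (f \<cdot> x))"
    using homotopy_map_hom[OF f x] by (cases k) auto
  ultimately show ?thesis
    unfolding homotopy_map_iso_def Let_def HomD(2,3)[OF f] iso_def by auto
qed

section \<open>From compressibility to homotopy groups and back\<close>

lemma pi_surj_of_compressible:
  assumes f: "f \<in> Hom C X Y" and x: "x \<in> Hom C point X" and c: "compressible C \<iota> k f"
  shows "pi_surj k X Y f x"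
  unfolding pi_surj_def
proof
  fix \<beta> assume \<beta>: "\<beta> \<in> loops C \<iota> k Y (f \<cdot> x)"
  let ?u = "x \<cdot> to_pt (Sph k)"
  have u: "?u \<in> Hom C (Sph k) X" using x by (simp add: Hom_def)
  have "f \<cdot> ?u = \<beta> \<cdot> inc k" unfolding loopsD(4)[OF \<beta>] using f x by (simp add: Hom_def)
  then obtain h where "h \<in> Hom C (Cub k) X" "h \<cdot> inc k = ?u" "homotopic k (f \<cdot> h) \<beta>"
    using c u loops_Hom[OF \<beta>] unfolding compressible_def HomD(2,3)[OF f] by blast
  then show "\<exists>\<alpha>\<in>loops C \<iota> k X x. homotopic k (f \<cdot> \<alpha>) \<beta>"
    using loopsI by blast
qed

lemma pi_inj_of_compressible:
  assumes f: "f \<in> Hom C X Y" and x: "x \<in> Hom C point X" and c: "compressible C \<iota> (k + 1) f"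
  shows "pi_inj k X f x"
  unfolding pi_inj_def
proof (intro ballI impI)
  fix \<alpha> \<beta> assume \<alpha>: "\<alpha> \<in> loops C \<iota> k X x" and \<beta>: "\<beta> \<in> loops C \<iota> k X x"
    and h: "homotopic k (f \<cdot> \<alpha>) (f \<cdot> \<beta>)"
  show "homotopic k \<alpha> \<beta>"
  proof (cases "k = 0")
    case True
    have b: "\<beta> \<in> Hom C point X" using loops_Hom[OF \<beta>] True by simp
    \<comment> \<open>With empty boundary \<open>\<alpha>\<close> is a loop at every point. Taking
      \<open>\<beta>\<close> as base point makes \<open>\<beta>\<close> the constant loop.\<close>
    have "\<alpha> \<in> loops C \<iota> k X \<beta>"
      using loopsD[OF \<alpha>] b x True by (intro loopsI Sph_0_eq) (auto simp: Hom_def)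
    from compressible_null[OF f c b this] h True f b show ?thesis by (simp add: Hom_def)
  next
    case False
    then have k: "k \<ge> 1" by simp
    obtain c0 \<rho> where P: "polar k c0 \<rho>" using polar_exists[OF k] by blast
    obtain d where d: "difference k \<rho> X \<alpha> \<beta> d"
      by (rule difference_exists[OF P loops_Hom[OF \<alpha>] loops_Hom[OF \<beta>]])
        (simp add: loopsD(4)[OF \<alpha>] loopsD(4)[OF \<beta>])
    \<comment> \<open>The difference loop is based at the center of \<open>\<alpha>\<close> and not
      at \<open>x\<close>; this is why the null criterion is needed at every base point.\<close>
    have ac: "\<alpha> \<cdot> c0 \<in> Hom C point X" using polar_path(4)[OF P loops_Hom[OF \<alpha>]] .
    have "(f \<cdot> \<alpha>) \<cdot> c0 = f \<cdot> (\<alpha> \<cdot> c0)" using f loopsD[OF \<alpha>] polarD[OF P] by (simp add: Hom_def)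
    with difference_homotopic[OF P k difference_comp[OF P d f] h]
    have "homotopic k (f \<cdot> d) ((f \<cdot> (\<alpha> \<cdot> c0)) \<cdot> to_pt (Cub k))" by simp
    from compressible_null[OF f c ac difference_loop[OF P d] this]
    show ?thesis by (rule homotopic_of_difference[OF P k d])
  qed
qed

text \<open>The boundary imposes no condition, so \<open>v\<close> is a loop over the image of any
  point. This is where a point of \<open>X\<close> has to exist; in higher degrees the map on the
  sphere provides one.\<close>

lemma compressible_0:
  assumes f: "f \<in> Hom C X Y" and x: "x \<in> Hom C point X" and s: "pi_surj 0 X Y f x"
  shows "compressible C \<iota> 0 f"
  unfolding compressible_def HomD(2,3)[OF f]
proof (intro ballI impI)
  fix u v assume u: "u \<in> Hom C (Sph 0) X" and v: "v \<in> Hom C (Cub 0) Y"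
  have "v \<in> loops C \<iota> 0 Y (f \<cdot> x)"
    by (rule loopsI[OF v Sph_0_eq]) (use f x v in \<open>auto simp: Hom_def\<close>)
  then obtain h where h: "h \<in> loops C \<iota> 0 X x" "homotopic 0 (f \<cdot> h) v"
    using s unfolding pi_surj_def by blast
  have "h \<cdot> inc 0 = u" by (rule Sph_0_eq[OF Comp_Hom[OF inc_Hom loops_Hom[OF h(1)]] u])
  then show "\<exists>h\<in>Hom C (Cub 0) X. h \<cdot> inc 0 = u \<and> homotopic 0 (f \<cdot> h) v"
    using h loops_Hom by blast
qed

lemma compressible_Suc:
  assumes f: "f \<in> Hom C X Y"
    and i: "\<And>x. x \<in> Hom C point X \<Longrightarrow> pi_inj m X f x"
    and s: "\<And>x. x \<in> Hom C point X \<Longrightarrow> pi_surj (m + 1) X Y f x"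
  shows "compressible C \<iota> (m + 1) f"
  unfolding compressible_def HomD(2,3)[OF f]
proof (intro ballI impI)
  fix u v assume u: "u \<in> Hom C (Sph (m + 1)) X" and v: "v \<in> Hom C (Cub (m + 1)) Y"
    and e: "f \<cdot> u = v \<cdot> inc (m + 1)"
  obtain pt \<sigma> where P: "pole m pt \<sigma>" using pole_exists by blast
  obtain c \<rho> where R: "polar (m + 1) c \<rho>" using polar_exists[of "m + 1"] by auto
  note P' = poleD[OF P] and R' = polarD[OF R]
  have F: "f \<in> Arr C" "Dom C f = X" "Cod C f = Y" "u \<in> Arr C" "Dom C u = Sph (m + 1)" "Cod C u = X"
    using f u by (auto simp: Hom_def)
  have x: "u \<cdot> pt \<in> Hom C point X" using F P' by (simp add: Hom_def)
  have "(u \<cdot> \<sigma>) \<cdot> inc m = u \<cdot> (\<sigma> \<cdot> inc m)" using F P'(1-6) by simp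
  then have "(u \<cdot> \<sigma>) \<cdot> inc m = (u \<cdot> pt) \<cdot> to_pt (Sph m)" unfolding P'(7) using F P'(1-6) by simp
  then have D: "u \<cdot> \<sigma> \<in> loops C \<iota> m X (u \<cdot> pt)"
    by (intro loopsI) (use F P'(1-6) in \<open>simp_all add: Hom_def\<close>)
  \<comment> \<open>The map \<open>v\<close> extends \<open>f \<cdot> u\<close>, so the image of the
    loop is null, with a base point that may travel.\<close>
  have "null m Y (f \<cdot> (u \<cdot> \<sigma>)) (f \<cdot> (u \<cdot> pt)) (v \<cdot> c)"
    using null_of_extension[OF P R v] unfolding e[symmetric] using F P'(1-6) by simp
  from homotopic_const_of_null[OF this loops_comp[OF D x f]]
  have "homotopic m (f \<cdot> (u \<cdot> \<sigma>)) (f \<cdot> ((u \<cdot> pt) \<cdot> to_pt (Cub m)))"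
    using F P'(1-6) by (simp add: Hom_def)
  moreover have "(u \<cdot> pt) \<cdot> to_pt (Cub m) \<in> loops C \<iota> m X (u \<cdot> pt)"
    by (rule loopsI) (use F P'(1-6) in \<open>simp_all add: Hom_def\<close>)
  ultimately have "homotopic m (u \<cdot> \<sigma>) ((u \<cdot> pt) \<cdot> to_pt (Cub m))"
    using i[OF x] D unfolding pi_inj_def by blast
  from extension_of_null[OF P R u null_of_homotopic_const[OF this D x]]
  obtain h where h: "h \<in> Hom C (Cub (m + 1)) X" "h \<cdot> inc (m + 1) = u" "h \<cdot> c = u \<cdot> pt" .
  note h' = HomD[OF h(1)]
  have fh: "f \<cdot> h \<in> Hom C (Cub (m + 1)) Y" "(f \<cdot> h) \<cdot> inc (m + 1) = v \<cdot> inc (m + 1)"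
    "(f \<cdot> h) \<cdot> c = f \<cdot> (h \<cdot> c)"
    unfolding e[symmetric] h(2)[symmetric] using F h' R' by (simp_all add: Hom_def)
  obtain d where d: "difference (m + 1) \<rho> Y (f \<cdot> h) v d"
    using difference_exists[OF R fh(1) v fh(2)] .
  \<comment> \<open>The center of \<open>h\<close> is \<open>u \<cdot> pt\<close>, because the
    contraction of the loop kept its base point fixed. The difference loop therefore lies over a
    point of \<open>X\<close>, where surjectivity can be applied.\<close>
  have "d \<in> loops C \<iota> (m + 1) Y (f \<cdot> (u \<cdot> pt))"
    using difference_loop[OF R d] unfolding fh(3) h(3) .
  then obtain w where w: "w \<in> loops C \<iota> (m + 1) X (h \<cdot> c)" "homotopic (m + 1) (f \<cdot> w) d"
    using s[OF x] unfolding pi_surj_def h(3) by blast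
  obtain h2 where "h2 \<in> Hom C (Cub (m + 1)) X" "h2 \<cdot> inc (m + 1) = h \<cdot> inc (m + 1)"
    "homotopic (m + 1) (f \<cdot> h2) v"
    using act_difference[OF R _ f h(1) d w] by auto
  then show "\<exists>h\<in>Hom C (Cub (m + 1)) X. h \<cdot> inc (m + 1) = u \<and> homotopic (m + 1) (f \<cdot> h) v"
    unfolding h(2) by blast
qed

text \<open>Compressibility in degree \<open>k + 1\<close> governs injectivity on
  \<open>\<pi>\<^sub>k\<close> and surjectivity on \<open>\<pi>\<^sub>k\<^sub>+\<^sub>1\<close>,
  which is why the top degree \<open>n\<close> carries surjectivity alone.\<close>

lemma n_connected_iff:
  assumes f: "f \<in> Hom C X Y" and p: "points C \<iota> X \<noteq> {}"
  shows "n_connected C \<iota> n f \<longleftrightarrow> (\<forall>x\<in>points C \<iota> X.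
     (\<forall>k<n. homotopy_map_iso C \<iota> a b k f x) \<and> homotopy_map_surj C \<iota> a b n f x)"
proof
  assume "n_connected C \<iota> n f"
  then have "compressible C \<iota> k f" if "k \<le> n" for k using that by (simp add: n_connected_def)
  then show "\<forall>x\<in>points C \<iota> X. (\<forall>k<n. homotopy_map_iso C \<iota> a b k f x) \<and> homotopy_map_surj C \<iota> a b n f x"
    unfolding points_def
    using homotopy_map_iso_iff[OF f] homotopy_map_surj_iff[OF f] pi_surj_of_compressible[OF f]
      pi_inj_of_compressible[OF f] by (simp add: Suc_le_eq flip: Suc_eq_plus1)
next
  assume r: "\<forall>x\<in>points C \<iota> X. (\<forall>k<n. homotopy_map_iso C \<iota> a b k f x) \<and> homotopy_map_surj C \<iota> a b n f x"
  have inj: "pi_inj k X f x" if "k < n" "x \<in> Hom C point X" for k x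
    using r that homotopy_map_iso_iff[OF f] unfolding points_def by blast
  have surj: "pi_surj k X Y f x" if "k \<le> n" "x \<in> Hom C point X" for k x
    using r that homotopy_map_iso_iff[OF f] homotopy_map_surj_iff[OF f] unfolding points_def
    by (cases "k = n") auto
  show "n_connected C \<iota> n f"
    unfolding n_connected_def
  proof (intro allI impI)
    fix k assume k: "k \<le> n"
    show "compressible C \<iota> k f"
    proof (cases k)
      case 0
      obtain x where "x \<in> Hom C point X" using p unfolding points_def by blast
      then show ?thesis using compressible_0[OF f _ surj[of 0]] 0 by simp
    next
      case (Suc m)
      then show ?thesis using compressible_Suc[OF f inj[of m] surj[of "m + 1"]] k by (simp add: Suc_le_eq flip: Suc_eq_plus1)
    qed
  qed
qed

end

theorem theorem3p12:
  fixes C :: "('o, 'm) cat"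
    and \<iota> :: "('o, 'm) box_functor"
    and a b :: space_map
    and X Y :: 'o and f :: 'm
  assumes "uncountable (UNIV :: 'u set)"
    and "good_Q_structure TYPE('u) C \<iota>"
    and "interval_square C \<iota> a b"
    and "f \<in> Hom C X Y"
    and "points C \<iota> X \<noteq> {}"
  shows "(\<forall>n. n_connected C \<iota> n f \<longleftrightarrow>
            (\<forall>x\<in>points C \<iota> X. (\<forall>k<n. homotopy_map_iso C \<iota> a b k f x) \<and>
                               homotopy_map_surj C \<iota> a b n f x)) \<and>
         (weak_equivalence C \<iota> f \<longleftrightarrow>
            (\<forall>n. \<forall>x\<in>points C \<iota> X. homotopy_map_iso C \<iota> a b n f x))"
proof -
  interpret good_Q C \<iota> "TYPE('u)" a b
    using assms(1-3) by unfold_locales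
  have "homotopy_map_surj C \<iota> a b n f x" if "homotopy_map_iso C \<iota> a b n f x" "x \<in> points C \<iota> X" for n x
    using that homotopy_map_iso_iff[OF assms(4)] homotopy_map_surj_iff[OF assms(4)]
    by (simp add: points_def)
  \<comment> \<open>Bijectivity in degree \<open>n\<close> is read off from connectedness in degree
    \<open>n + 1\<close>, and surjectivity in degree \<open>n\<close> from bijectivity
    there.\<close>
  then show ?thesis
    unfolding weak_equivalence_def n_connected_iff[OF assms(4,5)] by (meson lessI)
qed

end
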